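(* Let $\alpha\ge0$, $1\le p<\infty$. For real parameters $b,m$ write $\mathcal{S}_{b,m}f(t)=t^{m-b}\int_0^\infty\frac{s^{b-1}}{(s+t)^m}f(s)\,ds$, $t>0$. Let $\mathcal{S}_{\beta,\mu}$ and $\mathcal{S}_{\gamma,\nu}$ be generalized Stieltjes operators on $\mathcal{T}_p^{(\alpha)}(t^\alpha)$, with $0<\beta-\frac1p<\mu$ and $0<\gamma-\frac1p<\nu$. Then for $f\in\mathcal{T}_p^{(\alpha)}(t^\alpha)$ and almost every $t\in\mathbb{R}^+$, $$\frac{\mathcal{S}_{\beta,\mu}\mathcal{S}_{\gamma,\nu}f(t)}{B(\beta+\nu-\gamma,\gamma+\mu-\beta)}=\int_0^t f(s)\frac{s^{\beta-1}}{t^\beta}\,{}_2F_1\!\left(\mu,\beta+\nu-\gamma;\mu+\nu;1-\tfrac st\right)ds+\int_t^\infty f(s)\frac{t^{\mu-\beta}}{s^{\mu-\beta+1}}\,{}_2F_1\!\left(\mu,\gamma+\mu-\beta;\mu+\nu;1-\tfrac ts\right)ds.$$ In particular, if $p>1$, $\frac1p+\frac1{p'}=1$, $0<\beta-\frac1p<\mu$, and $\mathcal{S}_{\gamma,\nu}$ is a generalized Stieltjes operator on the dual space $\mathcal{T}_{p'}^{(\alpha)}(t^\alpha)$ with $0<\gamma-\frac1{p'}<\nu$, then for $f\in\mathcal{T}_p^{(\alpha)}(t^\alpha)$ and almost every $t\in\mathbb{R}^+$, $$\frac{\mathcal{S}_{\beta,\mu}(\mathcal{S}_{\gamma,\nu})'f(t)}{B(\beta+\gamma-1,\nu-\gamma+\mu-\beta+1)}=\int_0^t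 f(s)\frac{s^{\beta-1}}{t^\beta}\,{}_2F_1\!\left(\mu,\beta+\gamma-1;\mu+\nu;1-\tfrac st\right)ds+\int_t^\infty f(s)\frac{t^{\mu-\beta}}{s^{\mu-\beta+1}}\,{}_2F_1\!\left(\mu,\nu-\gamma+\mu-\beta+1;\mu+\nu;1-\tfrac ts\right)ds,$$ where $(\mathcal{S}_{\gamma,\nu})'$ denotes the adjoint, acting on $\mathcal{T}_p^{(\alpha)}(t^\alpha)$.
   Context: $B$ is the Beta function and ${}_2F_1$ the Gaussian hypergeometric function. Let $\mathcal{S}_+$ be the Schwartz class on $[0,\infty)$. For $f\in\mathcal{S}_+$ and $\alpha>0$ put $W_+^{-\alpha}f(t)=\frac1{\Gamma(\alpha)}\int_t^\infty(s-t)^{\alpha-1}f(s)\,ds$ and $W_+^{\alpha}f(t)=(-1)^n\frac{d^n}{dt^n}W_+^{-(n-\alpha)}f(t)$ with $n=[\alpha]+1$; $W_+^0=\mathrm{Id}$. For $1\le p<\infty$ and $\alpha>0$, $\mathcal{T}_p^{(\alpha)}(t^\alpha)$ is the completion of $\mathcal{S}_+$ in the norm $\|f\|_{\alpha,p}=\frac1{\Gamma(\alpha+1)}\left(\int_0^\infty|W_+^\alpha f(t)|^p t^{\alpha p}dt\right)^{1/p}$; $\mathcal{T}_p^{(0)}(t^0)=L^p(\mathbb{R}^+)$. These spaces are continuously embedded in $L^p(\mathbb{R}^+)$ and regarded as subspaces of it. The map $D_+^\alpha f(t)=\frac1{\Gamma(\alpha+1)}t^\alpha W_+^\alpha f(t)$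 extends to an isometric isomorphism $\mathcal{T}_p^{(\alpha)}(t^\alpha)\to L^p(\mathbb{R}^+)$ with inverse (for $\alpha>0$) $(D_+^\alpha)^{-1}h(t)=\alpha\int_t^\infty(s-t)^{\alpha-1}\frac{h(s)}{s^\alpha}ds$. For $1<p<\infty$ the dual of $\mathcal{T}_p^{(\alpha)}(t^\alpha)$ is $\mathcal{T}_{p'}^{(\alpha)}(t^\alpha)$ via the bilinear pairing $\langle f,g\rangle_\alpha=\int_0^\infty D_+^\alpha f(t)\,D_+^\alpha g(t)\,dt$; the adjoint $(\cdot)'$ is taken with respect to it. The operator $\mathcal{S}_{b,m}$ is bounded on $\mathcal{T}_q^{(\alpha)}(t^\alpha)$ whenever $0<b-\frac1q<m$. *)

theory Defs
  imports "HOL-Analysis.Analysis"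
begin

text \<open>
  Functions on the half-line are total functions of type \<open>real \<Rightarrow> complex\<close>; only their values on
  \<open>{0<..}\<close> (or \<open>{0..}\<close> for Schwartz functions) matter. Elements of \<open>L\<^sup>p\<close> and of its subspaces are
  represented by functions rather than by classes modulo null sets.
\<close>

section \<open>The Gaussian hypergeometric function\<close>

text \<open>The Gauss series; it represents the function for \<open>\<bar>z\<bar> < 1\<close>.\<close>

definition hyp2F1 :: "real \<Rightarrow> real \<Rightarrow> real \<Rightarrow> real \<Rightarrow> real" where
  "hyp2F1 a b c z = eval_fps (fps_hypergeo [a, b] [c] 1) z"

lemma hyp2F1_altdef:
  "hyp2F1 a b c z =
     (\<Sum>n. pochhammer a n * pochhammer b n / (pochhammer c n * fact n) * z ^ n)"
  by (simp add: hyp2F1_def eval_fps_def)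


section \<open>Function spaces on the half-line\<close>

definition Lp_pos :: "real \<Rightarrow> (real \<Rightarrow> complex) set" where
  "Lp_pos p = {f. f \<in> borel_measurable (lebesgue_on {0<..}) \<and>
                  integrable (lebesgue_on {0<..}) (\<lambda>t. norm (f t) powr p)}"

definition Lp_norm :: "real \<Rightarrow> (real \<Rightarrow> complex) \<Rightarrow> real" where
  "Lp_norm p f = (LINT t|lebesgue_on {0<..}. norm (f t) powr p) powr (1 / p)"

text \<open>The derivative is one-sided at \<open>0\<close> and the ordinary one at every \<open>t > 0\<close>.\<close>

definition deriv_pos :: "(real \<Rightarrow> complex) \<Rightarrow> real \<Rightarrow> complex" where
  "deriv_pos f t = vector_derivative f (at t within {0..})"

definition schwartz_pos :: "(real \<Rightarrow> complex) set" where
  "schwartz_pos = {f. \<forall>n. (deriv_pos ^^ n) f differentiable_on {0..} \<and>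
     (\<forall>k::nat. bounded ((\<lambda>t. t ^ k *\<^sub>R (deriv_pos ^^ n) f t) ` {0..}))}"


section \<open>Weyl fractional calculus\<close>

definition weyl_integral :: "real \<Rightarrow> (real \<Rightarrow> complex) \<Rightarrow> real \<Rightarrow> complex" where
  "weyl_integral \<alpha> f t =
     (LINT s:{t<..}|lebesgue. (s - t) powr (\<alpha> - 1) *\<^sub>R f s) /\<^sub>R Gamma \<alpha>"

definition weyl_deriv :: "real \<Rightarrow> (real \<Rightarrow> complex) \<Rightarrow> real \<Rightarrow> complex" where
  "weyl_deriv \<alpha> f =
     (if \<alpha> = 0 then f
      else let n = nat \<lfloor>\<alpha>\<rfloor> + 1
           in (\<lambda>t. (-1) ^ n * (deriv_pos ^^ n) (weyl_integral (real n - \<alpha>) f) t))"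

definition D_plus :: "real \<Rightarrow> (real \<Rightarrow> complex) \<Rightarrow> real \<Rightarrow> complex" where
  "D_plus \<alpha> f t = (t powr \<alpha> / Gamma (\<alpha> + 1)) *\<^sub>R weyl_deriv \<alpha> f t"


section \<open>The spaces \<open>\<T>\<^sub>p\<close> of fractional order\<close>

definition T_norm :: "real \<Rightarrow> real \<Rightarrow> (real \<Rightarrow> complex) \<Rightarrow> real" where
  "T_norm \<alpha> p f =
     1 / Gamma (\<alpha> + 1) *
     (LINT t|lebesgue_on {0<..}. norm (weyl_deriv \<alpha> f t) powr p * t powr (\<alpha> * p)) powr (1 / p)"

text \<open>
  The completion of the Schwartz class in \<open>T_norm\<close> is realised inside \<open>L\<^sup>p\<close>: the element given by a
  \<open>T_norm\<close>-Cauchy sequence \<open>\<phi>\<close> is identified with the \<open>L\<^sup>p\<close>-limit of \<open>\<phi>\<close>.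
\<close>

definition represents :: "real \<Rightarrow> real \<Rightarrow> (nat \<Rightarrow> real \<Rightarrow> complex) \<Rightarrow> (real \<Rightarrow> complex) \<Rightarrow> bool" where
  "represents \<alpha> p \<phi> f \<longleftrightarrow>
     (\<forall>n. \<phi> n \<in> schwartz_pos) \<and>
     (\<forall>e>0. \<exists>N. \<forall>m\<ge>N. \<forall>n\<ge>N. T_norm \<alpha> p (\<lambda>t. \<phi> m t - \<phi> n t) < e) \<and>
     (\<lambda>n. Lp_norm p (\<lambda>t. \<phi> n t - f t)) \<longlonglongrightarrow> 0"

definition T_space :: "real \<Rightarrow> real \<Rightarrow> (real \<Rightarrow> complex) set" where
  "T_space \<alpha> p = (if \<alpha> = 0 then Lp_pos p else {f \<in> Lp_pos p. \<exists>\<phi>. represents \<alpha> p \<phi> f})"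

text \<open>
  The extension of \<open>D_plus\<close> from the Schwartz class to \<open>T_space \<alpha> p\<close> by continuity; its value is
  determined up to equality almost everywhere.
\<close>

definition D_ext :: "real \<Rightarrow> real \<Rightarrow> (real \<Rightarrow> complex) \<Rightarrow> real \<Rightarrow> complex" where
  "D_ext \<alpha> p f =
     (if \<alpha> = 0 then f
      else SOME h. h \<in> Lp_pos p \<and>
             (\<exists>\<phi>. represents \<alpha> p \<phi> f \<and>
                  (\<lambda>n. Lp_norm p (\<lambda>t. D_plus \<alpha> (\<phi> n) t - h t)) \<longlonglongrightarrow> 0))"

text \<open>
  The bilinear (not sesquilinear) pairing of \<open>f \<in> T_space \<alpha> p\<close> with \<open>g \<in> T_space \<alpha> q\<close>,
  where \<open>q\<close> is the conjugate exponent of \<open>p\<close>.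
\<close>

definition T_pairing ::
    "real \<Rightarrow> real \<Rightarrow> real \<Rightarrow> (real \<Rightarrow> complex) \<Rightarrow> (real \<Rightarrow> complex) \<Rightarrow> complex" where
  "T_pairing \<alpha> p q f g = (LINT t|lebesgue_on {0<..}. D_ext \<alpha> p f t * D_ext \<alpha> q g t)"

text \<open>
  For an operator \<open>A\<close> on \<open>T_space \<alpha> q\<close>, its adjoint acts on \<open>T_space \<alpha> p\<close>, the dual of
  \<open>T_space \<alpha> q\<close> under the pairing. The value is determined up to equality almost everywhere.
\<close>

definition T_adjoint ::
    "real \<Rightarrow> real \<Rightarrow> real \<Rightarrow> ((real \<Rightarrow> complex) \<Rightarrow> real \<Rightarrow> complex)
       \<Rightarrow> (real \<Rightarrow> complex) \<Rightarrow> real \<Rightarrow> complex" where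
  "T_adjoint \<alpha> p q A f =
     (SOME u. u \<in> T_space \<alpha> p \<and>
        (\<forall>g\<in>T_space \<alpha> q. T_pairing \<alpha> p q u g = T_pairing \<alpha> p q f (A g)))"


section \<open>Generalized Stieltjes operators\<close>

definition stieltjes :: "real \<Rightarrow> real \<Rightarrow> (real \<Rightarrow> complex) \<Rightarrow> real \<Rightarrow> complex" where
  "stieltjes b m f t =
     t powr (m - b) *\<^sub>R (LINT s:{0<..}|lebesgue. (s powr (b - 1) / (s + t) powr m) *\<^sub>R f s)"

end

theory Submission
  imports Defs
begin

text \<open>
  Every operator involved is a superposition of dilations
  \<open>dil k f t = \<integral>\<^sub>0\<^sup>\<infinity> k(u) f(t u) du\<close> with a nonnegative kernel. Such operators are bounded on
  \<open>L\<^sup>p\<close> as soon as \<open>\<integral> k(u) u\<^bsup>-1/p\<^esup> du < \<infinity>\<close>, they commute, they compose by multiplicative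
  convolution of the kernels, and the transpose of \<open>k\<close> is \<open>k(1/u)/u\<close>.

  The kernel of \<open>\<S>\<^bsub>b,m\<^esub>\<close> is \<open>u\<^bsup>b-1\<^esup>/(1+u)\<^sup>m\<close>. The convolution of two of these is a pencil
  \<open>\<integral> x\<^bsup>b-1\<^esup> (1+x)\<^bsup>-\<nu>\<^esup> (1+w x)\<^bsup>-\<mu>\<^esup> dx\<close>, and \<open>x = v/(1-v)\<close> turns it into Euler's integral for
  \<open>\<^sub>2F\<^sub>1\<close>, of argument \<open>1-w\<close> if \<open>w \<le> 1\<close> and, after \<open>v \<mapsto> 1-v\<close>, of argument \<open>1-1/w\<close> if
  \<open>w \<ge> 1\<close>. This is the first formula.

  For the adjoint, the inverse of \<open>D\<^sub>+\<^sup>\<alpha>\<close> is itself a dilation operator, of Erdelyi-Kober type, so it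
  commutes with \<open>\<S>\<^bsub>\<gamma>,\<nu>\<^esub>\<close>; it identifies \<open>\<T>\<^sub>p\<close> with \<open>L\<^sup>p\<close> because it is injective and because the
  functions \<open>D\<^sub>+\<^sup>\<alpha> \<phi>\<close> are dense. Hence the adjoint is computed in \<open>L\<^sup>p\<close>, where it is the transpose
  \<open>\<S>\<^bsub>\<nu>-\<gamma>+1,\<nu>\<^esub>\<close>, and the second formula is an instance of the first.
\<close>

section \<open>Dilation operators on the half-line\<close>

text \<open>Elements of the spaces are functions that are only Lebesgue measurable and arbitrary off
  the half-line, and \<open>D_ext\<close> and \<open>T_adjoint\<close> are choices by
  \<open>SOME\<close>. Identities between elements are therefore proved almost everywhere, for Borel
  representatives over \<open>lpos\<close>, and a choice is controlled by showing that all
  admissible values agree almost everywhere. A divergent Bochner integral is 0, so every exchange of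
  integrals needs absolute convergence beforehand. One Minkowski-type bound over an arbitrary
  sigma-finite measure provides it: on the half-line for a single operator, on its square for a
  composition. Only boundedness counts, so factors such as 2^p are tolerated. Kernels are
  nonnegative and the Gauss series is used only on [0,1), so convolutions are computed in
  \<open>ennreal\<close>, free of convergence questions. The inverse of the fractional derivative is
  not found by inverting a derivative: Taylor's formula with remainder at infinity writes a Schwartz
  function as an Erdelyi-Kober image of integer order, and the semigroup law splits that order at
  \<alpha>. Exponentials, being eigenfunctions of the Weyl derivative, give the density.\<close>

definition lpos :: "real measure" where
  "lpos = density lborel (indicator {0<..})"

lemma sets_lpos [measurable_cong, simp]: "sets lpos = sets borel"
  by (simp add: lpos_def)

lemma space_lpos [simp]: "space lpos = UNIV"
  by (simp add: lpos_def)

lemma nn_integral_lpos: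
  "f \<in> borel_measurable borel \<Longrightarrow>
     (\<integral>\<^sup>+x. f x \<partial>lpos) = (\<integral>\<^sup>+x. indicator {0<..} x * f x \<partial>lborel)"
  unfolding lpos_def by (subst nn_integral_density) auto

lemma AE_lpos: "(AE x in lpos. P x) \<longleftrightarrow> (AE x in lborel. 0 < x \<longrightarrow> P x)"
proof -
  have "(AE x in lpos. P x) \<longleftrightarrow> (AE x in lborel. 0 < (indicator {0<..} x :: ennreal) \<longrightarrow> P x)"
    unfolding lpos_def by (rule AE_density) auto
  then show ?thesis by (simp add: indicator_def)
qed

lemma AE_lpos_pos: "AE x in lpos. 0 < x"
  by (simp add: AE_lpos)

lemma AE_lposI: "(\<And>x. 0 < x \<Longrightarrow> P x) \<Longrightarrow> AE x in lpos. P x"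
  by (simp add: AE_lpos)

interpretation lpos: sigma_finite_measure lpos
  unfolding lpos_def
  by (subst sigma_finite_measure.sigma_finite_iff_density_finite[OF sigma_finite_lborel])
    (auto simp: indicator_def)

interpretation lpos2: pair_sigma_finite lpos lpos ..

lemma nn_integral_lpos_cong:
  "(\<And>x. 0 < x \<Longrightarrow> f x = g x) \<Longrightarrow> (\<integral>\<^sup>+x. f x \<partial>lpos) = (\<integral>\<^sup>+x. g x \<partial>lpos)"
  by (rule nn_integral_cong_AE) (auto simp: AE_lpos)

lemma integral_lpos_cong:
  fixes f g :: "real \<Rightarrow> 'a::{banach, second_countable_topology}"
  assumes "f \<in> borel_measurable borel" "g \<in> borel_measurable borel"
    and "\<And>x. 0 < x \<Longrightarrow> f x = g x"
  shows "(LINT x|lpos. f x) = (LINT x|lpos. g x)"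
  by (rule integral_cong_AE) (use assms in \<open>auto simp: AE_lpos\<close>)

lemma nn_integral_lpos_scale:
  assumes [measurable]: "g \<in> borel_measurable borel" and c: "0 < c"
  shows "(\<integral>\<^sup>+x. g (c * x) \<partial>lpos) = ennreal (1 / c) * (\<integral>\<^sup>+x. g x \<partial>lpos)"
proof -
  have "(\<integral>\<^sup>+x. g x \<partial>lpos) = (\<integral>\<^sup>+x. indicator {0<..} x * g x \<partial>lborel)"
    by (simp add: nn_integral_lpos)
  also have "\<dots> = ennreal \<bar>c\<bar> * (\<integral>\<^sup>+x. indicator {0<..} (0 + c * x) * g (0 + c * x) \<partial>lborel)"
    by (rule nn_integral_real_affine) (use c in auto)
  also have "(\<integral>\<^sup>+x. indicator {0<..} (0 + c * x) * g (0 + c * x) \<partial>lborel) = (\<integral>\<^sup>+x. g (c * x) \<partial>lpos)"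
    using c by (subst nn_integral_lpos) (auto intro!: nn_integral_cong simp: indicator_def zero_less_mult_iff)
  finally show ?thesis
    using c by (simp add: mult.assoc [symmetric] ennreal_mult' [symmetric])
qed

lemma AE_lpos_scale:
  assumes "AE x in lpos. P x" "0 < c"
  shows "AE x in lpos. P (c * x)"
proof -
  obtain N where N: "{x \<in> space lpos. \<not> P x} \<subseteq> N" "emeasure lpos N = 0" "N \<in> sets lpos"
    using AE_E[OF assms(1)] by blast
  then have [measurable]: "N \<in> sets borel" by simp
  have "(\<integral>\<^sup>+x. indicator N (c * x) \<partial>lpos) = ennreal (1 / c) * (\<integral>\<^sup>+x. indicator N x \<partial>lpos)"
    using assms by (intro nn_integral_lpos_scale) auto
  also have "\<dots> = 0" using N by simp
  finally have "AE x in lpos. indicator N (c * x) = (0::ennreal)"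
    by (subst (asm) nn_integral_0_iff_AE) auto
  then show ?thesis
  proof eventually_elim
    case (elim x)
    then show ?case using N(1) by (auto simp: indicator_def split: if_splits)
  qed
qed

lemma integrable_lpos_scale:
  fixes g :: "real \<Rightarrow> 'a::{banach, second_countable_topology}"
  assumes [measurable]: "g \<in> borel_measurable borel" and c: "0 < c"
  shows "integrable lpos (\<lambda>x. g (c * x)) \<longleftrightarrow> integrable lpos g"
proof -
  have "(\<integral>\<^sup>+x. ennreal (norm (g (c * x))) \<partial>lpos) = ennreal (1 / c) * (\<integral>\<^sup>+x. ennreal (norm (g x)) \<partial>lpos)"
    using nn_integral_lpos_scale[of "\<lambda>x. ennreal (norm (g x))" c] c by simp
  with c show ?thesis
    by (auto simp: integrable_iff_bounded ennreal_mult_less_top)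
qed

lemma integral_lpos_scale:
  fixes g :: "real \<Rightarrow> 'a::{banach, second_countable_topology}"
  assumes [measurable]: "g \<in> borel_measurable borel" and c: "0 < c"
  shows "(LINT x|lpos. g (c * x)) = (LINT x|lpos. g x) /\<^sub>R c"
proof -
  have "(LINT x|lpos. g x) = (LINT x|lborel. indicat_real {0<..} x *\<^sub>R g x)"
    unfolding lpos_def by (subst integral_density[symmetric]) (auto simp: ennreal_indicator)
  also have "\<dots> = \<bar>c\<bar> *\<^sub>R (LINT x|lborel. indicat_real {0<..} (0 + c * x) *\<^sub>R g (0 + c * x))"
    by (rule lborel_integral_real_affine) (use c in auto)
  also have "(LINT x|lborel. indicat_real {0<..} (0 + c * x) *\<^sub>R g (0 + c * x)) =
      (LINT x|lborel. indicat_real {0<..} x *\<^sub>R g (c * x))"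
    using c by (intro Bochner_Integration.integral_cong) (auto simp: indicator_def zero_less_mult_iff)
  also have "\<dots> = (LINT x|lpos. g (c * x))"
    unfolding lpos_def by (subst integral_density[symmetric]) (auto simp: ennreal_indicator)
  finally show ?thesis using c by simp
qed

text \<open>The p-th power of the norm, with values in \<open>ennreal\<close>: finiteness and limits
  become statements about one number, and domination needs no integrability. The triangle inequality
  survives up to the factor 2^p (\<open>Ip_add\<close>), which suffices for limits.\<close>

definition Ip :: "real \<Rightarrow> (real \<Rightarrow> complex) \<Rightarrow> ennreal" where
  "Ip p f = (\<integral>\<^sup>+t. ennreal (norm (f t) powr p) \<partial>lpos)"

definition Lp :: "real \<Rightarrow> (real \<Rightarrow> complex) set" where
  "Lp p = {f \<in> borel_measurable borel. Ip p f < \<infinity>}"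

lemma LpD: "f \<in> Lp p \<Longrightarrow> f \<in> borel_measurable borel" "f \<in> Lp p \<Longrightarrow> Ip p f < \<infinity>"
  by (auto simp: Lp_def)

definition dil :: "(real \<Rightarrow> real) \<Rightarrow> (real \<Rightarrow> complex) \<Rightarrow> real \<Rightarrow> complex" where
  "dil k f t = (LINT u|lpos. k u *\<^sub>R f (t * u))"

section \<open>Boundedness of superpositions of dilations on L^p\<close>

lemma powr_tangent_bound:
  fixes a x p :: real
  assumes "0 < a" "0 \<le> x" "1 \<le> p"
  shows "x \<le> a + a powr (1 - p) * x powr p"
proof (cases "x \<le> a")
  case True
  then show ?thesis by (smt (verit) mult_nonneg_nonneg powr_ge_zero)
next
  case False
  then have x: "a < x" "0 < x" using assms by auto
  have "x = x powr (1 - p) * x powr p"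
    using x by (simp add: powr_add [symmetric])
  also have "\<dots> \<le> a powr (1 - p) * x powr p"
    using x assms by (intro mult_right_mono powr_mono2') auto
  finally show ?thesis using assms by linarith
qed

text \<open>The choice a = (b/A)^(1/p) balances the two terms, so that x \<le> 2 A a; its p-th power
  is the source of the constant in \<open>dilation_bound\<close>. For b = 0 this a would vanish, and
  a is sent to 0 instead.\<close>

lemma powr_bound_of_tangents:
  fixes x A b p :: real
  assumes x: "0 \<le> x" and le: "\<And>a. 0 < a \<Longrightarrow> x \<le> a * A + a powr (1 - p) * b"
    and "0 < A" "0 \<le> b" "1 \<le> p"
  shows "x powr p \<le> (2 * A) powr p / A * b"
proof (cases "b = 0")
  case True
  have "x \<le> 0 + e" if "0 < e" for e
    using le[of "e / A"] divide_pos_pos[OF that \<open>0 < A\<close>] \<open>0 < A\<close> True by simp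
  then have "x \<le> 0" using field_le_epsilon[of x 0] by blast
  then show ?thesis using x True by simp
next
  case False
  with \<open>0 \<le> b\<close> have b: "0 < b" by simp
  define a where "a = (b / A) powr (1 / p)"
  have a: "0 < a" using b \<open>0 < A\<close> by (simp add: a_def)
  have ap: "a powr p = b / A" using b assms by (simp add: a_def powr_powr)
  have "a powr (1 - p) * b = a * b / a powr p"
    using a by (simp add: powr_diff)
  also have "\<dots> = a * A" using b assms by (simp add: ap)
  finally have "x \<le> 2 * A * a" using le[OF a] by simp
  then have "x powr p \<le> (2 * A * a) powr p" using x assms by (intro powr_mono2) auto
  also have "\<dots> = (2 * A) powr p / A * b" using a assms by (simp add: powr_mult ap)
  finally show ?thesis .
qed

text \<open>
  Minkowski's integral inequality up to a constant: with \<open>x = d\<^bsup>1/p\<^esup> \<bar>f(t d)\<bar>\<close>, one integrates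
  \<open>x \<le> a + a\<^bsup>1-p\<^esup> x\<^sup>p\<close> against \<open>\<kappa> d\<^bsup>-1/p\<^esup>\<close> and optimises over \<open>a\<close>.
\<close>

lemma
  fixes f :: "real \<Rightarrow> complex" and \<kappa> d :: "'a \<Rightarrow> real"
  assumes M: "sigma_finite_measure M"
    and [measurable]: "\<kappa> \<in> borel_measurable M" "d \<in> borel_measurable M" "f \<in> borel_measurable borel"
    and \<kappa>: "\<And>w. 0 \<le> \<kappa> w" and d: "\<And>w. \<kappa> w \<noteq> 0 \<Longrightarrow> 0 < d w"
    and p: "1 \<le> p" and A: "(\<integral>\<^sup>+w. ennreal (\<kappa> w * d w powr (-1/p)) \<partial>M) \<le> ennreal A" "0 < A"
  defines "X \<equiv> \<lambda>t. \<integral>\<^sup>+w. ennreal (\<kappa> w * norm (f (t * d w))) \<partial>M"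
  shows dilation_bound: "(\<integral>\<^sup>+t. ennreal (enn2real (X t) powr p) \<partial>lpos) \<le> ennreal ((2 * A) powr p) * Ip p f"
    and dilation_AE_finite: "Ip p f < \<infinity> \<Longrightarrow> AE t in lpos. X t < \<infinity>"
proof -
  interpret M: sigma_finite_measure M by fact
  interpret P: pair_sigma_finite lpos M ..
  \<comment> \<open>The term x^p weighted by \<kappa> d^(-1/p) has d to the power 1 - 1/p.
    Integration over t scales by 1/d and restores the exponent -1/p of the moment
    hypothesis.\<close>
  define B where "B t = (\<integral>\<^sup>+w. ennreal (\<kappa> w * d w powr (1 - 1/p) * norm (f (t * d w)) powr p) \<partial>M)" for t
  have [measurable]: "B \<in> borel_measurable borel" "X \<in> borel_measurable borel"
    unfolding B_def X_def by measurable
  have "(\<integral>\<^sup>+t. B t \<partial>lpos) =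
      (\<integral>\<^sup>+w. (\<integral>\<^sup>+t. ennreal (\<kappa> w * d w powr (1 - 1/p) * norm (f (t * d w)) powr p) \<partial>lpos) \<partial>M)"
    unfolding B_def by (rule P.Fubini'[symmetric]) simp
  also have "\<dots> = (\<integral>\<^sup>+w. ennreal (\<kappa> w * d w powr (-1/p)) * Ip p f \<partial>M)"
  proof (rule nn_integral_cong)
    fix w
    show "(\<integral>\<^sup>+t. ennreal (\<kappa> w * d w powr (1 - 1/p) * norm (f (t * d w)) powr p) \<partial>lpos) =
        ennreal (\<kappa> w * d w powr (-1/p)) * Ip p f"
    proof (cases "\<kappa> w = 0")
      case False
      then have dw: "0 < d w" by (rule d)
      have "(\<integral>\<^sup>+t. ennreal (\<kappa> w * d w powr (1 - 1/p) * norm (f (t * d w)) powr p) \<partial>lpos) =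
          (\<integral>\<^sup>+t. ennreal (\<kappa> w * d w powr (1 - 1/p)) * ennreal (norm (f (d w * t)) powr p) \<partial>lpos)"
        using \<kappa> by (simp add: ennreal_mult mult.commute)
      also have "\<dots> = ennreal (\<kappa> w * d w powr (1 - 1/p)) * (\<integral>\<^sup>+t. ennreal (norm (f (d w * t)) powr p) \<partial>lpos)"
        by (rule nn_integral_cmult) simp
      also have "(\<integral>\<^sup>+t. ennreal (norm (f (d w * t)) powr p) \<partial>lpos) = ennreal (1 / d w) * Ip p f"
        unfolding Ip_def using dw by (intro nn_integral_lpos_scale) auto
      also have "ennreal (\<kappa> w * d w powr (1 - 1/p)) * (ennreal (1 / d w) * Ip p f) =
          ennreal (\<kappa> w * d w powr (1 - 1/p) * (1 / d w)) * Ip p f"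
        using \<kappa>[of w] dw
          by (subst ennreal_mult[of _ "1 / d w"]) (auto simp: mult.assoc)
      also have "\<kappa> w * d w powr (1 - 1/p) * (1 / d w) = \<kappa> w * d w powr (-1/p)"
        using dw by (simp add: powr_diff powr_minus field_simps)
      finally show ?thesis .
    qed simp
  qed
  also have "\<dots> = (\<integral>\<^sup>+w. ennreal (\<kappa> w * d w powr (-1/p)) \<partial>M) * Ip p f"
    by (rule nn_integral_multc) simp
  also have "\<dots> \<le> ennreal A * Ip p f"
    by (intro mult_right_mono A) simp
  finally have IB: "(\<integral>\<^sup>+t. B t \<partial>lpos) \<le> ennreal A * Ip p f" .
  have XB: "X t \<le> ennreal (a * A) + ennreal (a powr (1 - p)) * B t" if "0 < a" for a t
  proof -
    have "X t \<le> (\<integral>\<^sup>+w. ennreal a * ennreal (\<kappa> w * d w powr (-1/p)) +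
        ennreal (a powr (1 - p)) * ennreal (\<kappa> w * d w powr (1 - 1/p) * norm (f (t * d w)) powr p) \<partial>M)"
      unfolding X_def
    proof (rule nn_integral_mono)
      fix w
      have "\<kappa> w * norm (f (t * d w)) \<le> a * (\<kappa> w * d w powr (-1/p)) +
          a powr (1 - p) * (\<kappa> w * d w powr (1 - 1/p) * norm (f (t * d w)) powr p)"
      proof (cases "\<kappa> w = 0")
        case False
        then have dw: "0 < d w" by (rule d)
        let ?x = "d w powr (1/p) * norm (f (t * d w))"
        have "?x \<le> a + a powr (1 - p) * ?x powr p"
          using p that by (intro powr_tangent_bound) auto
        also have "?x powr p = d w * norm (f (t * d w)) powr p"
          using p dw by (simp add: powr_mult powr_powr)
        finally have "(\<kappa> w * d w powr (-1/p)) * ?x \<le>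
            (\<kappa> w * d w powr (-1/p)) * (a + a powr (1 - p) * (d w * norm (f (t * d w)) powr p))"
          using \<kappa> by (intro mult_left_mono) auto
        moreover have "d w powr (-1/p) * d w powr (1/p) = 1"
          using dw by (simp add: powr_add [symmetric])
        then have "(\<kappa> w * d w powr (-1/p)) * ?x = \<kappa> w * norm (f (t * d w))"
          by (metis (no_types, lifting) mult.assoc mult_1)
        moreover have "d w powr (1 - 1/p) = d w powr (-1/p) * d w"
          using dw by (simp add: powr_diff powr_minus field_simps)
        then have "(\<kappa> w * d w powr (-1/p)) * (a + a powr (1 - p) * (d w * norm (f (t * d w)) powr p)) =
            a * (\<kappa> w * d w powr (-1/p)) +
            a powr (1 - p) * (\<kappa> w * d w powr (1 - 1/p) * norm (f (t * d w)) powr p)"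
          by (simp only: algebra_simps)
        ultimately show ?thesis by argo
      qed simp
      then have "ennreal (\<kappa> w * norm (f (t * d w))) \<le> ennreal (a * (\<kappa> w * d w powr (-1/p)) +
          a powr (1 - p) * (\<kappa> w * d w powr (1 - 1/p) * norm (f (t * d w)) powr p))"
        by (rule ennreal_leI)
      also have "\<dots> = ennreal a * ennreal (\<kappa> w * d w powr (-1/p)) +
        ennreal (a powr (1 - p)) * ennreal (\<kappa> w * d w powr (1 - 1/p) * norm (f (t * d w)) powr p)"
        using \<kappa> that by (subst ennreal_plus) (auto simp: ennreal_mult)
      finally show "ennreal (\<kappa> w * norm (f (t * d w))) \<le> \<dots>" .
    qed
    also have "\<dots> = ennreal a * (\<integral>\<^sup>+w. ennreal (\<kappa> w * d w powr (-1/p)) \<partial>M) + ennreal (a powr (1 - p)) * B t"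
      unfolding B_def by (subst nn_integral_add) (auto simp: nn_integral_cmult)
    also have "\<dots> \<le> ennreal a * ennreal A + ennreal (a powr (1 - p)) * B t"
      using A by (intro add_right_mono mult_left_mono) auto
    finally show ?thesis using that A by (simp add: ennreal_mult)
  qed
  have fin: "X t < \<infinity>" if "B t < \<infinity>" for t
    using XB[of 1 t] that by (simp add: order_le_less_trans ennreal_add_eq_top less_top [symmetric])
      (metis ennreal_add_eq_top ennreal_neq_top infinity_ennreal_def neq_top_trans)
  have pt: "ennreal (enn2real (X t) powr p) \<le> ennreal ((2 * A) powr p / A) * B t" for t
  proof (cases "B t = \<infinity>")
    case True
    then show ?thesis using A by (simp add: ennreal_mult_top)
  next
    case False
    then obtain b where b: "B t = ennreal b" "0 \<le> b" by (cases "B t") auto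
    have "enn2real (X t) \<le> a * A + a powr (1 - p) * b" if "0 < a" for a
    proof -
      have "enn2real (X t) \<le> enn2real (ennreal (a * A + a powr (1 - p) * b))"
        using XB[OF that, of t] b that A by (intro enn2real_mono) (auto simp: ennreal_mult ennreal_mult_less_top)
      then show ?thesis using b that A by (simp del: ennreal_plus)
    qed
    then have "enn2real (X t) powr p \<le> (2 * A) powr p / A * b"
      using A b p by (intro powr_bound_of_tangents) auto
    then show ?thesis using b A by (simp add: ennreal_mult [symmetric])
  qed
  have "(\<integral>\<^sup>+t. ennreal (enn2real (X t) powr p) \<partial>lpos) \<le> (\<integral>\<^sup>+t. ennreal ((2 * A) powr p / A) * B t \<partial>lpos)"
    by (intro nn_integral_mono pt)
  also have "\<dots> \<le> ennreal ((2 * A) powr p / A) * (ennreal A * Ip p f)"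
    by (subst nn_integral_cmult) (auto intro!: mult_left_mono IB)
  also have "\<dots> = ennreal ((2 * A) powr p) * Ip p f"
    using A by (simp add: mult.assoc [symmetric] ennreal_mult' [symmetric])
  finally show "(\<integral>\<^sup>+t. ennreal (enn2real (X t) powr p) \<partial>lpos) \<le> ennreal ((2 * A) powr p) * Ip p f" .
  assume "Ip p f < \<infinity>"
  then have "(\<integral>\<^sup>+t. B t \<partial>lpos) < \<infinity>"
    using IB by (simp add: order_le_less_trans ennreal_mult_less_top)
  then have "AE t in lpos. B t \<noteq> \<infinity>"
    by (intro nn_integral_PInf_AE) auto
  then show "AE t in lpos. X t < \<infinity>"
    by eventually_elim (use fin less_top in auto)
qed

text \<open>The moment condition sums the norms \<open>u\<^bsup>-1/p\<^esup>\<close> of the dilations \<open>f \<mapsto> f(\<cdot> u)\<close> on \<open>L\<^sup>p\<close>.\<close>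

definition kern :: "real \<Rightarrow> (real \<Rightarrow> real) \<Rightarrow> bool" where
  "kern p k \<longleftrightarrow> k \<in> borel_measurable borel \<and> (\<forall>u. 0 \<le> k u) \<and> (\<forall>u\<le>0. k u = 0) \<and>
     (\<integral>\<^sup>+u. ennreal (k u * u powr (-1/p)) \<partial>lpos) < \<infinity>"

lemma kernD:
  assumes "kern p k"
  shows "k \<in> borel_measurable borel" "0 \<le> k u" "k u \<noteq> 0 \<Longrightarrow> 0 < u"
    "(\<integral>\<^sup>+u. ennreal (k u * u powr (-1/p)) \<partial>lpos) < \<infinity>"
  using assms by (auto simp: kern_def not_le[symmetric])

lemma kern_moment_bound:
  assumes "kern p k"
  obtains A where "0 < A" "(\<integral>\<^sup>+u. ennreal (k u * u powr (-1/p)) \<partial>lpos) \<le> ennreal A"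
proof -
  obtain a where "(\<integral>\<^sup>+u. ennreal (k u * u powr (-1/p)) \<partial>lpos) = ennreal a" "0 \<le> a"
    using kernD(4)[OF assms] by (cases "\<integral>\<^sup>+u. ennreal (k u * u powr (-1/p)) \<partial>lpos") auto
  \<comment> \<open>The moment a may be 0, while \<open>dilation_bound\<close> divides by its bound;
    a + 1 is positive in any case.\<close>
  then show ?thesis using that[of "a + 1"] by (simp add: ennreal_leI)
qed

lemma dil_measurable [measurable]:
  assumes [measurable]: "k \<in> borel_measurable borel" "f \<in> borel_measurable borel"
  shows "dil k f \<in> borel_measurable borel"
  unfolding dil_def[abs_def] by measurable

lemma dil_AE_integrable:
  assumes "kern p k" "f \<in> Lp p" "1 \<le> p"
  shows "AE t in lpos. integrable lpos (\<lambda>u. k u *\<^sub>R f (t * u))"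
proof -
  note [measurable] = kernD(1)[OF assms(1)] LpD(1)[OF assms(2)]
  obtain A where A: "0 < A" "(\<integral>\<^sup>+u. ennreal (k u * u powr (-1/p)) \<partial>lpos) \<le> ennreal A"
    using kern_moment_bound[OF assms(1)] .
  have "AE t in lpos. (\<integral>\<^sup>+u. ennreal (k u * norm (f (t * u))) \<partial>lpos) < \<infinity>"
    by (rule dilation_AE_finite[where p = p and A = A])
      (use A assms LpD[OF assms(2)] kernD[OF assms(1)] lpos.sigma_finite_measure_axioms in auto)
  then show ?thesis
    by eventually_elim (use kernD(2)[OF assms(1)] in \<open>simp add: integrable_iff_bounded\<close>)
qed

lemma dil_bounded:
  assumes "kern p k" "1 \<le> p"
  obtains C where "0 \<le> C" "\<And>f. f \<in> borel_measurable borel \<Longrightarrow> Ip p (dil k f) \<le> ennreal C * Ip p f"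
proof -
  note [measurable] = kernD(1)[OF assms(1)]
  obtain A where A: "0 < A" "(\<integral>\<^sup>+u. ennreal (k u * u powr (-1/p)) \<partial>lpos) \<le> ennreal A"
    using kern_moment_bound[OF assms(1)] .
  have "Ip p (dil k f) \<le> ennreal ((2 * A) powr p) * Ip p f"
    if [measurable]: "f \<in> borel_measurable borel" for f
  proof -
    let ?X = "\<lambda>t. \<integral>\<^sup>+u. ennreal (k u * norm (f (t * u))) \<partial>lpos"
    \<comment> \<open>Where the integral diverges, \<open>dil k f t\<close> is 0 by convention and
      the bound is trivial. It thus holds at every t and for every Borel f, also when
      \<open>Ip p f\<close> is infinite.\<close>
    have "norm (dil k f t) \<le> enn2real (?X t)" for t
    proof (cases "integrable lpos (\<lambda>u. k u *\<^sub>R f (t * u))")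
      case True
      have "ennreal (norm (dil k f t)) \<le> ?X t"
        unfolding dil_def using integral_norm_bound_ennreal[OF True] kernD(2)[OF assms(1)] by simp
      moreover have "?X t < \<infinity>" using True kernD(2)[OF assms(1)] by (simp add: integrable_iff_bounded)
      ultimately show ?thesis
        by (metis enn2real_ennreal enn2real_mono infinity_ennreal_def norm_ge_zero)
    qed (simp add: dil_def not_integrable_integral_eq)
    then have "Ip p (dil k f) \<le> (\<integral>\<^sup>+t. ennreal (enn2real (?X t) powr p) \<partial>lpos)"
      unfolding Ip_def using assms(2) by (intro nn_integral_mono ennreal_leI powr_mono2) auto
    also have "\<dots> \<le> ennreal ((2 * A) powr p) * Ip p f"
      by (rule dilation_bound)
        (use A assms kernD[OF assms(1)] lpos.sigma_finite_measure_axioms in auto)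
    finally show ?thesis .
  qed
  then show ?thesis using that[of "(2 * A) powr p"] by simp
qed

lemma dil_Lp:
  assumes "kern p k" "f \<in> Lp p" "1 \<le> p"
  shows "dil k f \<in> Lp p"
proof -
  note [measurable] = kernD(1)[OF assms(1)] LpD(1)[OF assms(2)]
  obtain C where C: "\<And>f. f \<in> borel_measurable borel \<Longrightarrow> Ip p (dil k f) \<le> ennreal C * Ip p f"
    using dil_bounded[OF assms(1,3)] by blast
  have "Ip p (dil k f) \<le> ennreal C * Ip p f" by (rule C) simp
  also have "\<dots> < \<infinity>" using LpD(2)[OF assms(2)] by (simp add: ennreal_mult_less_top)
  finally show ?thesis by (simp add: Lp_def)
qed

lemma dil_cong_AE:
  assumes [measurable]: "k \<in> borel_measurable borel" "f \<in> borel_measurable borel" "g \<in> borel_measurable borel"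
    and "AE x in lpos. f x = g x" "0 < t"
  shows "dil k f t = dil k g t"
  unfolding dil_def
proof (rule integral_cong_AE)
  show "AE u in lpos. k u *\<^sub>R f (t * u) = k u *\<^sub>R g (t * u)"
    using AE_lpos_scale[OF assms(4,5)] by eventually_elim simp
qed measurable

section \<open>Algebra of dilation operators: scalars, commutation, composition\<close>

lemma dil_cmult: "dil k (\<lambda>x. c * f x) t = c * dil k f t"
  unfolding dil_def by (subst integral_mult_right_zero [symmetric]) simp

lemma dil_kernel_cmult: "dil (\<lambda>u. c * k u) f t = c *\<^sub>R dil k f t"
  unfolding dil_def by (subst integral_scaleR_right [symmetric]) simp

text \<open>The bound for dilations is applied on the product space, with weight k(u) l(v) and
  dilation factor u v; its moment factors into the moments of k and l. The absolute convergence
  obtained here justifies Fubini both for commuting and for composing operators.\<close>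

lemma dil_dil_AE_integrable:
  assumes k: "kern p k" and l: "kern p l" and f: "f \<in> Lp p" and p: "1 \<le> p"
  shows "AE t in lpos. integrable (lpos \<Otimes>\<^sub>M lpos) (\<lambda>(u, v). (k u * l v) *\<^sub>R f (t * (u * v)))"
proof -
  note [measurable] = kernD(1)[OF k] kernD(1)[OF l] LpD(1)[OF f]
  obtain A where A: "0 < A" "(\<integral>\<^sup>+u. ennreal (k u * u powr (-1/p)) \<partial>lpos) \<le> ennreal A"
    using kern_moment_bound[OF k] .
  obtain B where B: "0 < B" "(\<integral>\<^sup>+u. ennreal (l u * u powr (-1/p)) \<partial>lpos) \<le> ennreal B"
    using kern_moment_bound[OF l] .
  have "(\<integral>\<^sup>+w. ennreal ((k (fst w) * l (snd w)) * (fst w * snd w) powr (-1/p)) \<partial>(lpos \<Otimes>\<^sub>M lpos)) =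
      (\<integral>\<^sup>+u. (\<integral>\<^sup>+v. ennreal ((k u * l v) * (u * v) powr (-1/p)) \<partial>lpos) \<partial>lpos)"
    by (subst lpos.nn_integral_fst[symmetric]) auto
  also have "\<dots> = (\<integral>\<^sup>+u. (\<integral>\<^sup>+v. ennreal (k u * u powr (-1/p)) * ennreal (l v * v powr (-1/p)) \<partial>lpos) \<partial>lpos)"
    using kernD(2)[OF k] kernD(2)[OF l]
    by (intro nn_integral_lpos_cong) (simp add: powr_mult ennreal_mult [symmetric] mult_ac)
  also have "\<dots> = (\<integral>\<^sup>+u. ennreal (k u * u powr (-1/p)) \<partial>lpos) * (\<integral>\<^sup>+u. ennreal (l u * u powr (-1/p)) \<partial>lpos)"
    by (simp add: nn_integral_cmult nn_integral_multc)
  also have "\<dots> \<le> ennreal (A * B)"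
    using A B by (simp add: ennreal_mult mult_mono)
  finally have AB: "(\<integral>\<^sup>+w. ennreal ((k (fst w) * l (snd w)) * (fst w * snd w) powr (-1/p)) \<partial>(lpos \<Otimes>\<^sub>M lpos)) \<le> ennreal (A * B)" .
  have "AE t in lpos. (\<integral>\<^sup>+w. ennreal ((k (fst w) * l (snd w)) * norm (f (t * (fst w * snd w)))) \<partial>(lpos \<Otimes>\<^sub>M lpos)) < \<infinity>"
    by (rule dilation_AE_finite[where p = p and A = "A * B"])
      (use A B AB p LpD[OF f] kernD[OF k] kernD[OF l] lpos2.sigma_finite_measure_axioms in
        \<open>auto simp: zero_less_mult_iff\<close>)
  then show ?thesis
    by eventually_elim
      (use kernD(2)[OF k] kernD(2)[OF l] in \<open>simp add: integrable_iff_bounded split_beta'\<close>)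
qed

lemma dil_dil_iterated:
  assumes [measurable]: "k \<in> borel_measurable borel" "l \<in> borel_measurable borel" "f \<in> borel_measurable borel"
  shows "dil k (dil l f) t = (LINT u|lpos. LINT v|lpos. (k u * l v) *\<^sub>R f (t * (u * v)))"
  unfolding dil_def
  by (intro Bochner_Integration.integral_cong refl)
     (subst integral_scaleR_right [symmetric], simp add: mult.assoc)

lemma dil_commute:
  assumes k: "kern p k" and l: "kern p l" and f: "f \<in> Lp p" and p: "1 \<le> p"
  shows "AE t in lpos. dil k (dil l f) t = dil l (dil k f) t"
  using dil_dil_AE_integrable[OF assms]
proof eventually_elim
  case (elim t)
  note [measurable] = kernD(1)[OF k] kernD(1)[OF l] LpD(1)[OF f]
  have "dil k (dil l f) t = (LINT u|lpos. LINT v|lpos. (k u * l v) *\<^sub>R f (t * (u * v)))"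
    by (rule dil_dil_iterated) auto
  also have "\<dots> = (LINT v|lpos. LINT u|lpos. (k u * l v) *\<^sub>R f (t * (u * v)))"
    by (rule lpos2.Fubini_integral [symmetric]) fact
  also have "\<dots> = dil l (dil k f) t"
    by (subst dil_dil_iterated) (auto simp: mult.commute)
  finally show ?case .
qed

text \<open>Substituting w = u v in the inner integral and exchanging the order collects the kernel
  in w. The convolution is required to be finite at every w > 0, so that m is a real function; the
  integrability is kept in the conclusion because the final formula splits the integral in
  two.\<close>

lemma dil_compose:
  assumes k: "kern p k" and l: "kern p l" and f: "f \<in> Lp p" and p: "1 \<le> p"
    and [measurable]: "m \<in> borel_measurable borel" and m0: "\<And>w. 0 \<le> m w"
    and m: "\<And>w. 0 < w \<Longrightarrow> (\<integral>\<^sup>+u. ennreal (k u * l (w / u) / u) \<partial>lpos) = ennreal (m w)"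
  shows "AE t in lpos. integrable lpos (\<lambda>w. m w *\<^sub>R f (t * w)) \<and> dil k (dil l f) t = dil m f t"
  using dil_dil_AE_integrable[OF k l f p]
proof eventually_elim
  case (elim t)
  note [measurable] = kernD(1)[OF k] kernD(1)[OF l] LpD(1)[OF f]
  have k0: "0 \<le> k u" and l0: "0 \<le> l u" for u using kernD(2)[OF k] kernD(2)[OF l] by auto
  \<comment> \<open>The integrand after w = u v. Its norm has the same iterated integral as that of
    the integrand in (u, v), so the integrability known from \<open>elim\<close> carries
    over.\<close>
  let ?G = "\<lambda>u w. (k u * l (w / u) / u) *\<^sub>R f (t * w)"
  have "(\<integral>\<^sup>+z. ennreal (norm (case z of (u, w) \<Rightarrow> ?G u w)) \<partial>(lpos \<Otimes>\<^sub>M lpos)) =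
      (\<integral>\<^sup>+u. (\<integral>\<^sup>+w. ennreal (norm (?G u w)) \<partial>lpos) \<partial>lpos)"
    by (subst lpos.nn_integral_fst[symmetric]) auto
  also have "\<dots> = (\<integral>\<^sup>+u. (\<integral>\<^sup>+v. ennreal (norm ((k u * l v) *\<^sub>R f (t * (u * v)))) \<partial>lpos) \<partial>lpos)"
  proof (rule nn_integral_lpos_cong)
    fix u :: real assume u: "0 < u"
    have "(\<integral>\<^sup>+v. ennreal (norm ((k u * l v) *\<^sub>R f (t * (u * v)))) \<partial>lpos) =
        (\<integral>\<^sup>+v. ennreal (norm ((k u * l ((u * v) / u)) *\<^sub>R f (t * (u * v)))) \<partial>lpos)"
      using u by simp
    also have "\<dots> = ennreal (1 / u) * (\<integral>\<^sup>+w. ennreal (norm ((k u * l (w / u)) *\<^sub>R f (t * w))) \<partial>lpos)"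
      using u by (intro nn_integral_lpos_scale[where g = "\<lambda>w. ennreal (norm ((k u * l (w / u)) *\<^sub>R f (t * w)))"]) auto
    also have "\<dots> = (\<integral>\<^sup>+w. ennreal (norm (?G u w)) \<partial>lpos)"
      using u k0 l0 by (subst nn_integral_cmult [symmetric]) (auto simp: ennreal_mult [symmetric] intro!: nn_integral_cong)
    finally show "(\<integral>\<^sup>+w. ennreal (norm (?G u w)) \<partial>lpos) =
        (\<integral>\<^sup>+v. ennreal (norm ((k u * l v) *\<^sub>R f (t * (u * v)))) \<partial>lpos)" ..
  qed
  also have "\<dots> = (\<integral>\<^sup>+z. ennreal (norm (case z of (u, v) \<Rightarrow> (k u * l v) *\<^sub>R f (t * (u * v)))) \<partial>(lpos \<Otimes>\<^sub>M lpos))"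
    by (subst lpos.nn_integral_fst[symmetric]) auto
  also have "\<dots> < \<infinity>" using elim by (simp add: integrable_iff_bounded)
  finally have G: "integrable (lpos \<Otimes>\<^sub>M lpos) (\<lambda>(u, w). ?G u w)"
    by (simp add: integrable_iff_bounded)
  have inner: "(LINT u|lpos. ?G u w) = m w *\<^sub>R f (t * w)" if "0 < w" for w
  proof -
    have nonneg: "AE u in lpos. 0 \<le> k u * l (w / u) / u"
      by (rule AE_lposI) (use k0 l0 in auto)
    have "integrable lpos (\<lambda>u. k u * l (w / u) / u)"
      by (rule integrableI_nn_integral_finite[where x = "m w"]) (use nonneg m[OF that] m0 in auto)
    moreover have "(LINT u|lpos. k u * l (w / u) / u) = m w"
      by (subst integral_eq_nn_integral) (use nonneg m[OF that] m0 in auto)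
    ultimately show ?thesis by simp
  qed
  have "dil k (dil l f) t = (LINT u|lpos. LINT v|lpos. (k u * l v) *\<^sub>R f (t * (u * v)))"
    by (rule dil_dil_iterated) auto
  also have "\<dots> = (LINT u|lpos. LINT w|lpos. ?G u w)"
  proof (rule integral_lpos_cong)
    fix u :: real assume u: "0 < u"
    have "(LINT v|lpos. (k u * l v) *\<^sub>R f (t * (u * v))) =
        (LINT v|lpos. (k u * l ((u * v) / u)) *\<^sub>R f (t * (u * v)))"
      using u by simp
    also have "\<dots> = (LINT w|lpos. (k u * l (w / u)) *\<^sub>R f (t * w)) /\<^sub>R u"
      using u by (intro integral_lpos_scale[where g = "\<lambda>w. (k u * l (w / u)) *\<^sub>R f (t * w)"]) auto
    also have "\<dots> = (LINT w|lpos. ?G u w)"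
      using u by (subst integral_scaleR_right [symmetric]) (simp add: field_simps)
    finally show "(LINT v|lpos. (k u * l v) *\<^sub>R f (t * (u * v))) = (LINT w|lpos. ?G u w)" .
  qed auto
  also have "\<dots> = (LINT w|lpos. LINT u|lpos. ?G u w)"
    by (rule lpos2.Fubini_integral [symmetric]) (rule G)
  also have "\<dots> = dil m f t"
    unfolding dil_def by (rule integral_lpos_cong) (use inner in auto)
  finally have eq: "dil k (dil l f) t = dil m f t" .
  have "integrable lpos (\<lambda>w. LINT u|lpos. ?G u w)"
    using lpos2.integrable_snd[OF G] .
  also have "?this \<longleftrightarrow> integrable lpos (\<lambda>w. m w *\<^sub>R f (t * w))"
    by (rule integrable_cong_AE) (use inner in \<open>auto intro: AE_lposI\<close>)
  finally show ?case using eq by blast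
qed

section \<open>Duality: Young's inequality and transposition\<close>

lemma mult_le_powr_sum:
  fixes x y p q :: real
  assumes "0 \<le> x" "0 \<le> y" "1 < p" "1/p + 1/q = 1"
  shows "x * y \<le> x powr p + y powr q"
proof -
  have "1 / q = 1 - 1 / p" "0 < 1 / p" "1 / p < 1" using assms by auto
  then have "0 < 1 / q" "1 / q < 1" by linarith+
  then have q: "1 < q" by (simp add: divide_less_eq)
  have "x * y \<le> x powr p / p + y powr q / q"
    using Youngs_inequality[of p q x y] assms q by auto
  also have "\<dots> \<le> x powr p + y powr q"
    using assms q by (intro add_mono) (auto simp: divide_le_eq mult_le_cancel_left1)
  finally show ?thesis .
qed

lemma Lp_mult_integrable:
  assumes "f \<in> Lp p" "g \<in> Lp q" "1 < p" "1/p + 1/q = 1"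
  shows "integrable lpos (\<lambda>t. f t * g t)"
proof -
  note [measurable] = LpD(1)[OF assms(1)] LpD(1)[OF assms(2)]
  have "(\<integral>\<^sup>+t. ennreal (norm (f t * g t)) \<partial>lpos) \<le> (\<integral>\<^sup>+t. ennreal (norm (f t) powr p) + ennreal (norm (g t) powr q) \<partial>lpos)"
    using assms mult_le_powr_sum[OF norm_ge_zero norm_ge_zero assms(3,4)]
    by (intro nn_integral_mono) (simp add: norm_mult ennreal_plus[symmetric] ennreal_leI del: ennreal_plus)
  also have "\<dots> = Ip p f + Ip q g" unfolding Ip_def by (rule nn_integral_add) auto
  also have "\<dots> < \<infinity>" using LpD(2)[OF assms(1)] LpD(2)[OF assms(2)] by simp
  finally show ?thesis by (simp add: integrable_iff_bounded)
qed

text \<open>Both sides are the double integral of k(s/t)/t f(s) g(t): on the left s = t u, on the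
  right t = s v, where the latter turns k into k(1/v)/v. For absolute convergence, the integral
  \<open>?X\<close> of the norms has a finite p-th power integral by \<open>dilation_bound\<close>,
  and Young's inequality pairs it with g.\<close>

lemma dil_transpose:
  assumes k: "kern p k" and k': "kern q k'" and f: "f \<in> Lp p" and g: "g \<in> Lp q"
    and p: "1 < p" "1/p + 1/q = 1" and kk': "\<And>v. 0 < v \<Longrightarrow> k' v = k (1 / v) / v"
  shows "(LINT t|lpos. dil k f t * g t) = (LINT t|lpos. f t * dil k' g t)"
proof -
  note [measurable] = kernD(1)[OF k] kernD(1)[OF k'] LpD(1)[OF f] LpD(1)[OF g]
  have k0: "0 \<le> k u" for u using kernD(2)[OF k] by auto
  obtain A where A: "0 < A" "(\<integral>\<^sup>+u. ennreal (k u * u powr (-1/p)) \<partial>lpos) \<le> ennreal A"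
    using kern_moment_bound[OF k] .
  let ?X = "\<lambda>t. \<integral>\<^sup>+u. ennreal (k u * norm (f (t * u))) \<partial>lpos"
  have X: "(\<integral>\<^sup>+t. ennreal (enn2real (?X t) powr p) \<partial>lpos) \<le> ennreal ((2 * A) powr p) * Ip p f"
    by (rule dilation_bound)
      (use A p kernD[OF k] lpos.sigma_finite_measure_axioms in auto)
  have Xfin: "AE t in lpos. ?X t < \<infinity>"
    by (rule dilation_AE_finite[where p = p and A = A])
      (use A p LpD[OF f] kernD[OF k] lpos.sigma_finite_measure_axioms in auto)
  let ?H = "\<lambda>t s. (k (s / t) / t) *\<^sub>R (f s * g t)"
  have resc: "(LINT u|lpos. k u *\<^sub>R f (t * u)) = (LINT s|lpos. (k (s / t) / t) *\<^sub>R f s)" if "0 < t" for t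
  proof -
    have "(LINT u|lpos. k u *\<^sub>R f (t * u)) = (LINT u|lpos. k ((t * u) / t) *\<^sub>R f (t * u))"
      using that by simp
    also have "\<dots> = (LINT s|lpos. k (s / t) *\<^sub>R f s) /\<^sub>R t"
      using that by (intro integral_lpos_scale[where g = "\<lambda>s. k (s / t) *\<^sub>R f s"]) auto
    also have "\<dots> = (LINT s|lpos. (k (s / t) / t) *\<^sub>R f s)"
      by (subst integral_scaleR_right [symmetric]) (simp add: field_simps)
    finally show ?thesis .
  qed
  have "(\<integral>\<^sup>+z. ennreal (norm (case z of (t, s) \<Rightarrow> ?H t s)) \<partial>(lpos \<Otimes>\<^sub>M lpos)) =
      (\<integral>\<^sup>+t. (\<integral>\<^sup>+s. ennreal (norm (?H t s)) \<partial>lpos) \<partial>lpos)"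
    by (subst lpos.nn_integral_fst[symmetric]) auto
  also have "\<dots> = (\<integral>\<^sup>+t. ?X t * ennreal (norm (g t)) \<partial>lpos)"
  proof (rule nn_integral_lpos_cong)
    fix t :: real assume t: "0 < t"
    have "(\<integral>\<^sup>+s. ennreal (norm (?H t s)) \<partial>lpos) = ennreal (norm (g t)) * (ennreal (1/t) * (\<integral>\<^sup>+s. ennreal (k (s / t) * norm (f s)) \<partial>lpos))"
      using t k0 by (subst nn_integral_cmult [symmetric], simp)+
        (auto intro!: nn_integral_cong simp: norm_mult ennreal_mult [symmetric] field_simps)
    also have "ennreal (1/t) * (\<integral>\<^sup>+s. ennreal (k (s / t) * norm (f s)) \<partial>lpos) =
        (\<integral>\<^sup>+u. ennreal (k ((t * u) / t) * norm (f (t * u))) \<partial>lpos)"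
      using t by (intro nn_integral_lpos_scale[symmetric, where g = "\<lambda>s. ennreal (k (s / t) * norm (f s))"]) auto
    also have "\<dots> = ?X t" using t by simp
    finally show "(\<integral>\<^sup>+s. ennreal (norm (?H t s)) \<partial>lpos) = ?X t * ennreal (norm (g t))"
      by (simp add: mult.commute)
  qed
  also have "\<dots> \<le> (\<integral>\<^sup>+t. ennreal (enn2real (?X t) powr p) + ennreal (norm (g t) powr q) \<partial>lpos)"
  proof (rule nn_integral_mono_AE)
    show "AE t in lpos. ?X t * ennreal (norm (g t)) \<le> ennreal (enn2real (?X t) powr p) + ennreal (norm (g t) powr q)"
      using Xfin
    proof eventually_elim
      case (elim t)
      then have "?X t * ennreal (norm (g t)) = ennreal (enn2real (?X t) * norm (g t))"
        by (simp add: ennreal_mult less_top)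
      also have "\<dots> \<le> ennreal (enn2real (?X t) powr p + norm (g t) powr q)"
        using p by (intro ennreal_leI mult_le_powr_sum) auto
      finally show ?case by simp
    qed
  qed
  also have "\<dots> = (\<integral>\<^sup>+t. ennreal (enn2real (?X t) powr p) \<partial>lpos) + Ip q g"
    unfolding Ip_def by (rule nn_integral_add) auto
  also have "\<dots> < \<infinity>"
    using order_le_less_trans[OF X, of \<infinity>] LpD(2)[OF f] LpD(2)[OF g] by (simp add: ennreal_mult_less_top)
  finally have H: "integrable (lpos \<Otimes>\<^sub>M lpos) (\<lambda>(t, s). ?H t s)"
    by (simp add: integrable_iff_bounded)
  have "(LINT t|lpos. dil k f t * g t) = (LINT t|lpos. LINT s|lpos. ?H t s)"
  proof (rule integral_lpos_cong)
    fix t :: real assume t: "0 < t"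
    show "dil k f t * g t = (LINT s|lpos. ?H t s)"
      unfolding dil_def resc[OF t]
      by (subst integral_mult_left_zero [symmetric]) simp
  qed auto
  also have "\<dots> = (LINT s|lpos. LINT t|lpos. ?H t s)"
    by (rule lpos2.Fubini_integral [symmetric]) (rule H)
  also have "\<dots> = (LINT s|lpos. f s * dil k' g s)"
  proof (rule integral_lpos_cong)
    fix s :: real assume s: "0 < s"
    have "(LINT t|lpos. ?H t s) = (LINT v|lpos. ?H (s * v) s) * s"
      using s by (subst integral_lpos_scale[where g = "\<lambda>t. ?H t s"]) (auto simp: scaleR_conv_of_real)
    also have "\<dots> = (LINT v|lpos. ?H (s * v) s * s)"
      by (subst integral_mult_left_zero) simp
    also have "\<dots> = (LINT v|lpos. f s * (k' v *\<^sub>R g (s * v)))"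
      by (rule integral_lpos_cong) (use s in \<open>auto simp: kk' scaleR_conv_of_real\<close>)
    finally show "(LINT t|lpos. ?H t s) = f s * dil k' g s"
      unfolding dil_def by (subst (asm) integral_mult_right_zero) simp
  qed auto
  finally show ?thesis .
qed

section \<open>From Lebesgue measurable functions to Borel representatives\<close>

lemma AE_lebesgue_on_pos: "(AE t in lebesgue_on {0<..}. P t) \<longleftrightarrow> (AE t in lpos. P t)"
proof -
  have "(AE t in lebesgue_on {0<..}. P t) \<longleftrightarrow> (AE t in lebesgue. t \<in> {0<..} \<longrightarrow> P t)"
    by (rule AE_restrict_space_iff) auto
  also have "\<dots> \<longleftrightarrow> (AE t in lpos. P t)"
    unfolding AE_completion_iff AE_lpos by simp
  finally show ?thesis .
qed

lemma integrable_lpos: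
  fixes f :: "real \<Rightarrow> 'a::{banach, second_countable_topology}"
  assumes [measurable]: "f \<in> borel_measurable borel"
  shows "integrable lpos f \<longleftrightarrow> integrable lborel (\<lambda>x. indicator {0<..} x *\<^sub>R f x)"
  unfolding lpos_def by (subst integrable_density[symmetric]) (auto simp: ennreal_indicator)

lemma integral_lpos:
  fixes f :: "real \<Rightarrow> 'a::{banach, second_countable_topology}"
  assumes [measurable]: "f \<in> borel_measurable borel"
  shows "(LINT x|lpos. f x) = (LINT x|lborel. indicator {0<..} x *\<^sub>R f x)"
  unfolding lpos_def by (subst integral_density[symmetric]) (auto simp: ennreal_indicator)

text \<open>Integrals over the completed measure are brought to \<open>lpos\<close> here. F is
  controlled only through a Borel function equal to it almost everywhere on A, because elements of
  the spaces are arbitrary elsewhere and need not be Borel measurable.\<close>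

lemma
  fixes F F0 :: "real \<Rightarrow> complex"
  assumes A: "A \<in> sets borel" "A \<subseteq> {0<..}"
    and [measurable]: "F0 \<in> borel_measurable borel"
    and eq: "AE x in lpos. x \<in> A \<longrightarrow> F x = F0 x"
  shows set_integrable_lebesgue_lpos:
      "set_integrable lebesgue A F \<longleftrightarrow> integrable lpos (\<lambda>x. indicator A x *\<^sub>R F0 x)" (is ?int)
    and set_integral_lebesgue_lpos:
      "(LINT x:A|lebesgue. F x) = (LINT x|lpos. indicator A x *\<^sub>R F0 x)" (is ?eq)
    and set_measurable_lebesgue_lpos:
      "(\<lambda>x. indicator A x *\<^sub>R F x) \<in> borel_measurable lebesgue" (is ?meas)
proof -
  note [measurable] = A(1)
  have ae: "AE x in lebesgue. indicat_real A x *\<^sub>R F0 x = indicat_real A x *\<^sub>R F x"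
    unfolding AE_completion_iff using eq[unfolded AE_lpos] A(2)
    by (auto elim!: eventually_mono simp: indicator_def)
  have m0: "(\<lambda>x. indicat_real A x *\<^sub>R F0 x) \<in> borel_measurable lborel" by simp
  then have m0': "(\<lambda>x. indicat_real A x *\<^sub>R F0 x) \<in> borel_measurable lebesgue"
    by (rule measurable_completion)
  then show meas: ?meas by (rule borel_measurable_AE) (rule ae)
  have ind: "indicat_real {0<..} x *\<^sub>R (indicat_real A x *\<^sub>R F0 x) = indicat_real A x *\<^sub>R F0 x" for x
    using A(2) by (auto simp: indicator_def)
  have "set_integrable lebesgue A F \<longleftrightarrow> integrable lebesgue (\<lambda>x. indicat_real A x *\<^sub>R F0 x)"
    unfolding set_integrable_def by (rule integrable_cong_AE) (use meas m0' ae in auto)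
  also have "\<dots> \<longleftrightarrow> integrable lborel (\<lambda>x. indicat_real A x *\<^sub>R F0 x)"
    by (rule integrable_completion) (use m0 in simp)
  also have "\<dots> \<longleftrightarrow> integrable lpos (\<lambda>x. indicat_real A x *\<^sub>R F0 x)"
    by (subst integrable_lpos) (simp, simp only: ind)
  finally show ?int .
  have "(LINT x:A|lebesgue. F x) = (LINT x|lebesgue. indicat_real A x *\<^sub>R F0 x)"
    unfolding set_lebesgue_integral_def by (rule integral_cong_AE) (use meas m0' ae in auto)
  also have "\<dots> = (LINT x|lborel. indicat_real A x *\<^sub>R F0 x)"
    by (rule integral_completion) (use m0 in simp)
  also have "\<dots> = (LINT x|lpos. indicat_real A x *\<^sub>R F0 x)"
    by (subst integral_lpos) (simp, simp only: ind)
  finally show ?eq .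
qed

lemma Ip_cong_AE:
  assumes "AE x in lpos. f x = g x"
  shows "Ip p f = Ip p g"
  unfolding Ip_def by (rule nn_integral_cong_AE) (use assms in \<open>auto elim!: eventually_mono\<close>)

lemma measurable_lebesgue_on_posI:
  fixes f f0 :: "real \<Rightarrow> complex"
  assumes [measurable]: "f0 \<in> borel_measurable borel" and "AE x in lpos. f x = f0 x"
  shows "f \<in> borel_measurable (lebesgue_on {0<..})"
  by (subst borel_measurable_restrict_space_iff, simp, rule set_measurable_lebesgue_lpos[of _ f0])
    (use assms in \<open>auto elim!: eventually_mono\<close>)

lemma integral_lebesgue_on_pos:
  fixes f f0 :: "real \<Rightarrow> complex"
  assumes [measurable]: "f0 \<in> borel_measurable borel" and "AE x in lpos. f x = f0 x"
  shows "(LINT x|lebesgue_on {0<..}. f x) = (LINT x|lpos. f0 x)"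
proof -
  have "(LINT x|lebesgue_on {0<..}. f x) = (LINT x:{0<..}|lebesgue. f x)"
    unfolding set_lebesgue_integral_def by (rule integral_restrict_space) auto
  also have "\<dots> = (LINT x|lpos. indicat_real {0<..} x *\<^sub>R f0 x)"
    by (rule set_integral_lebesgue_lpos) (use assms in auto)
  also have "\<dots> = (LINT x|lpos. f0 x)"
    by (rule integral_cong_AE) (auto simp: AE_lpos)
  finally show ?thesis .
qed

lemma nn_integral_lebesgue_on_pos:
  fixes f f0 :: "real \<Rightarrow> ennreal"
  assumes [measurable]: "f0 \<in> borel_measurable borel" and eq: "AE x in lpos. f x = f0 x"
  shows "(\<integral>\<^sup>+x. f x \<partial>lebesgue_on {0<..}) = (\<integral>\<^sup>+x. f0 x \<partial>lpos)"
proof -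
  have "(\<integral>\<^sup>+x. f x \<partial>lebesgue_on {0<..}) = (\<integral>\<^sup>+x. f x * indicator {0<..} x \<partial>lebesgue)"
    by (rule nn_integral_restrict_space) auto
  also have "\<dots> = (\<integral>\<^sup>+x. indicator {0<..} x * f0 x \<partial>lebesgue)"
    by (rule nn_integral_cong_AE, unfold AE_completion_iff, use eq[unfolded AE_lpos] in eventually_elim)
      (auto simp: indicator_def)
  also have "\<dots> = (\<integral>\<^sup>+x. f0 x \<partial>lpos)"
    by (simp add: nn_integral_completion nn_integral_lpos)
  finally show ?thesis .
qed

lemma norm_powr_lebesgue_on_pos:
  fixes f f0 :: "real \<Rightarrow> complex"
  assumes f0[measurable]: "f0 \<in> borel_measurable borel" and eq: "AE x in lpos. f x = f0 x"
  shows "(\<integral>\<^sup>+t. ennreal (norm (f t) powr p) \<partial>lebesgue_on {0<..}) = Ip p f0"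
  unfolding Ip_def
  by (rule nn_integral_lebesgue_on_pos) (use eq in \<open>auto elim!: eventually_mono\<close>)

lemma Lp_pos_iff:
  assumes f0[measurable]: "f0 \<in> borel_measurable borel" and eq: "AE x in lpos. f x = f0 x"
  shows "f \<in> Lp_pos p \<longleftrightarrow> f0 \<in> Lp p"
proof -
  have [measurable]: "f \<in> borel_measurable (lebesgue_on {0<..})"
    by (rule measurable_lebesgue_on_posI[OF assms])
  show ?thesis
    using norm_powr_lebesgue_on_pos[OF assms, of p]
    by (simp add: Lp_pos_def Lp_def integrable_iff_bounded)
qed

lemma Lp_norm_eq:
  assumes f0[measurable]: "f0 \<in> borel_measurable borel" and eq: "AE x in lpos. f x = f0 x"
  shows "Lp_norm p f = enn2real (Ip p f0) powr (1 / p)"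
proof -
  have [measurable]: "f \<in> borel_measurable (lebesgue_on {0<..})"
    by (rule measurable_lebesgue_on_posI[OF assms])
  show ?thesis
    unfolding Lp_norm_def norm_powr_lebesgue_on_pos[OF assms, symmetric]
    by (subst integral_eq_nn_integral) auto
qed

text \<open>Real and imaginary part are replaced separately by Borel functions equal almost
  everywhere. The representative is needed because \<open>t * u\<close> and the product measures are
  handled on the Borel sigma-algebra.\<close>

lemma Lp_pos_obtain_borel:
  assumes "f \<in> Lp_pos p"
  obtains f0 where "f0 \<in> Lp p" "AE x in lpos. f x = f0 x"
proof -
  have "f \<in> borel_measurable (lebesgue_on {0<..})" using assms by (simp add: Lp_pos_def)
  then have F[measurable]: "(\<lambda>x. indicat_real {0<..} x *\<^sub>R f x) \<in> borel_measurable lebesgue"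
    by (subst (asm) borel_measurable_restrict_space_iff) auto
  obtain g where g[measurable]: "g \<in> borel_measurable lborel"
    and g': "AE x in lborel. Re (indicat_real {0<..} x *\<^sub>R f x) = g x"
    using completion_ex_borel_measurable_real[of "\<lambda>x. Re (indicat_real {0<..} x *\<^sub>R f x)" lborel]
      measurable_compose[OF F borel_measurable_Re] by (auto simp: o_def)
  obtain h where h[measurable]: "h \<in> borel_measurable lborel"
    and h': "AE x in lborel. Im (indicat_real {0<..} x *\<^sub>R f x) = h x"
    using completion_ex_borel_measurable_real[of "\<lambda>x. Im (indicat_real {0<..} x *\<^sub>R f x)" lborel]
      measurable_compose[OF F borel_measurable_Im] by (auto simp: o_def)
  have eq: "AE x in lpos. f x = Complex (g x) (h x)"
    unfolding AE_lpos using g' h' by eventually_elim (auto simp: complex_eq_iff)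
  have "(\<lambda>x. Complex (g x) (h x)) = (\<lambda>x. of_real (g x) + \<i> * of_real (h x))"
    by (simp add: complex_eq_iff fun_eq_iff)
  then have m: "(\<lambda>x. Complex (g x) (h x)) \<in> borel_measurable borel"
    using g h by simp
  from that[OF _ eq] Lp_pos_iff[OF m eq] assms show ?thesis by blast
qed

section \<open>Euler's integral\<close>

lemma nn_integral_Beta_real:
  assumes "0 < a" "0 < (b::real)"
  shows "(\<integral>\<^sup>+v. ennreal (v powr (a - 1) * (1 - v) powr (b - 1)) * indicator {0<..<1} v \<partial>lborel) = ennreal (Beta a b)"
  by (rule nn_integral_has_integral_lebesgue')
    (use has_integral_Beta_real[OF assms] in \<open>auto simp: has_integral_Icc_iff_Ioo\<close>)

text \<open>Change of variables x = v/(1-v), with derivative 1/(1-v)^2, from (0,1) onto the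
  half-line. Nonnegativity allows the passage to absolutely integrable functions and back.\<close>

lemma nn_integral_lpos_odds:
  fixes F :: "real \<Rightarrow> real"
  assumes [measurable]: "F \<in> borel_measurable borel" and F0: "\<And>x. 0 < x \<Longrightarrow> 0 \<le> F x"
    and I: "(\<integral>\<^sup>+v. ennreal (F (v / (1 - v)) / (1 - v)\<^sup>2) * indicator {0<..<1} v \<partial>lborel) = ennreal I" "0 \<le> I"
  shows "(\<integral>\<^sup>+x. ennreal (F x) \<partial>lpos) = ennreal I"
proof -
  let ?g = "\<lambda>v::real. v / (1 - v)"
  let ?h = "\<lambda>v. indicat_real {0<..<1} v * (F (?g v) / (1 - v)\<^sup>2)"
  have "(?h has_integral I) UNIV"
  proof (rule nn_integral_has_integral)
    show "(\<integral>\<^sup>+v. ennreal (?h v) \<partial>lborel) = ennreal I"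
      unfolding I(1)[symmetric] by (auto intro!: nn_integral_cong simp: indicator_def)
  qed (use F0 I in \<open>auto simp: indicator_def\<close>)
  also have "?h = (\<lambda>v. if v \<in> {0<..<1} then F (?g v) / (1 - v)\<^sup>2 else 0)"
    by (auto simp: indicator_def)
  finally have hi: "((\<lambda>v. \<bar>1 / (1 - v)\<^sup>2\<bar> * F (?g v)) has_integral I) {0<..<1}"
    by (subst (asm) has_integral_restrict_UNIV) simp
  have abs: "(\<lambda>v. \<bar>1 / (1 - v)\<^sup>2\<bar> * F (?g v)) absolutely_integrable_on {0<..<1}"
    by (rule nonnegative_absolutely_integrable_1) (use hi F0 in auto)
  have img: "?g ` {0<..<1} = {0<..}"
  proof safe
    fix x :: real assume "0 < x"
    then show "x \<in> ?g ` {0<..<1}"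
      by (intro image_eqI[of _ _ "x / (1 + x)"]) (auto simp: field_simps)
  qed auto
  have "F absolutely_integrable_on ?g ` {0<..<1} \<and> integral (?g ` {0<..<1}) F = I"
  proof (subst has_absolute_integral_change_of_variables_1'[symmetric])
    show "(?g has_field_derivative 1 / (1 - v)\<^sup>2) (at v within {0<..<1})" if "v \<in> {0<..<1}" for v
      using that by (auto intro!: derivative_eq_intros simp: power2_eq_square field_simps)
    show "inj_on ?g {0<..<1}"
      by (auto simp: inj_on_def field_simps)
  qed (use abs hi in \<open>auto simp: integral_unique\<close>)
  then have "(F has_integral I) {0<..}"
    unfolding img by (metis has_integral_integrable_integral set_lebesgue_integral_eq_integral(1))
  then have "integral\<^sup>N lborel (\<lambda>x. ennreal (F x) * indicator {0<..} x) = ennreal I"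
    by (intro nn_integral_has_integral_lebesgue') (use F0 in auto)
  then show ?thesis by (simp add: nn_integral_lpos mult.commute)
qed

text \<open>The Beta integral of the second kind. The moments of the Stieltjes and the Erdelyi-Kober
  kernels reduce to it, as do the integrals that dominate Schwartz functions.\<close>

lemma nn_integral_Beta_prime:
  assumes "0 < a" "0 < b"
  shows "(\<integral>\<^sup>+x. ennreal (x powr (a - 1) / (1 + x) powr (a + b)) \<partial>lpos) = ennreal (Beta a b)"
proof (rule nn_integral_lpos_odds)
  have "v powr (a - 1) * (1 - v) powr (b - 1) =
      (v / (1 - v)) powr (a - 1) / (1 + v / (1 - v)) powr (a + b) / (1 - v)\<^sup>2"
    if "0 < v" "v < 1" for v
  proof -
    have "1 + v / (1 - v) = 1 / (1 - v)" using that by (simp add: field_simps)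
    moreover have "y powr (b - 1) = y powr (a + b) / y powr (a - 1) / y\<^sup>2" if "0 < y" for y
      using that by (simp add: powr_diff powr_add power2_eq_square field_simps)
    then have "(1 - v) powr (b - 1) = (1 - v) powr (a + b) / (1 - v) powr (a - 1) / (1 - v)\<^sup>2"
      using that by simp
    ultimately show ?thesis
      using that by (simp add: powr_divide field_simps)
  qed
  then show "(\<integral>\<^sup>+v. ennreal ((v / (1 - v)) powr (a - 1) / (1 + v / (1 - v)) powr (a + b) / (1 - v)\<^sup>2) *
      indicator {0<..<1} v \<partial>lborel) = ennreal (Beta a b)"
    unfolding nn_integral_Beta_real[OF assms, symmetric]
    by (intro nn_integral_cong) (auto simp: indicator_def)
  show "0 \<le> Beta a b"
    using assms by (simp add: Beta_def Gamma_real_pos less_imp_le)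
qed (use assms in auto)

section \<open>The Gauss series and its Euler integral\<close>

lemma Beta_pos: "0 < a \<Longrightarrow> 0 < b \<Longrightarrow> 0 < Beta a (b::real)"
  by (simp add: Beta_def Gamma_real_pos)

lemma Beta_shift_pochhammer:
  fixes b d :: real
  assumes "0 < b" "0 < d"
  shows "Beta (b + real n) d = Beta b d * pochhammer b n / pochhammer (b + d) n"
proof -
  have nn: "b \<notin> \<int>\<^sub>\<le>\<^sub>0" "b + d \<notin> \<int>\<^sub>\<le>\<^sub>0" using assms by (auto elim!: nonpos_Ints_cases)
  have "Gamma b > 0" "Gamma (b + d) > 0" "Gamma (b + d + real n) > 0"
    using assms by (auto intro!: Gamma_real_pos)
  then show ?thesis
    by (simp add: Beta_def pochhammer_Gamma[OF nn(1)] pochhammer_Gamma[OF nn(2)] add_ac)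
qed

lemma sums_one_minus_powr:
  fixes a z :: real
  assumes "\<bar>z\<bar> < 1"
  shows "(\<lambda>n. pochhammer a n / fact n * z ^ n) sums ((1 - z) powr (-a))"
proof -
  have "(-1) ^ n * (-z) ^ n = z ^ n" for n
    by (simp flip: power_mult_distrib)
  then have "(-a gchoose n) * (-z) ^ n = pochhammer a n / fact n * z ^ n" for n
    by (simp add: gbinomial_pochhammer)
  then show ?thesis
    using gen_binomial_real[of "-z" "-a"] assms by simp
qed

text \<open>Since 0 < b < c, the quotient of the Pochhammer symbols of b and c is at most 1, and the
  series is dominated termwise by the binomial series of (1-z)^(-a). Its terms are nonnegative for z
  \<ge> 0.\<close>

lemma hyp2F1_sums:
  fixes a b c z :: real
  assumes "0 < a" "0 < b" "b < c" "0 \<le> z" "z < 1"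
  shows "(\<lambda>n. pochhammer a n * pochhammer b n / (pochhammer c n * fact n) * z ^ n) sums hyp2F1 a b c z"
    and hyp2F1_nonneg: "0 \<le> hyp2F1 a b c z"
proof -
  have pos: "0 < pochhammer a n" "0 < pochhammer b n" "0 < pochhammer c n" for n
    using assms by (auto intro!: pochhammer_pos)
  have bc: "pochhammer b n \<le> pochhammer c n" for n
    unfolding pochhammer_prod using assms by (intro prod_mono) auto
  have "summable (\<lambda>n. pochhammer a n * pochhammer b n / (pochhammer c n * fact n) * z ^ n)"
  proof (rule summable_comparison_test'[OF sums_summable[OF sums_one_minus_powr]])
    show "\<bar>z\<bar> < 1" using assms by simp
    show "norm (pochhammer a n * pochhammer b n / (pochhammer c n * fact n) * z ^ n) \<le>
        pochhammer a n / fact n * z ^ n" if "0 \<le> n" for n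
    proof -
      have "pochhammer b n / pochhammer c n \<le> 1" using pos bc by simp
      then have "pochhammer a n / fact n * z ^ n * (pochhammer b n / pochhammer c n) \<le> pochhammer a n / fact n * z ^ n"
        using pos assms by (intro mult_left_le) (auto simp: less_imp_le)
      moreover have nonneg: "0 \<le> pochhammer a n * pochhammer b n / (pochhammer c n * fact n) * z ^ n"
        using pos assms by (simp add: less_imp_le)
      ultimately show ?thesis
        unfolding real_norm_def abs_of_nonneg[OF nonneg] by (simp add: mult_ac)
    qed
  qed
  then show "(\<lambda>n. pochhammer a n * pochhammer b n / (pochhammer c n * fact n) * z ^ n) sums hyp2F1 a b c z"
    unfolding hyp2F1_altdef by (rule summable_sums)
  from sums_le[OF _ sums_zero this] show "0 \<le> hyp2F1 a b c z"
    using pos assms by (simp add: less_imp_le)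
qed

text \<open>Expand (1 - z v)^(-a) in its binomial series. For z \<ge> 0 all terms are nonnegative,
  so they may be integrated one by one, and each is a Beta integral with b shifted by n.\<close>

lemma nn_integral_Euler:
  fixes a b c z :: real
  assumes "0 < a" "0 < b" "b < c" "0 \<le> z" "z < 1"
  shows "(\<integral>\<^sup>+v. ennreal (v powr (b - 1) * (1 - v) powr (c - b - 1) / (1 - z * v) powr a) * indicator {0<..<1} v \<partial>lborel)
     = ennreal (Beta b (c - b) * hyp2F1 a b c z)"
proof -
  have pos: "0 < pochhammer a n" for n
    using assms by (auto intro!: pochhammer_pos)
  let ?t = "\<lambda>n v. pochhammer a n / fact n * z ^ n * (v powr (b + real n - 1) * (1 - v) powr (c - b - 1))"
  have "(\<integral>\<^sup>+v. ennreal (v powr (b - 1) * (1 - v) powr (c - b - 1) / (1 - z * v) powr a) * indicator {0<..<1} v \<partial>lborel)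
      = (\<integral>\<^sup>+v. (\<Sum>n. ennreal (?t n v) * indicator {0<..<1} v) \<partial>lborel)"
  proof (rule nn_integral_cong)
    fix v :: real
    show "ennreal (v powr (b - 1) * (1 - v) powr (c - b - 1) / (1 - z * v) powr a) * indicator {0<..<1} v =
        (\<Sum>n. ennreal (?t n v) * indicator {0<..<1} v)"
    proof (cases "v \<in> {0<..<1}")
      case True
      then have zv: "\<bar>z * v\<bar> < 1"
        using assms by (auto simp: abs_mult intro!: le_less_trans[OF mult_left_le])
      have "?t n v = pochhammer a n / fact n * (z * v) ^ n * (v powr (b - 1) * (1 - v) powr (c - b - 1))" for n
        using True by (simp add: powr_add powr_diff powr_realpow power_mult_distrib)
      then have "(\<lambda>n. ?t n v) sums ((1 - z * v) powr (-a) * (v powr (b - 1) * (1 - v) powr (c - b - 1)))"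
        using sums_mult2[OF sums_one_minus_powr[OF zv, of a]] by (simp only:)
      then have "(\<lambda>n. ?t n v) sums (v powr (b - 1) * (1 - v) powr (c - b - 1) / (1 - z * v) powr a)"
        by (simp add: powr_minus divide_simps)
      then have "(\<Sum>n. ennreal (?t n v)) = ennreal (v powr (b - 1) * (1 - v) powr (c - b - 1) / (1 - z * v) powr a)"
        using pos assms by (intro suminf_ennreal_eq) (auto simp: less_imp_le)
      then show ?thesis using True by simp
    qed simp
  qed
  also have "\<dots> = (\<Sum>n. (\<integral>\<^sup>+v. ennreal (?t n v) * indicator {0<..<1} v \<partial>lborel))"
    by (rule nn_integral_suminf) simp
  also have "\<dots> = (\<Sum>n. ennreal (Beta b (c - b) * (pochhammer a n * pochhammer b n / (pochhammer c n * fact n) * z ^ n)))"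
  proof (rule suminf_cong)
    fix n
    have "(\<integral>\<^sup>+v. ennreal (?t n v) * indicator {0<..<1} v \<partial>lborel) =
        (\<integral>\<^sup>+v. ennreal (pochhammer a n / fact n * z ^ n) *
           (ennreal (v powr (b + real n - 1) * (1 - v) powr (c - b - 1)) * indicator {0<..<1} v) \<partial>lborel)"
    proof -
      have "ennreal (x * y) * i = ennreal x * (ennreal y * i)" if "0 \<le> x" for x y :: real and i
        using that by (simp add: ennreal_mult' mult.assoc)
      moreover have "0 \<le> pochhammer a n / fact n * z ^ n" using pos assms by (simp add: less_imp_le)
      ultimately show ?thesis by (intro nn_integral_cong) blast
    qed
    also have "\<dots> = ennreal (pochhammer a n / fact n * z ^ n) * ennreal (Beta (b + real n) (c - b))"
      using assms by (subst nn_integral_cmult) (auto simp: nn_integral_Beta_real)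
    also have "\<dots> = ennreal (pochhammer a n / fact n * z ^ n * Beta (b + real n) (c - b))"
      using pos assms by (subst ennreal_mult) (auto simp: less_imp_le Beta_pos)
    also have "pochhammer a n / fact n * z ^ n * Beta (b + real n) (c - b) =
        Beta b (c - b) * (pochhammer a n * pochhammer b n / (pochhammer c n * fact n) * z ^ n)"
      using assms by (subst Beta_shift_pochhammer) (auto simp: mult_ac)
    finally show "(\<integral>\<^sup>+v. ennreal (?t n v) * indicator {0<..<1} v \<partial>lborel) = ennreal \<dots>" .
  qed
  also have "\<dots> = ennreal (Beta b (c - b) * hyp2F1 a b c z)"
  proof (rule suminf_ennreal_eq)
    show "0 \<le> Beta b (c - b) * (pochhammer a n * pochhammer b n / (pochhammer c n * fact n) * z ^ n)" for n
      using assms pochhammer_pos[of b n] pochhammer_pos[of c n] pos[of n] Beta_pos[of b "c - b"]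
      by (simp add: less_imp_le)
  qed (intro sums_mult hyp2F1_sums assms)
  finally show ?thesis .
qed

text \<open>The value I is left open because the integral over (0,1) is evaluated differently for w
  \<le> 1 and for w \<ge> 1.\<close>

lemma nn_integral_pencil:
  fixes b \<mu> \<nu> w :: real
  assumes "0 < w"
    and I: "(\<integral>\<^sup>+v. ennreal (v powr (b - 1) * (1 - v) powr (\<mu> + \<nu> - b - 1) / (1 - (1 - w) * v) powr \<mu>) *
      indicator {0<..<1} v \<partial>lborel) = ennreal I" "0 \<le> I"
  shows "(\<integral>\<^sup>+x. ennreal (x powr (b - 1) / ((1 + x) powr \<nu> * (1 + w * x) powr \<mu>)) \<partial>lpos) = ennreal I"
proof (rule nn_integral_lpos_odds[OF _ _ _ I(2)])
  have "v powr (b - 1) * (1 - v) powr (\<mu> + \<nu> - b - 1) / (1 - (1 - w) * v) powr \<mu> =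
      (v / (1 - v)) powr (b - 1) / ((1 + v / (1 - v)) powr \<nu> * (1 + w * (v / (1 - v))) powr \<mu>) / (1 - v)\<^sup>2"
    if v: "0 < v" "v < 1" for v
  proof -
    have q: "0 < 1 - (1 - w) * v"
      using v \<open>0 < w\<close> add_pos_pos[of "1 - v" "w * v"] by (simp add: algebra_simps)
    have "1 + v / (1 - v) = 1 / (1 - v)" "1 + w * (v / (1 - v)) = (1 - (1 - w) * v) / (1 - v)"
      using v by (simp_all add: field_simps)
    moreover have "y powr (\<mu> + \<nu> - b - 1) = y powr \<mu> * y powr \<nu> / y powr (b - 1) / y\<^sup>2" if "0 < y" for y
      using that by (simp add: powr_diff powr_add power2_eq_square field_simps)
    then have "(1 - v) powr (\<mu> + \<nu> - b - 1) = (1 - v) powr \<mu> * (1 - v) powr \<nu> / (1 - v) powr (b - 1) / (1 - v)\<^sup>2"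
      using v by simp
    ultimately show ?thesis
      using v q by (simp add: powr_divide mult_ac)
  qed
  then show "(\<integral>\<^sup>+v. ennreal ((v / (1 - v)) powr (b - 1) /
      ((1 + v / (1 - v)) powr \<nu> * (1 + w * (v / (1 - v))) powr \<mu>) / (1 - v)\<^sup>2) *
      indicator {0<..<1} v \<partial>lborel) = ennreal I"
    unfolding I(1)[symmetric]
    by (intro nn_integral_cong) (auto simp: indicator_def)
qed (use assms in auto)

lemma nn_integral_hyp2F1_le:
  fixes b \<mu> \<nu> w :: real
  assumes "0 < \<mu>" "0 < b" "b < \<mu> + \<nu>" "0 < w" "w \<le> 1"
  shows "(\<integral>\<^sup>+x. ennreal (x powr (b - 1) / ((1 + x) powr \<nu> * (1 + w * x) powr \<mu>)) \<partial>lpos) =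
    ennreal (Beta b (\<mu> + \<nu> - b) * hyp2F1 \<mu> b (\<mu> + \<nu>) (1 - w))"
proof (rule nn_integral_pencil)
  show "(\<integral>\<^sup>+v. ennreal (v powr (b - 1) * (1 - v) powr (\<mu> + \<nu> - b - 1) / (1 - (1 - w) * v) powr \<mu>) *
      indicator {0<..<1} v \<partial>lborel) = ennreal (Beta b (\<mu> + \<nu> - b) * hyp2F1 \<mu> b (\<mu> + \<nu>) (1 - w))"
    by (rule nn_integral_Euler) (use assms in auto)
  show "0 \<le> Beta b (\<mu> + \<nu> - b) * hyp2F1 \<mu> b (\<mu> + \<nu>) (1 - w)"
    using assms Beta_pos[of b "\<mu> + \<nu> - b"] hyp2F1_nonneg[of \<mu> b "\<mu> + \<nu>" "1 - w"] by simp
qed (use assms in auto)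

text \<open>For w > 1 the argument 1 - w is negative, outside the range of
  \<open>nn_integral_Euler\<close>. The reflection of v uses 1 - (1-w)(1-v) = w (1 - (1 - 1/w) v):
  it extracts w^(-\<mu>) and exchanges b with \<mu> + \<nu> - b. This is Pfaff's transformation on
  the level of the integral.\<close>

lemma nn_integral_hyp2F1_ge:
  fixes b \<mu> \<nu> w :: real
  assumes "0 < \<mu>" "0 < b" "b < \<mu> + \<nu>" "1 \<le> w"
  shows "(\<integral>\<^sup>+x. ennreal (x powr (b - 1) / ((1 + x) powr \<nu> * (1 + w * x) powr \<mu>)) \<partial>lpos) =
    ennreal (Beta b (\<mu> + \<nu> - b) * w powr (- \<mu>) * hyp2F1 \<mu> (\<mu> + \<nu> - b) (\<mu> + \<nu>) (1 - 1 / w))"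
proof (rule nn_integral_pencil)
  let ?c = "\<mu> + \<nu>"
  let ?h = "\<lambda>v. ennreal (v powr (b - 1) * (1 - v) powr (?c - b - 1) / (1 - (1 - w) * v) powr \<mu>) * indicator {0<..<1} v"
  have "(\<integral>\<^sup>+v. ?h v \<partial>lborel) = ennreal \<bar>-1\<bar> * (\<integral>\<^sup>+v. ?h (1 + (-1) * v) \<partial>lborel)"
    by (rule nn_integral_real_affine) auto
  also have "\<dots> = (\<integral>\<^sup>+v. ?h (1 - v) \<partial>lborel)" by simp
  also have "\<dots> = (\<integral>\<^sup>+v. ennreal (w powr (- \<mu>)) * (ennreal (v powr ((?c - b) - 1) *
      (1 - v) powr (?c - (?c - b) - 1) / (1 - (1 - 1 / w) * v) powr \<mu>) * indicator {0<..<1} v) \<partial>lborel)"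
  proof (rule nn_integral_cong)
    fix v :: real
    show "?h (1 - v) = ennreal (w powr (- \<mu>)) * (ennreal (v powr ((?c - b) - 1) *
      (1 - v) powr (?c - (?c - b) - 1) / (1 - (1 - 1 / w) * v) powr \<mu>) * indicator {0<..<1} v)"
    proof (cases "v \<in> {0<..<1}")
      case True
      have "(1 - 1 / w) * v < 1"
        using True \<open>1 \<le> w\<close> by (intro le_less_trans[OF mult_left_le_one_le]) (auto simp: field_simps)
      then have "0 < 1 - (1 - 1 / w) * v" by simp
      moreover have "1 - (1 - w) * (1 - v) = w * (1 - (1 - 1 / w) * v)"
        using \<open>1 \<le> w\<close> by (simp add: field_simps)
      ultimately have "(1 - (1 - w) * (1 - v)) powr \<mu> = w powr \<mu> * (1 - (1 - 1 / w) * v) powr \<mu>"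
        using \<open>1 \<le> w\<close> by (simp add: powr_mult)
      then show ?thesis using True
        by (simp add: ennreal_mult [symmetric] powr_minus field_simps)
    qed (auto simp: indicator_def)
  qed
  also have "\<dots> = ennreal (w powr (- \<mu>)) * ennreal (Beta (?c - b) (?c - (?c - b)) * hyp2F1 \<mu> (?c - b) ?c (1 - 1 / w))"
    by (subst nn_integral_cmult, simp) (use assms in \<open>subst nn_integral_Euler, auto\<close>)
  also have "\<dots> = ennreal (Beta b (?c - b) * w powr (- \<mu>) * hyp2F1 \<mu> (?c - b) ?c (1 - 1 / w))"
    by (subst ennreal_mult' [symmetric]) (auto simp: Beta_commute[of b] mult_ac)
  finally show "(\<integral>\<^sup>+v. ?h v \<partial>lborel) = \<dots>" .
  show "0 \<le> Beta b (?c - b) * w powr (- \<mu>) * hyp2F1 \<mu> (?c - b) ?c (1 - 1 / w)"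
    using assms Beta_pos[of b "?c - b"] hyp2F1_nonneg[of \<mu> "?c - b" ?c "1 - 1 / w"] by simp
qed (use assms in auto)

section \<open>Stieltjes kernels and their multiplicative convolution\<close>

definition sk :: "real \<Rightarrow> real \<Rightarrow> real \<Rightarrow> real" where
  "sk b m u = (if 0 < u then u powr (b - 1) / (1 + u) powr m else 0)"

lemma sk_measurable [measurable]: "sk b m \<in> borel_measurable borel"
  unfolding sk_def[abs_def] by measurable

lemma sk_nonneg [simp]: "0 \<le> sk b m u"
  by (simp add: sk_def)

lemma kern_sk:
  assumes "0 < b - 1 / p" "b - 1 / p < m"
  shows "kern p (sk b m)"
proof -
  have "(\<integral>\<^sup>+u. ennreal (sk b m u * u powr (-1/p)) \<partial>lpos) =
      (\<integral>\<^sup>+u. ennreal (u powr ((b - 1/p) - 1) / (1 + u) powr ((b - 1/p) + (m - (b - 1/p)))) \<partial>lpos)"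
  proof (rule nn_integral_lpos_cong)
    fix u :: real assume u: "0 < u"
    have "u powr (b - 1) * u powr (-1/p) = u powr ((b - 1/p) - 1)"
      by (simp flip: powr_add add: algebra_simps)
    then show "ennreal (sk b m u * u powr (-1/p)) =
        ennreal (u powr ((b - 1/p) - 1) / (1 + u) powr ((b - 1/p) + (m - (b - 1/p))))"
      using u by (simp add: sk_def)
  qed
  also have "\<dots> < \<infinity>"
    by (subst nn_integral_Beta_prime) (use assms in auto)
  finally show ?thesis
    by (auto simp: kern_def sk_def)
qed

text \<open>Substitute s = t u. The identity holds at every t > 0 and not only almost everywhere, as
  the integral does not see the null set on which f and its representative differ.\<close>

lemma stieltjes_eq_dil:
  assumes [measurable]: "f0 \<in> borel_measurable borel" and eq: "AE x in lpos. f x = f0 x" and t: "0 < t"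
  shows "stieltjes b m f t = dil (sk b m) f0 t"
proof -
  let ?g = "\<lambda>s. (s powr (b - 1) / (s + t) powr m) *\<^sub>R f0 s"
  have "(LINT s:{0<..}|lebesgue. (s powr (b - 1) / (s + t) powr m) *\<^sub>R f s) =
      (LINT s|lpos. indicator {0<..} s *\<^sub>R ?g s)"
    by (rule set_integral_lebesgue_lpos) (use eq in \<open>auto elim!: eventually_mono\<close>)
  then have "stieltjes b m f t = t powr (m - b) *\<^sub>R (LINT s|lpos. indicator {0<..} s *\<^sub>R ?g s)"
    by (simp only: stieltjes_def)
  also have "(LINT s|lpos. indicator {0<..} s *\<^sub>R ?g s) = (LINT s|lpos. ?g s)"
    by (rule integral_lpos_cong) auto
  also have "\<dots> = t *\<^sub>R (LINT u|lpos. ?g (t * u))"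
    using t by (subst integral_lpos_scale[where g = ?g]) auto
  also have "t powr (m - b) *\<^sub>R (t *\<^sub>R (LINT u|lpos. ?g (t * u))) =
      (LINT u|lpos. (t powr (m - b) * t) *\<^sub>R ?g (t * u))"
    by (subst integral_scaleR_right) simp
  also have "\<dots> = dil (sk b m) f0 t"
    unfolding dil_def
  proof (rule integral_lpos_cong)
    fix u :: real assume u: "0 < u"
    have "t * u + t = t * (1 + u)" by (simp add: algebra_simps)
    then have "(t powr (m - b) * t) * ((t * u) powr (b - 1) / (t * u + t) powr m) = sk b m u"
      using u t by (simp add: sk_def powr_mult powr_diff)
    then show "(t powr (m - b) * t) *\<^sub>R ?g (t * u) = sk b m u *\<^sub>R f0 (t * u)"
      by simp
  qed auto
  finally show ?thesis .
qed

text \<open>Defined as an integral rather than by the hypergeometric formulas, so that measurability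
  in w comes for free; the closed forms are then evaluated pointwise on either side of w =
  1.\<close>

definition sk_conv :: "real \<Rightarrow> real \<Rightarrow> real \<Rightarrow> real \<Rightarrow> real \<Rightarrow> real" where
  "sk_conv \<beta> \<mu> \<gamma> \<nu> w = enn2real (\<integral>\<^sup>+u. ennreal (sk \<beta> \<mu> u * sk \<gamma> \<nu> (w / u) / u) \<partial>lpos)"

lemma sk_conv_measurable [measurable]: "sk_conv \<beta> \<mu> \<gamma> \<nu> \<in> borel_measurable borel"
  unfolding sk_conv_def[abs_def] by measurable

text \<open>Substitute u = w x: the first kernel yields (1 + w x)^\<mu>, while the second, evaluated
  at 1/x, yields (1 + x)^\<nu> together with the extra power x^(\<nu> - \<gamma>).\<close>

lemma sk_convolution:
  assumes w: "0 < w"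
  shows "(\<integral>\<^sup>+u. ennreal (sk \<beta> \<mu> u * sk \<gamma> \<nu> (w / u) / u) \<partial>lpos) =
    ennreal (w powr (\<beta> - 1)) *
    (\<integral>\<^sup>+x. ennreal (x powr ((\<beta> + \<nu> - \<gamma>) - 1) / ((1 + x) powr \<nu> * (1 + w * x) powr \<mu>)) \<partial>lpos)"
proof -
  let ?g = "\<lambda>u. ennreal (sk \<beta> \<mu> u * sk \<gamma> \<nu> (w / u) / u)"
  have "(\<integral>\<^sup>+u. ?g u \<partial>lpos) = ennreal w * (\<integral>\<^sup>+x. ?g (w * x) \<partial>lpos)"
    using w by (subst nn_integral_lpos_scale) (auto simp: mult.assoc [symmetric] ennreal_mult' [symmetric])
  also have "\<dots> = (\<integral>\<^sup>+x. ennreal w * ?g (w * x) \<partial>lpos)"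
    by (rule nn_integral_cmult [symmetric]) simp
  also have "\<dots> = (\<integral>\<^sup>+x. ennreal (w powr (\<beta> - 1)) *
      ennreal (x powr ((\<beta> + \<nu> - \<gamma>) - 1) / ((1 + x) powr \<nu> * (1 + w * x) powr \<mu>)) \<partial>lpos)"
  proof (rule nn_integral_lpos_cong)
    fix x :: real assume x: "0 < x"
    have "1 + 1 / x = (1 + x) / x" using x by (simp add: field_simps)
    then have "w * (sk \<beta> \<mu> (w * x) * sk \<gamma> \<nu> (w / (w * x)) / (w * x)) =
        w powr (\<beta> - 1) * (x powr ((\<beta> + \<nu> - \<gamma>) - 1) / ((1 + x) powr \<nu> * (1 + w * x) powr \<mu>))"
      using x w by (simp add: sk_def powr_mult powr_divide powr_diff powr_add)
    then show "ennreal w * ?g (w * x) = ennreal (w powr (\<beta> - 1)) *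
      ennreal (x powr ((\<beta> + \<nu> - \<gamma>) - 1) / ((1 + x) powr \<nu> * (1 + w * x) powr \<mu>))"
      using w by (simp add: ennreal_mult' [symmetric])
  qed
  also have "\<dots> = ennreal (w powr (\<beta> - 1)) *
    (\<integral>\<^sup>+x. ennreal (x powr ((\<beta> + \<nu> - \<gamma>) - 1) / ((1 + x) powr \<nu> * (1 + w * x) powr \<mu>)) \<partial>lpos)"
    by (rule nn_integral_cmult) simp
  finally show ?thesis .
qed

lemma
  fixes \<beta> \<mu> \<gamma> \<nu> w :: real
  assumes "0 < \<mu>" "\<gamma> - \<beta> < \<nu>" "\<beta> - \<gamma> < \<mu>" "0 < w"
  defines "b \<equiv> \<beta> + \<nu> - \<gamma>" and "d \<equiv> \<gamma> + \<mu> - \<beta>"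
  shows sk_conv_le: "w \<le> 1 \<Longrightarrow> sk_conv \<beta> \<mu> \<gamma> \<nu> w = Beta b d * w powr (\<beta> - 1) * hyp2F1 \<mu> b (\<mu> + \<nu>) (1 - w)" (is "_ \<Longrightarrow> ?le")
    and sk_conv_ge: "1 \<le> w \<Longrightarrow> sk_conv \<beta> \<mu> \<gamma> \<nu> w = Beta b d * w powr (\<beta> - \<mu> - 1) * hyp2F1 \<mu> d (\<mu> + \<nu>) (1 - 1 / w)" (is "_ \<Longrightarrow> ?ge")
    and sk_conv_finite: "(\<integral>\<^sup>+u. ennreal (sk \<beta> \<mu> u * sk \<gamma> \<nu> (w / u) / u) \<partial>lpos) = ennreal (sk_conv \<beta> \<mu> \<gamma> \<nu> w)"
proof -
  have bd: "0 < b" "0 < d" "b < \<mu> + \<nu>" "\<mu> + \<nu> - b = d" "d < \<mu> + \<nu>" using assms by auto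
  have le: "(\<integral>\<^sup>+u. ennreal (sk \<beta> \<mu> u * sk \<gamma> \<nu> (w / u) / u) \<partial>lpos) =
      ennreal (Beta b d * w powr (\<beta> - 1) * hyp2F1 \<mu> b (\<mu> + \<nu>) (1 - w))" if "w \<le> 1"
  proof -
    have "(\<integral>\<^sup>+u. ennreal (sk \<beta> \<mu> u * sk \<gamma> \<nu> (w / u) / u) \<partial>lpos) =
        ennreal (w powr (\<beta> - 1)) * ennreal (Beta b d * hyp2F1 \<mu> b (\<mu> + \<nu>) (1 - w))"
      using nn_integral_hyp2F1_le[of \<mu> b \<nu> w, unfolded bd(4)] that bd assms(1,4)
        sk_convolution[OF \<open>0 < w\<close>, of \<beta> \<mu> \<gamma> \<nu>, folded b_def] by (simp only:)
    also have "\<dots> = ennreal (Beta b d * w powr (\<beta> - 1) * hyp2F1 \<mu> b (\<mu> + \<nu>) (1 - w))"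
      by (subst ennreal_mult' [symmetric]) (auto simp: mult_ac)
    finally show ?thesis .
  qed
  have ge: "(\<integral>\<^sup>+u. ennreal (sk \<beta> \<mu> u * sk \<gamma> \<nu> (w / u) / u) \<partial>lpos) =
      ennreal (Beta b d * w powr (\<beta> - \<mu> - 1) * hyp2F1 \<mu> d (\<mu> + \<nu>) (1 - 1 / w))" if "1 \<le> w"
  proof -
    have "(\<integral>\<^sup>+u. ennreal (sk \<beta> \<mu> u * sk \<gamma> \<nu> (w / u) / u) \<partial>lpos) =
        ennreal (w powr (\<beta> - 1)) * ennreal (Beta b d * w powr (- \<mu>) * hyp2F1 \<mu> d (\<mu> + \<nu>) (1 - 1 / w))"
      using nn_integral_hyp2F1_ge[of \<mu> b \<nu> w, unfolded bd(4)] that bd assms(1,4)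
        sk_convolution[OF \<open>0 < w\<close>, of \<beta> \<mu> \<gamma> \<nu>, folded b_def] by (simp only:)
    also have "\<dots> = ennreal (w powr (\<beta> - 1) * (Beta b d * w powr (- \<mu>) * hyp2F1 \<mu> d (\<mu> + \<nu>) (1 - 1 / w)))"
      by (subst ennreal_mult' [symmetric]) auto
    also have "w powr (\<beta> - 1) * (Beta b d * w powr (- \<mu>) * hyp2F1 \<mu> d (\<mu> + \<nu>) (1 - 1 / w)) =
        Beta b d * w powr (\<beta> - \<mu> - 1) * hyp2F1 \<mu> d (\<mu> + \<nu>) (1 - 1 / w)"
    proof -
      have "w powr (\<beta> - 1) * w powr (- \<mu>) = w powr (\<beta> - \<mu> - 1)"
        by (simp flip: powr_add add: algebra_simps)
      then show ?thesis by (metis mult.assoc mult.commute)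
    qed
    finally show ?thesis .
  qed
  have nle: "0 \<le> Beta b d * w powr (\<beta> - 1) * hyp2F1 \<mu> b (\<mu> + \<nu>) (1 - w)" if "w \<le> 1"
    using bd assms that Beta_pos[of b d] hyp2F1_nonneg[of \<mu> b "\<mu> + \<nu>" "1 - w"] by simp
  have nge: "0 \<le> Beta b d * w powr (\<beta> - \<mu> - 1) * hyp2F1 \<mu> d (\<mu> + \<nu>) (1 - 1 / w)" if "1 \<le> w"
    using bd assms that Beta_pos[of b d] hyp2F1_nonneg[of \<mu> d "\<mu> + \<nu>" "1 - 1 / w"] by simp
  show "w \<le> 1 \<Longrightarrow> ?le" unfolding sk_conv_def using le nle by simp
  show "1 \<le> w \<Longrightarrow> ?ge" unfolding sk_conv_def using ge nge by simp
  show "(\<integral>\<^sup>+u. ennreal (sk \<beta> \<mu> u * sk \<gamma> \<nu> (w / u) / u) \<partial>lpos) = ennreal (sk_conv \<beta> \<mu> \<gamma> \<nu> w)"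
    using le ge by (cases "w \<le> 1") (auto simp: sk_conv_def)
qed

lemma dil_rescale:
  assumes [measurable]: "m \<in> borel_measurable borel" "f \<in> borel_measurable borel" and t: "0 < t"
  shows "dil m f t = (LINT s|lpos. (m (s / t) / t) *\<^sub>R f s)"
    and "integrable lpos (\<lambda>w. m w *\<^sub>R f (t * w)) \<longleftrightarrow> integrable lpos (\<lambda>s. (m (s / t) / t) *\<^sub>R f s)"
proof -
  let ?g = "\<lambda>s. m (s / t) *\<^sub>R f s"
  have eq: "(m (s / t) / t) *\<^sub>R f s = (1 / t) *\<^sub>R ?g s" for s by simp
  have "dil m f t = (LINT w|lpos. ?g (t * w))" using t by (simp add: dil_def)
  also have "\<dots> = (LINT s|lpos. (m (s / t) / t) *\<^sub>R f s)"
    unfolding eq integral_scaleR_right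
    using t by (subst integral_lpos_scale[where g = ?g]) (simp_all add: inverse_eq_divide)
  finally show "dil m f t = (LINT s|lpos. (m (s / t) / t) *\<^sub>R f s)" .
  have "integrable lpos (\<lambda>w. m w *\<^sub>R f (t * w)) \<longleftrightarrow> integrable lpos (\<lambda>w. ?g (t * w))"
    using t by simp
  also have "\<dots> \<longleftrightarrow> integrable lpos ?g"
    using t by (intro integrable_lpos_scale) auto
  also have "\<dots> \<longleftrightarrow> integrable lpos (\<lambda>s. (m (s / t) / t) *\<^sub>R f s)"
    unfolding eq using t integrable_scaleR_right[of "1/t" lpos ?g]
      integrable_scaleR_right[of t lpos "\<lambda>s. (1 / t) *\<^sub>R ?g s"] by auto
  finally show "integrable lpos (\<lambda>w. m w *\<^sub>R f (t * w)) \<longleftrightarrow> integrable lpos (\<lambda>s. (m (s / t) / t) *\<^sub>R f s)" .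
qed

text \<open>The inner transform enters as any h equal to it almost everywhere, because for the
  second formula h is the adjoint, which is known only up to null sets.\<close>

lemma stieltjes_compose:
  fixes p \<beta> \<mu> \<gamma> \<nu> :: real
  assumes p: "1 \<le> p" and \<beta>: "0 < \<beta> - 1 / p" "\<beta> - 1 / p < \<mu>" and \<gamma>: "0 < \<gamma> - 1 / p" "\<gamma> - 1 / p < \<nu>"
    and f: "f \<in> Lp_pos p" and h: "AE t in lpos. h t = stieltjes \<gamma> \<nu> f t"
  shows "AE t in lebesgue_on {0<..}.
          let k1 = (\<lambda>s. (s powr (\<beta> - 1) / t powr \<beta> *
                     hyp2F1 \<mu> (\<beta> + \<nu> - \<gamma>) (\<mu> + \<nu>) (1 - s / t)) *\<^sub>R f s);
              k2 = (\<lambda>s. (t powr (\<mu> - \<beta>) / s powr (\<mu> - \<beta> + 1) *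
                     hyp2F1 \<mu> (\<gamma> + \<mu> - \<beta>) (\<mu> + \<nu>) (1 - t / s)) *\<^sub>R f s)
          in set_integrable lebesgue {0<..<t} k1 \<and> set_integrable lebesgue {t<..} k2 \<and>
             stieltjes \<beta> \<mu> h t /\<^sub>R Beta (\<beta> + \<nu> - \<gamma>) (\<gamma> + \<mu> - \<beta>) =
             (LINT s:{0<..<t}|lebesgue. k1 s) + (LINT s:{t<..}|lebesgue. k2 s)"
proof -
  obtain f0 where f0: "f0 \<in> Lp p" and ff0: "AE x in lpos. f x = f0 x"
    using Lp_pos_obtain_borel[OF f] .
  note [measurable] = LpD(1)[OF f0]
  define B where "B = Beta (\<beta> + \<nu> - \<gamma>) (\<gamma> + \<mu> - \<beta>)"
  have B: "0 < B" unfolding B_def using \<beta> \<gamma> by (intro Beta_pos) auto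
  \<comment> \<open>The terms 1/p cancel: \<gamma> - \<beta> is less than \<gamma> - 1/p, and
    \<beta> - \<gamma> less than \<beta> - 1/p.\<close>
  have \<mu>: "0 < \<mu>" "\<gamma> - \<beta> < \<nu>" "\<beta> - \<gamma> < \<mu>" using \<beta> \<gamma> by auto
  let ?m = "sk_conv \<beta> \<mu> \<gamma> \<nu>"
  have hd: "AE t in lpos. h t = dil (sk \<gamma> \<nu>) f0 t"
    using h AE_lpos_pos by eventually_elim (use ff0 in \<open>simp add: stieltjes_eq_dil\<close>)
  have "AE t in lpos. integrable lpos (\<lambda>w. ?m w *\<^sub>R f0 (t * w)) \<and> dil (sk \<beta> \<mu>) (dil (sk \<gamma> \<nu>) f0) t = dil ?m f0 t"
    by (rule dil_compose[OF kern_sk[OF \<beta>] kern_sk[OF \<gamma>] f0 p])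
      (use sk_conv_finite[OF \<mu>] in \<open>auto simp: sk_conv_def\<close>)
  then show ?thesis
    unfolding AE_lebesgue_on_pos using AE_lpos_pos
  proof eventually_elim
    case (elim t)
    then have t: "0 < t" by simp
    let ?k1 = "\<lambda>f s. (s powr (\<beta> - 1) / t powr \<beta> * hyp2F1 \<mu> (\<beta> + \<nu> - \<gamma>) (\<mu> + \<nu>) (1 - s / t)) *\<^sub>R f s"
    let ?k2 = "\<lambda>f s. (t powr (\<mu> - \<beta>) / s powr (\<mu> - \<beta> + 1) * hyp2F1 \<mu> (\<gamma> + \<mu> - \<beta>) (\<mu> + \<nu>) (1 - t / s)) *\<^sub>R f s"
    \<comment> \<open>One integrand for both ranges: it is the first kernel for s < t and the second
      for s > t, and s = t is a null set. Its integrability on the whole half-line implies both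
      integrability claims.\<close>
    define k where "k s = (?m (s / t) / t / B) *\<^sub>R f0 s" for s
    have [measurable]: "k \<in> borel_measurable borel" unfolding k_def by measurable
    have k_eq: "k = (\<lambda>s. (1 / B) *\<^sub>R ((?m (s / t) / t) *\<^sub>R f0 s))"
      by (simp add: k_def fun_eq_iff mult_ac)
    have kint: "integrable lpos k"
      unfolding k_eq using elim dil_rescale(2)[of ?m f0 t] t by (intro integrable_scaleR_right) auto
    have k1: "?k1 f0 s = k s" if "0 < s" "s < t" for s
      using that sk_conv_le[OF \<mu>, of "s / t"] B t
      by (simp add: k_def B_def[symmetric] powr_divide powr_diff)
    have k2: "?k2 f0 s = k s" if "t < s" for s
    proof -
      have "(s / t) powr (\<beta> - \<mu> - 1) / t = t powr (\<mu> - \<beta>) / s powr (\<mu> - \<beta> + 1)"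
        using that t by (simp add: powr_divide powr_diff powr_add field_simps)
      moreover have "?m (s / t) / t / B = (s / t) powr (\<beta> - \<mu> - 1) / t * hyp2F1 \<mu> (\<gamma> + \<mu> - \<beta>) (\<mu> + \<nu>) (1 - t / s)"
        using that sk_conv_ge[OF \<mu>, of "s / t"] B t
        by (simp add: B_def[symmetric])
      ultimately show ?thesis unfolding k_def by (simp only:)
    qed
    have e1: "AE s in lpos. s \<in> {0<..<t} \<longrightarrow> ?k1 f s = k s"
      using ff0 by eventually_elim (use k1 in auto)
    have e2: "AE s in lpos. s \<in> {t<..} \<longrightarrow> ?k2 f s = k s"
      using ff0 by eventually_elim (use k2 in auto)
    have i: "integrable lpos (\<lambda>s. indicat_real A s *\<^sub>R k s)" if "A \<in> sets borel" for A
      using kint that by (intro integrable_mult_indicator) auto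
    have "set_integrable lebesgue {0<..<t} (?k1 f)"
      by (subst set_integrable_lebesgue_lpos[OF _ _ _ e1]) (auto intro!: i)
    moreover have "set_integrable lebesgue {t<..} (?k2 f)"
      by (subst set_integrable_lebesgue_lpos[OF _ _ _ e2]) (use t in \<open>auto intro!: i\<close>)
    moreover have "stieltjes \<beta> \<mu> h t /\<^sub>R B =
        (LINT s:{0<..<t}|lebesgue. ?k1 f s) + (LINT s:{t<..}|lebesgue. ?k2 f s)"
    proof -
      have "stieltjes \<beta> \<mu> h t = (LINT s|lpos. (?m (s / t) / t) *\<^sub>R f0 s)"
        using stieltjes_eq_dil[OF _ hd t] elim dil_rescale(1)[of ?m f0 t] t by simp
      then have "stieltjes \<beta> \<mu> h t /\<^sub>R B = (LINT s|lpos. k s)"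
        unfolding k_eq by (subst integral_scaleR_right) (simp add: inverse_eq_divide)
      also have "\<dots> = (LINT s|lpos. indicat_real {0<..<t} s *\<^sub>R k s + indicat_real {t<..} s *\<^sub>R k s)"
      proof (rule integral_cong_AE)
        have "AE s in lpos. s \<noteq> t"
          unfolding AE_lpos using AE_lborel_singleton[of t] by eventually_elim simp
        then show "AE s in lpos. k s = indicat_real {0<..<t} s *\<^sub>R k s + indicat_real {t<..} s *\<^sub>R k s"
          using AE_lpos_pos by eventually_elim (auto simp: indicator_def)
      qed auto
      also have "\<dots> = (LINT s|lpos. indicat_real {0<..<t} s *\<^sub>R k s) + (LINT s|lpos. indicat_real {t<..} s *\<^sub>R k s)"
        by (rule Bochner_Integration.integral_add) (auto intro!: i)
      also have "(LINT s|lpos. indicat_real {0<..<t} s *\<^sub>R k s) = (LINT s:{0<..<t}|lebesgue. ?k1 f s)"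
        by (rule set_integral_lebesgue_lpos[OF _ _ _ e1, symmetric]) auto
      also have "(LINT s|lpos. indicat_real {t<..} s *\<^sub>R k s) = (LINT s:{t<..}|lebesgue. ?k2 f s)"
        by (rule set_integral_lebesgue_lpos[OF _ _ _ e2, symmetric]) (use t in auto)
      finally show ?thesis .
    qed
    ultimately show ?case unfolding Let_def B_def by blast
  qed
qed

section \<open>Erdelyi-Kober operators\<close>

text \<open>With s = t u, the operator \<open>dil (ek \<eta> a)\<close> is the Erdelyi-Kober
  integral of order a: t^\<eta> / \<Gamma>(a) times the integral over s > t of (s-t)^(a-1)
  s^(-a-\<eta>) f(s).\<close>

definition ek :: "real \<Rightarrow> real \<Rightarrow> real \<Rightarrow> real" where
  "ek \<eta> a u = (if 1 < u then (u - 1) powr (a - 1) * u powr (- a - \<eta>) / Gamma a else 0)"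

lemma ek_measurable [measurable]: "ek \<eta> a \<in> borel_measurable borel"
  unfolding ek_def[abs_def] by measurable

lemma ek_nonneg: "0 < a \<Longrightarrow> 0 \<le> ek \<eta> a u"
  by (simp add: ek_def Gamma_real_pos less_imp_le)

lemma nn_integral_lpos_shift:
  assumes [measurable]: "g \<in> borel_measurable borel"
  shows "(\<integral>\<^sup>+u. (if 1 < u then g u else 0) \<partial>lpos) = (\<integral>\<^sup>+x. g (1 + x) \<partial>lpos)"
proof -
  have "(\<integral>\<^sup>+u. (if 1 < u then g u else 0) \<partial>lpos) = (\<integral>\<^sup>+u. indicator {1<..} u * g u \<partial>lborel)"
    by (subst nn_integral_lpos) (auto intro!: nn_integral_cong simp: indicator_def)
  also have "\<dots> = ennreal \<bar>1\<bar> * (\<integral>\<^sup>+x. indicator {1<..} (1 + 1 * x) * g (1 + 1 * x) \<partial>lborel)"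
    by (rule nn_integral_real_affine) auto
  also have "\<dots> = (\<integral>\<^sup>+x. g (1 + x) \<partial>lpos)"
    by (subst nn_integral_lpos) (auto intro!: nn_integral_cong simp: indicator_def)
  finally show ?thesis .
qed

text \<open>With u = 1 + x the moment becomes B(a, \<eta> + 1/p) / \<Gamma>(a), which explains the
  condition on \<eta>.\<close>

lemma kern_ek:
  assumes "0 < a" "0 < \<eta> + 1 / p"
  shows "kern p (ek \<eta> a)"
proof -
  have "(\<integral>\<^sup>+u. ennreal (ek \<eta> a u * u powr (-1/p)) \<partial>lpos) =
      (\<integral>\<^sup>+u. (if 1 < u then ennreal ((u - 1) powr (a - 1) * u powr (- a - \<eta>) / Gamma a * u powr (-1/p)) else 0) \<partial>lpos)"
    by (rule nn_integral_cong) (simp add: ek_def)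
  also have "\<dots> = (\<integral>\<^sup>+x. ennreal ((1 + x - 1) powr (a - 1) * (1 + x) powr (- a - \<eta>) / Gamma a * (1 + x) powr (-1/p)) \<partial>lpos)"
    by (rule nn_integral_lpos_shift) simp
  also have "\<dots> = (\<integral>\<^sup>+x. ennreal (1 / Gamma a) * ennreal (x powr (a - 1) / (1 + x) powr (a + (\<eta> + 1 / p))) \<partial>lpos)"
  proof (rule nn_integral_lpos_cong)
    fix x :: real assume x: "0 < x"
    have "- a - \<eta> + -1/p = - (a + (\<eta> + 1 / p))" by simp
    then have "(1 + x) powr (- a - \<eta>) * (1 + x) powr (-1/p) = (1 + x) powr (- (a + (\<eta> + 1 / p)))"
      by (simp only: powr_add [symmetric])
    also have "\<dots> = 1 / (1 + x) powr (a + (\<eta> + 1 / p))" by (rule powr_minus_divide)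
    finally have "(1 + x - 1) powr (a - 1) * (1 + x) powr (- a - \<eta>) / Gamma a * (1 + x) powr (-1/p) =
        1 / Gamma a * (x powr (a - 1) / (1 + x) powr (a + (\<eta> + 1 / p)))"
      by (simp add: field_simps)
    then show "ennreal ((1 + x - 1) powr (a - 1) * (1 + x) powr (- a - \<eta>) / Gamma a * (1 + x) powr (-1/p)) =
        ennreal (1 / Gamma a) * ennreal (x powr (a - 1) / (1 + x) powr (a + (\<eta> + 1 / p)))"
      using assms by (simp only:) (rule ennreal_mult', simp add: Gamma_real_pos less_imp_le)
  qed
  also have "\<dots> = ennreal (1 / Gamma a) * ennreal (Beta a (\<eta> + 1 / p))"
    by (subst nn_integral_cmult) (use assms in \<open>simp_all add: nn_integral_Beta_prime\<close>)
  also have "\<dots> < \<infinity>" by (simp add: ennreal_mult_less_top)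
  finally show ?thesis
    using ek_nonneg[OF assms(1)] by (auto simp: kern_def) (simp add: ek_def)
qed

text \<open>Semigroup law in the order. The shift of the second parameter to \<eta> + a makes all
  powers of u cancel; u = 1 + (w-1) v then leaves B(a, s), whose Gamma factors replace \<Gamma>(a)
  \<Gamma>(s) by \<Gamma>(a + s).\<close>

lemma ek_convolution:
  assumes a: "0 < a" and s: "0 < s" and w: "0 < w"
  shows "(\<integral>\<^sup>+u. ennreal (ek \<eta> a u * ek (\<eta> + a) s (w / u) / u) \<partial>lpos) = ennreal (ek \<eta> (a + s) w)"
proof (cases "1 < w")
  case False
  have "(\<integral>\<^sup>+u. ennreal (ek \<eta> a u * ek (\<eta> + a) s (w / u) / u) \<partial>lpos) = (\<integral>\<^sup>+u. 0 \<partial>lpos)"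
  proof (rule nn_integral_lpos_cong)
    fix u :: real assume "0 < u"
    then have "\<not> (1 < u \<and> 1 < w / u)" using False by (auto simp: less_divide_eq)
    then show "ennreal (ek \<eta> a u * ek (\<eta> + a) s (w / u) / u) = 0" by (auto simp: ek_def)
  qed
  then show ?thesis using False by (simp add: ek_def)
next
  case True
  define C where "C = w powr (- (a + s) - \<eta>) / (Gamma a * Gamma s)"
  have G: "0 < Gamma a" "0 < Gamma s" "0 < Gamma (a + s)" using a s by (auto intro!: Gamma_real_pos)
  have C: "0 \<le> C" using G by (simp add: C_def less_imp_le)
  let ?h = "\<lambda>u. ennreal (C * ((u - 1) powr (a - 1) * (w - u) powr (s - 1))) * indicator {1<..<w} u"
  have "(\<integral>\<^sup>+u. ennreal (ek \<eta> a u * ek (\<eta> + a) s (w / u) / u) \<partial>lpos) = (\<integral>\<^sup>+u. ?h u \<partial>lpos)"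
  proof (rule nn_integral_lpos_cong)
    fix u :: real assume u: "0 < u"
    show "ennreal (ek \<eta> a u * ek (\<eta> + a) s (w / u) / u) = ?h u"
    proof (cases "u \<in> {1<..<w}")
      case True
      then have wu: "1 < w / u" "w / u - 1 = (w - u) / u" using u by (auto simp: field_simps)
      have "(w / u) powr (- s - (\<eta> + a)) = w powr (- (a + s) - \<eta>) * u powr (s + \<eta> + a)"
        using u w by (simp add: powr_divide powr_diff powr_minus powr_add field_simps)
      moreover have "((w - u) / u) powr (s - 1) = (w - u) powr (s - 1) * u powr (1 - s)"
        using True u by (simp add: powr_divide powr_diff field_simps)
      moreover have "u powr (- a - \<eta>) * u powr (1 - s) * u powr (s + \<eta> + a) = u"
        using u by (simp flip: powr_add)
      ultimately have "u powr (- a - \<eta>) * (((w - u) / u) powr (s - 1) * (w / u) powr (- s - (\<eta> + a))) / u =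
          w powr (- (a + s) - \<eta>) * (w - u) powr (s - 1)"
        using u by (simp add: field_simps)
      moreover have "ek \<eta> a u * ek (\<eta> + a) s (w / u) / u = (u - 1) powr (a - 1) / (Gamma a * Gamma s) *
          (u powr (- a - \<eta>) * (((w - u) / u) powr (s - 1) * (w / u) powr (- s - (\<eta> + a))) / u)"
        using True wu by (simp add: ek_def)
      ultimately have "ek \<eta> a u * ek (\<eta> + a) s (w / u) / u = C * ((u - 1) powr (a - 1) * (w - u) powr (s - 1))"
        by (simp add: C_def)
      then show ?thesis using True by simp
    next
      case False
      then have "\<not> (1 < u \<and> 1 < w / u)" using u by (auto simp: less_divide_eq)
      then show ?thesis using False by (auto simp: ek_def)
    qed
  qed
  also have "\<dots> = (\<integral>\<^sup>+u. ?h u \<partial>lborel)"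
    by (subst nn_integral_lpos) (auto intro!: nn_integral_cong simp: indicator_def)
  also have "\<dots> = ennreal \<bar>w - 1\<bar> * (\<integral>\<^sup>+v. ?h (1 + (w - 1) * v) \<partial>lborel)"
    using True by (intro nn_integral_real_affine) auto
  also have "\<dots> = (\<integral>\<^sup>+v. ennreal (w - 1) * ?h (1 + (w - 1) * v) \<partial>lborel)"
    using True by (subst nn_integral_cmult) auto
  also have "\<dots> = (\<integral>\<^sup>+v. ennreal (C * (w - 1) powr (a + s - 1)) *
      (ennreal (v powr (a - 1) * (1 - v) powr (s - 1)) * indicator {0<..<1} v) \<partial>lborel)"
  proof (rule nn_integral_cong)
    fix v :: real
    have iff: "1 + (w - 1) * v \<in> {1<..<w} \<longleftrightarrow> v \<in> {0<..<1}"
    proof -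
      have "1 + (w - 1) * v < w \<longleftrightarrow> (w - 1) * v < (w - 1) * 1" by auto
      then show ?thesis
        using True mult_less_cancel_left_pos[of "w - 1" v 1] by (auto simp: zero_less_mult_iff)
    qed
    show "ennreal (w - 1) * ?h (1 + (w - 1) * v) = ennreal (C * (w - 1) powr (a + s - 1)) *
      (ennreal (v powr (a - 1) * (1 - v) powr (s - 1)) * indicator {0<..<1} v)"
    proof (cases "v \<in> {0<..<1}")
      case v: True
      define y where "y = w - 1"
      have y: "0 < y" using True by (simp add: y_def)
      have e: "w - (1 + y * v) = y * (1 - v)" by (simp add: y_def algebra_simps)
      have "y * (C * ((y * v) powr (a - 1) * (y * (1 - v)) powr (s - 1))) =
          C * (y * y powr (a - 1) * y powr (s - 1)) * (v powr (a - 1) * (1 - v) powr (s - 1))"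
        using v y by (simp add: powr_mult)
      also have "y * y powr (a - 1) * y powr (s - 1) = y powr (a + s - 1)"
        using y by (simp add: powr_diff powr_add)
      finally show ?thesis
        using v iff y C unfolding y_def[symmetric] e
        by (simp add: ennreal_mult' [symmetric] y_def[symmetric] e)
    qed (use iff in auto)
  qed
  also have "\<dots> = ennreal (C * (w - 1) powr (a + s - 1)) * ennreal (Beta a s)"
    by (subst nn_integral_cmult) (use a s in \<open>simp_all add: nn_integral_Beta_real\<close>)
  also have "\<dots> = ennreal (C * (w - 1) powr (a + s - 1) * Beta a s)"
    using C by (subst ennreal_mult' [symmetric]) auto
  also have "C * (w - 1) powr (a + s - 1) * Beta a s = ek \<eta> (a + s) w"
    using True G by (simp add: ek_def C_def Beta_def)
  finally show ?thesis .
qed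

lemma ek_compose:
  assumes "0 < a" "0 < s" "0 < \<eta> + 1 / p" "1 \<le> p" "f \<in> Lp p"
  shows "AE t in lpos. dil (ek \<eta> a) (dil (ek (\<eta> + a) s) f) t = dil (ek \<eta> (a + s)) f t"
proof -
  have "AE t in lpos. integrable lpos (\<lambda>w. ek \<eta> (a + s) w *\<^sub>R f (t * w)) \<and>
      dil (ek \<eta> a) (dil (ek (\<eta> + a) s) f) t = dil (ek \<eta> (a + s)) f t"
    by (rule dil_compose) (use assms ek_convolution in \<open>auto intro!: kern_ek ek_nonneg\<close>)
  then show ?thesis by eventually_elim simp
qed

section \<open>Injectivity of the Erdelyi-Kober operators\<close>

lemma AE_lpos_dense:
  assumes "AE t in lpos. P t" "0 \<le> x" "x < (y::real)"
  obtains t where "x < t" "t < y" "P t"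
proof (rule ccontr)
  assume "\<not> thesis"
  then have n: "\<And>t. x < t \<Longrightarrow> t < y \<Longrightarrow> \<not> P t" using that by blast
  have "AE t in lborel. t \<notin> {x<..<y}"
    using assms(1)[unfolded AE_lpos] by eventually_elim (use n assms(2) in auto)
  then have "emeasure lborel {x<..<y} = 0"
    using AE_iff_null_sets[of "{x<..<y}" lborel] by auto
  then show False using assms by simp
qed

text \<open>A set of full measure is dense, so by dominated convergence the tail integral vanishes
  at every x > 0. Open half-lines are stable under intersection and generate the Borel sets, so the
  integral over every Borel subset of a tail vanishes. As w need not be integrable near 0, this is
  done on the tail beyond a, for a = 1/(n+1).\<close>

lemma AE_zero_if_tail_integrals_zero:
  fixes w :: "real \<Rightarrow> complex"
  assumes [measurable]: "w \<in> borel_measurable borel"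
    and tail: "AE t in lpos. integrable lpos (\<lambda>s. indicator {t<..} s *\<^sub>R w s) \<and>
      (LINT s|lpos. indicator {t<..} s *\<^sub>R w s) = 0"
  shows "AE s in lpos. w s = 0"
proof -
  have int: "integrable lpos (\<lambda>s. indicat_real {x<..} s *\<^sub>R w s)" if x: "0 < x" for x
  proof -
    obtain t where t: "t < x" "integrable lpos (\<lambda>s. indicat_real {t<..} s *\<^sub>R w s)"
      using AE_lpos_dense[OF tail, of 0 x] x by auto
    have "integrable lpos (\<lambda>s. indicat_real {x<..} s *\<^sub>R (indicat_real {t<..} s *\<^sub>R w s))"
      by (rule integrable_mult_indicator) (use t in auto)
    also have "(\<lambda>s. indicat_real {x<..} s *\<^sub>R (indicat_real {t<..} s *\<^sub>R w s)) = (\<lambda>s. indicat_real {x<..} s *\<^sub>R w s)"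
      using t by (auto simp: indicator_def)
    finally show ?thesis .
  qed
  have zero: "(LINT s|lpos. indicat_real {x<..} s *\<^sub>R w s) = 0" if x: "0 < x" for x
  proof -
    \<comment> \<open>Approaching x from the right keeps the tails of \<open>t n\<close> inside the
      tail of x, whose integrability then gives the dominating function.\<close>
    have "\<exists>t. x < t \<and> t < x + 1 / real (Suc n) \<and> (LINT s|lpos. indicat_real {t<..} s *\<^sub>R w s) = 0" for n
      using AE_lpos_dense[OF tail, of x "x + 1 / real (Suc n)"] x by auto
    then obtain t where t: "\<And>n. x < t n" "\<And>n. t n < x + 1 / real (Suc n)"
      "\<And>n. (LINT s|lpos. indicat_real {t n<..} s *\<^sub>R w s) = 0" by metis
    have tx: "t \<longlonglongrightarrow> x"
    proof (rule tendsto_sandwich[where f = "\<lambda>_. x" and h = "\<lambda>n. x + 1 / real (Suc n)"])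
      show "(\<lambda>n. x + 1 / real (Suc n)) \<longlonglongrightarrow> x"
        using tendsto_add[OF tendsto_const LIMSEQ_Suc[OF lim_1_over_n], of x] by simp
    qed (use t in \<open>auto intro!: always_eventually less_imp_le\<close>)
    have "(\<lambda>n. LINT s|lpos. indicat_real {t n<..} s *\<^sub>R w s) \<longlonglongrightarrow> (LINT s|lpos. indicat_real {x<..} s *\<^sub>R w s)"
    proof (rule integral_dominated_convergence[where w = "\<lambda>s. norm (indicat_real {x<..} s *\<^sub>R w s)"])
      show "AE s in lpos. (\<lambda>n. indicat_real {t n<..} s *\<^sub>R w s) \<longlonglongrightarrow> indicat_real {x<..} s *\<^sub>R w s"
      proof (rule AE_I2)
        fix s
        show "(\<lambda>n. indicat_real {t n<..} s *\<^sub>R w s) \<longlonglongrightarrow> indicat_real {x<..} s *\<^sub>R w s"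
        proof (cases "x < s")
          case True
          have "eventually (\<lambda>n. t n < s) sequentially" using order_tendstoD(2)[OF tx True] .
          then have "eventually (\<lambda>n. indicat_real {t n<..} s *\<^sub>R w s = indicat_real {x<..} s *\<^sub>R w s) sequentially"
            by eventually_elim (use True in simp)
          then show ?thesis by (rule tendsto_eventually)
        next
          case False
          then have "\<not> t n < s" for n using t(1)[of n] by linarith
          then show ?thesis using False by (simp add: indicator_def)
        qed
      qed
      show "AE s in lpos. norm (indicat_real {t n<..} s *\<^sub>R w s) \<le> norm (indicat_real {x<..} s *\<^sub>R w s)" for n
        using t(1)[of n] by (intro AE_I2) (auto simp: indicator_def)
      show "integrable lpos (\<lambda>s. norm (indicat_real {x<..} s *\<^sub>R w s))"
        by (rule integrable_norm) (rule int[OF x])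
    qed auto
    then show ?thesis using t(3) by (simp add: LIMSEQ_const_iff)
  qed
  have "AE s in lpos. indicat_real {a<..} s *\<^sub>R w s = 0" if a: "0 < a" for a
  proof -
    let ?v = "\<lambda>s. indicat_real {a<..} s *\<^sub>R w s"
    have "(LINT s|lpos. indicat_real A s *\<^sub>R ?v s) = 0" if "A \<in> sets borel" for A
    proof -
      have A: "A \<in> sigma_sets UNIV (range (greaterThan :: real \<Rightarrow> real set))"
        using that by (simp add: borel_Ioi)
      have i: "integrable lpos (\<lambda>s. indicat_real B s *\<^sub>R ?v s)" if "B \<in> sets borel" for B
        by (rule integrable_mult_indicator) (use that int[OF a] in auto)
      have sb: "B \<in> sets borel" if "B \<in> sigma_sets UNIV (range (greaterThan :: real \<Rightarrow> real set))" for B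
        using that by (simp add: borel_Ioi)
      have "Int_stable (range (greaterThan :: real \<Rightarrow> real set))"
      proof -
        have "{a<..} \<inter> {b<..} = {max a b<..}" for a b :: real by auto
        then show ?thesis by (auto simp: Int_stable_def)
      qed
      from this subset_UNIV[of "range greaterThan", folded Pow_UNIV] A show ?thesis
      proof (induction rule: sigma_sets_induct_disjoint)
        case (basic B)
        then obtain x where "B = {x<..}" by auto
        then have "(\<lambda>s. indicat_real B s *\<^sub>R ?v s) = (\<lambda>s. indicat_real {max a x<..} s *\<^sub>R w s)"
          by (auto simp: indicator_def)
        then show ?case using zero[of "max a x"] a by simp
      next
        case (compl B)
        have "(LINT s|lpos. indicat_real (UNIV - B) s *\<^sub>R ?v s) = (LINT s|lpos. ?v s - indicat_real B s *\<^sub>R ?v s)"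
          by (intro Bochner_Integration.integral_cong) (auto simp: indicator_def)
        also have "\<dots> = (LINT s|lpos. ?v s) - (LINT s|lpos. indicat_real B s *\<^sub>R ?v s)"
          using i[OF sb[OF compl(1)]] int[OF a] by (intro Bochner_Integration.integral_diff) auto
        finally show ?case using compl zero[OF a] by simp
      next
        case (union B)
        have Bs: "B n \<in> sets lpos" for n using union(2) sb by auto
        have "(LINT s|lpos. indicat_real (\<Union>(range B)) s *\<^sub>R ?v s) = (LINT s:(\<Union>(range B))|lpos. ?v s)"
          by (simp add: set_lebesgue_integral_def)
        also have "\<dots> = (\<Sum>n. (LINT s:(B n)|lpos. ?v s))"
        proof (rule lebesgue_integral_countable_add)
          show "set_integrable lpos (\<Union>(range B)) ?v"
            unfolding set_integrable_def by (rule i) (use Bs in auto)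
        qed (use union(1) Bs in \<open>auto simp: disjoint_family_on_def\<close>)
        also have "\<dots> = 0" using union(3) by (simp add: set_lebesgue_integral_def)
        finally show ?case .
      qed auto
    qed
    then show ?thesis
      by (intro lpos.density_unique_banach[where f' = "\<lambda>_. 0"])
        (use int[OF a] in \<open>auto simp: set_lebesgue_integral_def\<close>)
  qed
  then have "AE s in lpos. \<forall>n. indicat_real {1 / real (Suc n)<..} s *\<^sub>R w s = 0"
    by (subst AE_all_countable) simp
  then show ?thesis using AE_lpos_pos
  proof eventually_elim
    case (elim s)
    obtain n where "1 / real (Suc n) < s" using elim(2) nat_approx_posE by (metis of_nat_Suc)
    then show ?case using elim(1) by (auto simp: indicator_def split: if_splits)
  qed
qed

text \<open>In order one the kernel (u-1)^(a-1) is constant, so the operator is t^\<eta> times the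
  tail integral of s^(-1-\<eta>) f(s).\<close>

lemma ek_one_injective:
  assumes "0 < \<eta> + 1 / p" "1 \<le> p" and f: "f \<in> Lp p" and zero: "AE t in lpos. dil (ek \<eta> 1) f t = 0"
  shows "AE t in lpos. f t = 0"
proof -
  note [measurable] = LpD(1)[OF f]
  let ?w = "\<lambda>s. s powr (-1 - \<eta>) *\<^sub>R f s"
  have "AE s in lpos. ?w s = 0"
  proof (rule AE_zero_if_tail_integrals_zero)
    show "AE t in lpos. integrable lpos (\<lambda>s. indicator {t<..} s *\<^sub>R ?w s) \<and> (LINT s|lpos. indicator {t<..} s *\<^sub>R ?w s) = 0"
      using dil_AE_integrable[OF kern_ek[OF zero_less_one assms(1)] f assms(2)] zero AE_lpos_pos
    proof eventually_elim
      case (elim t)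
      then have t: "0 < t" by simp
      have eq: "(ek \<eta> 1 (s / t) / t) *\<^sub>R f s = t powr \<eta> *\<^sub>R (indicat_real {t<..} s *\<^sub>R ?w s)" if "0 < s" for s
      proof (cases "t < s")
        case True
        then have "(s / t) powr (-1 - \<eta>) / t = t powr \<eta> * s powr (-1 - \<eta>)"
          using t by (simp add: powr_divide powr_diff powr_minus field_simps)
        then have "ek \<eta> 1 (s / t) / t = t powr \<eta> * s powr (-1 - \<eta>)"
          using True t by (simp add: ek_def)
        then show ?thesis using True by simp
      qed (use t in \<open>simp add: ek_def\<close>)
      have "integrable lpos (\<lambda>s. (ek \<eta> 1 (s / t) / t) *\<^sub>R f s)"
        using elim dil_rescale(2)[of "ek \<eta> 1" f t] t by simp
      then have "integrable lpos (\<lambda>s. t powr \<eta> *\<^sub>R (indicat_real {t<..} s *\<^sub>R ?w s))"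
        by (rule integrable_cong_AE_imp) (use eq in \<open>auto intro!: AE_lposI\<close>)
      then have "integrable lpos (\<lambda>s. t powr (- \<eta>) *\<^sub>R (t powr \<eta> *\<^sub>R (indicat_real {t<..} s *\<^sub>R ?w s)))"
        by (rule integrable_scaleR_right)
      moreover have "t powr (- \<eta>) *\<^sub>R (t powr \<eta> *\<^sub>R z) = z" for z :: complex
        using t by (simp add: powr_minus)
      ultimately have int: "integrable lpos (\<lambda>s. indicat_real {t<..} s *\<^sub>R ?w s)" by (simp only:)
      have "0 = (LINT s|lpos. (ek \<eta> 1 (s / t) / t) *\<^sub>R f s)"
        using elim dil_rescale(1)[of "ek \<eta> 1" f t] t by simp
      also have "\<dots> = (LINT s|lpos. t powr \<eta> *\<^sub>R (indicat_real {t<..} s *\<^sub>R ?w s))"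
        by (rule integral_lpos_cong) (use eq in auto)
      finally have "t powr \<eta> *\<^sub>R (LINT s|lpos. indicat_real {t<..} s *\<^sub>R ?w s) = 0"
        by (subst (asm) integral_scaleR_right) simp
      then show ?case using int t by simp
    qed
  qed simp
  then show ?thesis using AE_lpos_pos by eventually_elim simp
qed

text \<open>The semigroup law peels off an innermost operator of order one: the outer factor of
  order n + 1 is injective by induction, the inner one by \<open>ek_one_injective\<close>.\<close>

lemma ek_nat_injective:
  assumes "0 \<le> \<eta>" "1 \<le> p" and "f \<in> Lp p" "AE t in lpos. dil (ek \<eta> (real (Suc n))) f t = 0"
  shows "AE t in lpos. f t = 0"
  using assms(3,4)
proof (induction n arbitrary: f)
  case 0
  then show ?case using ek_one_injective[of \<eta> p f] assms(1,2) by (simp add: add_nonneg_pos)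
next
  case (Suc n)
  let ?g = "dil (ek (\<eta> + real (Suc n)) 1) f"
  have pos: "0 < \<eta> + 1 / p" "0 < \<eta> + real (Suc n) + 1 / p" using assms(1,2) by (auto intro!: add_nonneg_pos)
  have g: "?g \<in> Lp p" by (rule dil_Lp) (use pos assms Suc in \<open>auto intro!: kern_ek\<close>)
  have "AE t in lpos. dil (ek \<eta> (real (Suc n))) ?g t = dil (ek \<eta> (real (Suc n) + 1)) f t"
    by (rule ek_compose) (use pos assms Suc in auto)
  then have "AE t in lpos. dil (ek \<eta> (real (Suc n))) ?g t = 0"
    using Suc.prems(2) by eventually_elim (simp add: add.commute)
  then have "AE t in lpos. ?g t = 0" by (rule Suc.IH[OF g])
  then show ?case using ek_one_injective[OF pos(2) assms(2) Suc.prems(1)] by blast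
qed

lemma dil_zero: "dil k (\<lambda>_. 0) t = 0"
  by (simp add: dil_def)

text \<open>The order is completed to an integer by an operator of order s. The semigroup law has
  this operator inside, but dilation operators commute, so it may act last, on the function that
  vanishes by assumption.\<close>

lemma ek_injective:
  assumes "0 < \<alpha>" "1 \<le> p" and f: "f \<in> Lp p" and zero: "AE t in lpos. dil (ek 0 \<alpha>) f t = 0"
  shows "AE t in lpos. f t = 0"
proof -
  define n where "n = nat \<lceil>\<alpha>\<rceil>"
  \<comment> \<open>The successor of the ceiling keeps s positive also for integer \<alpha>.\<close>
  define s where "s = real (Suc n) - \<alpha>"
  have s: "0 < s" "\<alpha> + s = real (Suc n)" unfolding s_def n_def using \<open>0 < \<alpha>\<close> by linarith+
  have pos: "0 < 0 + 1 / p" "0 < \<alpha> + 1 / p" using assms(1,2) by (auto intro!: add_pos_pos)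
  note k0 = kern_ek[OF \<open>0 < \<alpha>\<close> pos(1)] and ks = kern_ek[OF s(1) pos(2)]
  note [measurable] = LpD(1)[OF f]
  have "AE t in lpos. dil (ek 0 \<alpha>) (dil (ek (0 + \<alpha>) s) f) t = dil (ek 0 (\<alpha> + s)) f t"
    by (rule ek_compose) (use assms s pos in auto)
  moreover have "AE t in lpos. dil (ek 0 \<alpha>) (dil (ek \<alpha> s) f) t = dil (ek \<alpha> s) (dil (ek 0 \<alpha>) f) t"
    by (rule dil_commute[OF k0 ks f \<open>1 \<le> p\<close>])
  moreover have "AE t in lpos. dil (ek \<alpha> s) (dil (ek 0 \<alpha>) f) t = 0"
    using AE_lpos_pos
  proof eventually_elim
    case (elim t)
    then have "dil (ek \<alpha> s) (dil (ek 0 \<alpha>) f) t = dil (ek \<alpha> s) (\<lambda>_. 0) t"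
      by (intro dil_cong_AE) (use zero in auto)
    then show ?case by (simp add: dil_zero)
  qed
  ultimately have "AE t in lpos. dil (ek 0 (real (Suc n))) f t = 0"
    unfolding s(2)[symmetric] by eventually_elim simp
  then show ?thesis by (intro ek_nat_injective[OF _ \<open>1 \<le> p\<close> f]) auto
qed

text \<open>Test with h = |f|^(p-2) times the conjugate of f. It lies in L^q because (p-1) q = p,
  and it turns the pairing into the integral of |f|^p. The conjugate is explicit because the pairing
  is bilinear.\<close>

lemma Lp_eq_zero_if_annihilates:
  assumes f: "f \<in> Lp p" and p: "1 < p" "1/p + 1/q = 1"
    and zero: "\<And>h. h \<in> Lp q \<Longrightarrow> (LINT t|lpos. f t * h t) = 0"
  shows "AE t in lpos. f t = 0"
proof -
  note [measurable] = LpD(1)[OF f]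
  have "1 / q = 1 - 1 / p" "0 < 1 / p" "1 / p < 1" using p by auto
  then have "0 < 1 / q" "1 / q < 1" by linarith+
  then have q: "0 < q" by simp
  have pq: "(p - 1) * q = p" using p q by (simp add: field_simps)
  define h where "h t = of_real (norm (f t) powr (p - 2)) * cnj (f t)" for t
  have [measurable]: "cnj \<in> borel_measurable borel"
    by (intro borel_measurable_continuous_onI continuous_intros)
  have [measurable]: "h \<in> borel_measurable borel" unfolding h_def by measurable
  have nh: "norm (h t) = norm (f t) powr (p - 1)" for t
  proof (cases "f t = 0")
    case False
    then have "norm (f t) powr (p - 2) * norm (f t) powr 1 = norm (f t) powr (p - 1)"
      by (subst powr_add[symmetric]) simp
    then show ?thesis by (simp add: h_def norm_mult)
  qed (simp add: h_def)
  have "Ip q h = Ip p f" unfolding Ip_def nh by (simp add: powr_powr pq)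
  then have h: "h \<in> Lp q" using LpD[OF f] by (simp add: Lp_def)
  have fh: "f t * h t = of_real (norm (f t) powr p)" for t
  proof (cases "f t = 0")
    case False
    have "f t * h t = of_real (norm (f t) powr (p - 2)) * (f t * cnj (f t))" by (simp add: h_def mult_ac)
    also have "f t * cnj (f t) = of_real (norm (f t) powr 2)"
    proof -
      have "norm (f t) powr 2 = (norm (f t))\<^sup>2" using False by simp
      then show ?thesis by (simp only: complex_norm_square)
    qed
    also have "of_real (norm (f t) powr (p - 2)) * complex_of_real (norm (f t) powr 2) =
        of_real (norm (f t) powr (p - 2) * norm (f t) powr 2)" by simp
    also have "norm (f t) powr (p - 2) * norm (f t) powr 2 = norm (f t) powr p"
      by (subst powr_add [symmetric]) simp
    finally show ?thesis .
  qed simp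
  have int: "integrable lpos (\<lambda>t. norm (f t) powr p)"
    using LpD(2)[OF f] by (simp add: integrable_iff_bounded Ip_def)
  have "complex_of_real (LINT t|lpos. norm (f t) powr p) = 0"
    using zero[OF h] unfolding fh by simp
  then have "(LINT t|lpos. norm (f t) powr p) = 0" by simp
  then have "AE t in lpos. norm (f t) powr p = 0"
    by (subst (asm) integral_nonneg_eq_0_iff_AE) (use int in auto)
  then show ?thesis by eventually_elim simp
qed

section \<open>Weyl derivatives of Schwartz functions\<close>

lemma at_within_Ici_neq_bot:
  assumes "0 \<le> (t::real)"
  shows "at t within {0..} \<noteq> bot"
proof -
  have "at_right t \<le> at t within {0..}" using assms by (intro at_le) auto
  then show ?thesis by (metis bot.extremum_uniqueI trivial_limit_at_right_real)
qed

lemma deriv_pos_eq: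
  assumes "0 \<le> t" "(f has_vector_derivative v) (at t within {0..})"
  shows "deriv_pos f t = v"
  unfolding deriv_pos_def by (rule vector_derivative_within[OF at_within_Ici_neq_bot]) fact+

lemma deriv_pos_cong:
  assumes "\<And>x. 0 \<le> x \<Longrightarrow> f x = g x" "0 \<le> t"
  shows "deriv_pos f t = deriv_pos g t"
  unfolding deriv_pos_def using assms
  by (intro vector_derivative_cong_eq) (auto intro!: always_eventually)

lemma has_vector_derivative_deriv_pos:
  assumes "f differentiable_on {0..}" "0 \<le> t"
  shows "(f has_vector_derivative deriv_pos f t) (at t within {0..})"
  unfolding deriv_pos_def using assms
  by (subst vector_derivative_works[symmetric]) (auto simp: differentiable_on_def)

lemma schwartz_posD:
  assumes "f \<in> schwartz_pos"
  shows "(deriv_pos ^^ n) f differentiable_on {0..}"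
    and "bounded ((\<lambda>t. t ^ k *\<^sub>R (deriv_pos ^^ n) f t) ` {0..})"
  using assms by (auto simp: schwartz_pos_def)

lemma schwartz_pos_deriv: "f \<in> schwartz_pos \<Longrightarrow> (deriv_pos ^^ n) f \<in> schwartz_pos"
proof -
  assume "f \<in> schwartz_pos"
  moreover have "(deriv_pos ^^ m) ((deriv_pos ^^ n) f) = (deriv_pos ^^ (m + n)) f" for m
    by (simp add: funpow_add)
  ultimately show ?thesis by (simp add: schwartz_pos_def)
qed

lemma schwartz_pos_continuous: "f \<in> schwartz_pos \<Longrightarrow> continuous_on {0..} ((deriv_pos ^^ n) f)"
  by (rule differentiable_imp_continuous_on) (rule schwartz_posD)

lemma schwartz_pos_has_derivative:
  assumes "f \<in> schwartz_pos" "0 \<le> t"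
  shows "((deriv_pos ^^ n) f has_vector_derivative (deriv_pos ^^ Suc n) f t) (at t within {0..})"
  using has_vector_derivative_deriv_pos[OF schwartz_posD(1)[OF assms(1)] assms(2)] by simp

lemma schwartz_pos_decay:
  assumes "f \<in> schwartz_pos"
  obtains C where "0 \<le> C" "\<And>t. 0 \<le> t \<Longrightarrow> norm ((deriv_pos ^^ n) f t) \<le> C / (1 + t) ^ N"
proof -
  let ?f = "(deriv_pos ^^ n) f"
  obtain A where A: "\<And>t. 0 \<le> t \<Longrightarrow> norm (t ^ 0 *\<^sub>R ?f t) \<le> A"
    using schwartz_posD(2)[OF assms, of 0 n] unfolding bounded_iff by auto
  obtain B where B: "\<And>t. 0 \<le> t \<Longrightarrow> norm (t ^ N *\<^sub>R ?f t) \<le> B"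
    using schwartz_posD(2)[OF assms, of N n] unfolding bounded_iff by auto
  have AB: "0 \<le> A" "0 \<le> B" using A[of 0] B[of 0] norm_ge_zero order_trans by blast+
  \<comment> \<open>The factor 2^N comes from 1 + t \<le> 2 max(1, t).\<close>
  have "norm (?f t) \<le> 2 ^ N * (A + B) / (1 + t) ^ N" if t: "0 \<le> t" for t
  proof -
    have "(1 + t) ^ N \<le> (2 * max 1 t) ^ N" using t by (intro power_mono) auto
    also have "\<dots> \<le> 2 ^ N * (1 + t ^ N)"
      using t by (auto simp: power_mult_distrib max_def)
    finally have "(1 + t) ^ N * norm (?f t) \<le> 2 ^ N * (1 + t ^ N) * norm (?f t)"
      by (intro mult_right_mono) auto
    also have "\<dots> = 2 ^ N * (norm (t ^ 0 *\<^sub>R ?f t) + norm (t ^ N *\<^sub>R ?f t))"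
      using t by (simp add: algebra_simps)
    also have "\<dots> \<le> 2 ^ N * (A + B)"
      using A[OF t] B[OF t] by (intro mult_left_mono add_mono) auto
    finally show ?thesis using t by (simp add: field_simps)
  qed
  then show ?thesis using that[of "2 ^ N * (A + B)"] AB by simp
qed

text \<open>
  A Schwartz function on \<open>{0..}\<close> has arbitrary values on the negative axis, so that only its
  truncation is Borel measurable.
\<close>

definition cut :: "(real \<Rightarrow> complex) \<Rightarrow> real \<Rightarrow> complex" where
  "cut f t = indicat_real {0..} t *\<^sub>R f t"

lemma cut_eq [simp]: "0 \<le> t \<Longrightarrow> cut f t = f t"
  by (simp add: cut_def)

lemma cut_measurable:
  assumes "continuous_on {0..} f"
  shows "cut f \<in> borel_measurable borel"
  unfolding cut_def[abs_def]
  using borel_measurable_continuous_on_indicator[OF _ assms] by simp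

lemma schwartz_pos_cut_measurable:
  "f \<in> schwartz_pos \<Longrightarrow> cut ((deriv_pos ^^ n) f) \<in> borel_measurable borel"
  by (intro cut_measurable schwartz_pos_continuous)

section \<open>Weyl integrals and their derivatives\<close>

lemma weyl_integral_eq:
  assumes [measurable]: "cut f \<in> borel_measurable borel" and t: "0 \<le> t"
  shows "weyl_integral \<sigma> f t = (LINT u|lpos. u powr (\<sigma> - 1) *\<^sub>R cut f (t + u)) /\<^sub>R Gamma \<sigma>"
proof -
  let ?g = "\<lambda>s. (s - t) powr (\<sigma> - 1) *\<^sub>R cut f s"
  have "(LINT s:{t<..}|lebesgue. (s - t) powr (\<sigma> - 1) *\<^sub>R f s) = (LINT s|lpos. indicat_real {t<..} s *\<^sub>R ?g s)"
    by (rule set_integral_lebesgue_lpos) (use t in \<open>auto intro!: AE_lposI\<close>)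
  also have "\<dots> = (LINT s|lborel. indicat_real {t<..} s *\<^sub>R ?g s)"
    by (subst integral_lpos) (use t in \<open>auto intro!: Bochner_Integration.integral_cong simp: indicator_def\<close>)
  also have "\<dots> = \<bar>1\<bar> *\<^sub>R (LINT u|lborel. indicat_real {t<..} (t + 1 * u) *\<^sub>R ?g (t + 1 * u))"
    by (rule lborel_integral_real_affine) auto
  also have "\<dots> = (LINT u|lpos. u powr (\<sigma> - 1) *\<^sub>R cut f (t + u))"
    by (subst integral_lpos) (auto intro!: Bochner_Integration.integral_cong simp: indicator_def)
  finally show ?thesis by (simp add: weyl_integral_def)
qed

lemma integrable_powr_decay:
  assumes "0 < \<sigma>" "\<sigma> < real N"
  shows "integrable lpos (\<lambda>u. C * (u powr (\<sigma> - 1) / (1 + u) ^ N))"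
proof -
  have "(\<integral>\<^sup>+u. ennreal (norm (u powr (\<sigma> - 1) / (1 + u) ^ N)) \<partial>lpos) =
      (\<integral>\<^sup>+u. ennreal (u powr (\<sigma> - 1) / (1 + u) powr (\<sigma> + (real N - \<sigma>))) \<partial>lpos)"
    by (rule nn_integral_lpos_cong) (simp add: powr_realpow)
  also have "\<dots> < \<infinity>" using assms by (subst nn_integral_Beta_prime) auto
  finally have "integrable lpos (\<lambda>u. u powr (\<sigma> - 1) / (1 + u) ^ N)"
    by (simp add: integrable_iff_bounded)
  then show ?thesis by (rule integrable_mult_right)
qed

lemma weyl_kernel_integrable:
  fixes f :: "real \<Rightarrow> complex"
  assumes [measurable]: "f \<in> borel_measurable borel" and "0 < \<sigma>" "\<sigma> < real N" "0 \<le> t"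
    and decay: "\<And>x. 0 \<le> x \<Longrightarrow> norm (f x) \<le> C / (1 + x) ^ N" "0 \<le> C"
  shows "integrable lpos (\<lambda>u. u powr (\<sigma> - 1) *\<^sub>R f (t + u))"
proof (rule Bochner_Integration.integrable_bound)
  show "integrable lpos (\<lambda>u. C * (u powr (\<sigma> - 1) / (1 + u) ^ N))"
    by (rule integrable_powr_decay) fact+
  show "AE u in lpos. norm (u powr (\<sigma> - 1) *\<^sub>R f (t + u)) \<le> norm (C * (u powr (\<sigma> - 1) / (1 + u) ^ N))"
  proof (rule AE_lposI)
    fix u :: real assume u: "0 < u"
    have "norm (f (t + u)) \<le> C / (1 + (t + u)) ^ N" using u \<open>0 \<le> t\<close> by (intro decay) auto
    also have "\<dots> \<le> C / (1 + u) ^ N"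
      using u \<open>0 \<le> t\<close> \<open>0 \<le> C\<close> by (intro divide_left_mono power_mono) auto
    finally have "u powr (\<sigma> - 1) * norm (f (t + u)) \<le> u powr (\<sigma> - 1) * (C / (1 + u) ^ N)"
      by (intro mult_left_mono) auto
    then show "norm (u powr (\<sigma> - 1) *\<^sub>R f (t + u)) \<le> norm (C * (u powr (\<sigma> - 1) / (1 + u) ^ N))"
      using u \<open>0 \<le> C\<close> by (simp add: mult_ac)
  qed
qed measurable

text \<open>After s = t + u the variable t no longer occurs in the singular kernel, so the
  derivative falls on \<phi>. Differentiation under the integral is justified by dominated
  convergence along sequences inside [0, \<infinity>), which covers the one-sided derivative at
  0.\<close>

lemma weyl_integral_has_derivative:
  assumes \<phi>: "\<phi> \<in> schwartz_pos" and \<sigma>: "0 < \<sigma>" and t: "0 \<le> t"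
  shows "(weyl_integral \<sigma> \<phi> has_vector_derivative weyl_integral \<sigma> (deriv_pos \<phi>) t) (at t within {0..})"
proof -
  define N where "N = nat \<lceil>\<sigma>\<rceil> + 1"
  have N: "\<sigma> < real N" unfolding N_def using \<sigma> by linarith
  let ?f = "cut \<phi>" and ?f' = "cut (deriv_pos \<phi>)"
  note [measurable] = schwartz_pos_cut_measurable[OF \<phi>, of 0, simplified] schwartz_pos_cut_measurable[OF \<phi>, of 1, simplified]
  obtain C0 where C0: "0 \<le> C0" "\<And>x. 0 \<le> x \<Longrightarrow> norm (\<phi> x) \<le> C0 / (1 + x) ^ N"
    using schwartz_pos_decay[OF \<phi>, of 0 N] by auto
  obtain C where C: "0 \<le> C" "\<And>x. 0 \<le> x \<Longrightarrow> norm (deriv_pos \<phi> x) \<le> C / (1 + x) ^ N"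
    using schwartz_pos_decay[OF \<phi>, of 1 N] by auto
  have der: "(\<phi> has_vector_derivative deriv_pos \<phi> x) (at x within {0..})" if "0 \<le> x" for x
    using schwartz_pos_has_derivative[OF \<phi> that, of 0] by simp
  have int: "integrable lpos (\<lambda>u. u powr (\<sigma> - 1) *\<^sub>R ?f (x + u))" if "0 \<le> x" for x
    by (rule weyl_kernel_integrable[of _ _ N _ C0]) (use \<sigma> N C0 that in auto)
  have int': "integrable lpos (\<lambda>u. u powr (\<sigma> - 1) *\<^sub>R ?f' (t + u))"
    by (rule weyl_kernel_integrable[of _ _ N _ C]) (use \<sigma> N C t in auto)
  define G where "G x = (LINT u|lpos. u powr (\<sigma> - 1) *\<^sub>R ?f (x + u))" for x
  define G' where "G' = (LINT u|lpos. u powr (\<sigma> - 1) *\<^sub>R ?f' (t + u))"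
  \<comment> \<open>The normalised first-order remainder of \<phi> at t + u. By linearity that of G
    is the weighted integral of Q, so it suffices that this integral tends to 0.\<close>
  define Q where "Q x u = (1 / norm (x - t)) *\<^sub>R (?f (x + u) - (?f (t + u) + (x - t) *\<^sub>R ?f' (t + u)))" for x u
  have Qint: "(1 / norm (x - t)) *\<^sub>R (G x - (G t + (x - t) *\<^sub>R G')) = (LINT u|lpos. u powr (\<sigma> - 1) *\<^sub>R Q x u)"
    if "0 \<le> x" for x
  proof -
    have "(LINT u|lpos. u powr (\<sigma> - 1) *\<^sub>R Q x u) = (LINT u|lpos. (1 / norm (x - t)) *\<^sub>R
        (u powr (\<sigma> - 1) *\<^sub>R ?f (x + u) - (u powr (\<sigma> - 1) *\<^sub>R ?f (t + u) + (x - t) *\<^sub>R (u powr (\<sigma> - 1) *\<^sub>R ?f' (t + u)))))"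
      by (intro Bochner_Integration.integral_cong) (simp_all add: Q_def scaleR_diff_right scaleR_add_right mult_ac)
    also have "\<dots> = (1 / norm (x - t)) *\<^sub>R (G x - (G t + (x - t) *\<^sub>R G'))"
      unfolding G_def G'_def
      by (subst integral_scaleR_right, subst Bochner_Integration.integral_diff,
          rule int[OF that], rule Bochner_Integration.integrable_add[OF int[OF t] integrable_scaleR_right[OF int']],
          subst Bochner_Integration.integral_add, rule int[OF t], rule integrable_scaleR_right[OF int'])
        (simp only: integral_scaleR_right)
    finally show ?thesis ..
  qed
  \<comment> \<open>Both x + u and t + u lie in [u, \<infinity>), where the derivative is at most
    C/(1+u)^N. The bound is thus independent of x and integrable against u^(\<sigma>-1).\<close>
  have lip: "norm (?f (x + u) - ?f (t + u)) \<le> C / (1 + u) ^ N * norm (x - t)" if "0 \<le> x" "0 < u" for x u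
  proof -
    have "norm (\<phi> (x + u) - \<phi> (t + u)) \<le> C / (1 + u) ^ N * norm ((x + u) - (t + u))"
    proof (rule differentiable_bound[where S = "{u..}" and f' = "\<lambda>y h. h *\<^sub>R deriv_pos \<phi> y"])
      show "(\<phi> has_derivative (\<lambda>h. h *\<^sub>R deriv_pos \<phi> y)) (at y within {u..})" if "y \<in> {u..}" for y
        using der[of y] \<open>0 < u\<close> that unfolding has_vector_derivative_def
        by (auto intro: has_derivative_subset)
      show "onorm (\<lambda>h. h *\<^sub>R deriv_pos \<phi> y) \<le> C / (1 + u) ^ N" if "y \<in> {u..}" for y
      proof (rule onorm_le)
        fix h :: real
        have "norm (deriv_pos \<phi> y) \<le> C / (1 + y) ^ N" using that \<open>0 < u\<close> by (intro C) auto
        also have "\<dots> \<le> C / (1 + u) ^ N"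
          using that \<open>0 < u\<close> C(1) by (intro divide_left_mono power_mono) auto
        finally have "\<bar>h\<bar> * norm (deriv_pos \<phi> y) \<le> \<bar>h\<bar> * (C / (1 + u) ^ N)" by (intro mult_left_mono) auto
        then show "norm (h *\<^sub>R deriv_pos \<phi> y) \<le> C / (1 + u) ^ N * norm h" by (simp add: mult_ac)
      qed
    qed (use that t in auto)
    then show ?thesis using that t by simp
  qed
  have dom: "norm (u powr (\<sigma> - 1) *\<^sub>R Q x u) \<le> 2 * C * (u powr (\<sigma> - 1) / (1 + u) ^ N)"
    if "0 \<le> x" "x \<noteq> t" "0 < u" for x u
  proof -
    have "norm (?f' (t + u)) \<le> C / (1 + (t + u)) ^ N" using that t by (simp, intro C) auto
    also have "\<dots> \<le> C / (1 + u) ^ N"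
      using that t C(1) by (intro divide_left_mono power_mono) auto
    finally have f': "norm (?f' (t + u)) \<le> C / (1 + u) ^ N" .
    have "norm (?f (x + u) - (?f (t + u) + (x - t) *\<^sub>R ?f' (t + u))) \<le>
        norm (?f (x + u) - ?f (t + u)) + norm ((x - t) *\<^sub>R ?f' (t + u))"
      by (simp only: diff_diff_add [symmetric]) (rule norm_triangle_ineq4)
    also have "\<dots> \<le> C / (1 + u) ^ N * norm (x - t) + norm (x - t) * (C / (1 + u) ^ N)"
      unfolding norm_scaleR real_norm_def using lip[OF that(1,3)] f' by (intro add_mono mult_left_mono) auto
    finally have "norm (?f (x + u) - (?f (t + u) + (x - t) *\<^sub>R ?f' (t + u))) \<le> norm (x - t) * (2 * C / (1 + u) ^ N)"
      by (simp add: field_simps)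
    moreover have "norm (Q x u) = norm (?f (x + u) - (?f (t + u) + (x - t) *\<^sub>R ?f' (t + u))) / norm (x - t)"
      by (simp add: Q_def)
    ultimately have "norm (Q x u) \<le> 2 * C / (1 + u) ^ N"
      using that(2) by (simp only:) (subst pos_divide_le_eq, auto simp: mult.commute)
    then have "u powr (\<sigma> - 1) * norm (Q x u) \<le> u powr (\<sigma> - 1) * (2 * C / (1 + u) ^ N)"
      by (intro mult_left_mono) auto
    then show ?thesis by (simp add: mult_ac)
  qed
  have lim: "((\<lambda>x. (1 / norm (x - t)) *\<^sub>R (G x - (G t + (x - t) *\<^sub>R G'))) \<longlongrightarrow> 0) (at t within {0..})"
    unfolding tendsto_at_iff_sequentially
  proof (intro allI impI)
    fix X :: "nat \<Rightarrow> real" assume X: "\<forall>i. X i \<in> {0..} - {t}" "X \<longlonglongrightarrow> t"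
    have "(\<lambda>i. LINT u|lpos. u powr (\<sigma> - 1) *\<^sub>R Q (X i) u) \<longlonglongrightarrow> (LINT u|lpos. 0)"
    proof (rule integral_dominated_convergence[where w = "\<lambda>u. 2 * C * (u powr (\<sigma> - 1) / (1 + u) ^ N)"])
      show "integrable lpos (\<lambda>u. 2 * C * (u powr (\<sigma> - 1) / (1 + u) ^ N))"
        by (rule integrable_powr_decay) fact+
      show "AE u in lpos. (\<lambda>i. u powr (\<sigma> - 1) *\<^sub>R Q (X i) u) \<longlonglongrightarrow> 0"
      proof (rule AE_lposI)
        fix u :: real assume u: "0 < u"
        have "((\<lambda>y. (1 / norm (y - (t + u))) *\<^sub>R (\<phi> y - (\<phi> (t + u) + (y - (t + u)) *\<^sub>R deriv_pos \<phi> (t + u)))) \<longlongrightarrow> 0)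
            (at (t + u) within {0..})"
          using der[of "t + u"] u t unfolding has_vector_derivative_def has_derivative_within by simp
        then have "((\<lambda>y. (1 / norm (y - (t + u))) *\<^sub>R (\<phi> y - (\<phi> (t + u) + (y - (t + u)) *\<^sub>R deriv_pos \<phi> (t + u)))) \<circ> (\<lambda>i. X i + u)) \<longlonglongrightarrow> 0"
          unfolding tendsto_at_iff_sequentially
          using X u t by (auto elim!: allE[of _ "\<lambda>i. X i + u"] intro!: tendsto_intros)
        also have "((\<lambda>y. (1 / norm (y - (t + u))) *\<^sub>R (\<phi> y - (\<phi> (t + u) + (y - (t + u)) *\<^sub>R deriv_pos \<phi> (t + u)))) \<circ> (\<lambda>i. X i + u)) =
            (\<lambda>i. Q (X i) u)"
          using X(1) u t by (auto simp: Q_def fun_eq_iff)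
        finally have "(\<lambda>i. Q (X i) u) \<longlonglongrightarrow> 0" .
        from tendsto_scaleR[OF tendsto_const this, of "u powr (\<sigma> - 1)"]
        show "(\<lambda>i. u powr (\<sigma> - 1) *\<^sub>R Q (X i) u) \<longlonglongrightarrow> 0" by simp
      qed
      show "AE u in lpos. norm (u powr (\<sigma> - 1) *\<^sub>R Q (X i) u) \<le> 2 * C * (u powr (\<sigma> - 1) / (1 + u) ^ N)" for i
        by (rule AE_lposI, rule dom) (use X(1) in auto)
    qed (simp_all add: Q_def)
    moreover have "(\<lambda>i. LINT u|lpos. u powr (\<sigma> - 1) *\<^sub>R Q (X i) u) =
        ((\<lambda>x. (1 / norm (x - t)) *\<^sub>R (G x - (G t + (x - t) *\<^sub>R G'))) \<circ> X)"
      unfolding o_def by (rule ext, rule Qint [symmetric]) (use X(1) in auto)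
    ultimately show "((\<lambda>x. (1 / norm (x - t)) *\<^sub>R (G x - (G t + (x - t) *\<^sub>R G'))) \<circ> X) \<longlonglongrightarrow> 0" by simp
  qed
  have "(G has_vector_derivative G') (at t within {0..})"
    unfolding has_vector_derivative_def has_derivative_within using lim
    by (auto intro: bounded_linear_scaleR_left)
  then have "((\<lambda>x. G x /\<^sub>R Gamma \<sigma>) has_vector_derivative G' /\<^sub>R Gamma \<sigma>) (at t within {0..})"
    by (rule bounded_linear.has_vector_derivative[OF bounded_linear_scaleR_right])
  moreover have "weyl_integral \<sigma> (deriv_pos \<phi>) t = G' /\<^sub>R Gamma \<sigma>"
    unfolding G'_def by (rule weyl_integral_eq) (use t in auto)
  moreover have "weyl_integral \<sigma> \<phi> x = G x /\<^sub>R Gamma \<sigma>" if "x \<in> {0..}" for x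
    unfolding G_def by (rule weyl_integral_eq) (use that in auto)
  ultimately show ?thesis using t by (auto intro: has_vector_derivative_transform[rotated 2])
qed

lemma deriv_pos_weyl_integral:
  assumes \<phi>: "\<phi> \<in> schwartz_pos" and \<sigma>: "0 < \<sigma>" and t: "0 \<le> t"
  shows "(deriv_pos ^^ n) (weyl_integral \<sigma> \<phi>) t = weyl_integral \<sigma> ((deriv_pos ^^ n) \<phi>) t"
  using t
proof (induction n arbitrary: t)
  case (Suc n)
  have "(deriv_pos ^^ Suc n) (weyl_integral \<sigma> \<phi>) t = deriv_pos ((deriv_pos ^^ n) (weyl_integral \<sigma> \<phi>)) t" by simp
  also have "\<dots> = deriv_pos (weyl_integral \<sigma> ((deriv_pos ^^ n) \<phi>)) t"
    by (rule deriv_pos_cong) (use Suc in auto)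
  also have "\<dots> = weyl_integral \<sigma> (deriv_pos ((deriv_pos ^^ n) \<phi>)) t"
    by (intro deriv_pos_eq weyl_integral_has_derivative schwartz_pos_deriv \<phi> \<sigma> Suc.prems)
  finally show ?case by simp
qed simp

text \<open>Moving powers of s into the function makes the Weyl kernel homogeneous, which brings
  Weyl integrals under the calculus of dilation operators.\<close>

lemma weyl_integral_eq_ek:
  assumes [measurable]: "cut f \<in> borel_measurable borel" and t: "0 < t" and \<sigma>: "0 < \<sigma>"
  shows "t powr \<eta> *\<^sub>R weyl_integral \<sigma> f t = dil (ek \<eta> \<sigma>) (\<lambda>x. x powr (\<eta> + \<sigma>) *\<^sub>R cut f x) t"
proof -
  let ?k = "\<lambda>s. t powr \<eta> / Gamma \<sigma> * (indicat_real {t<..} s * (s - t) powr (\<sigma> - 1))"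
  have "(LINT s:{t<..}|lebesgue. (s - t) powr (\<sigma> - 1) *\<^sub>R f s) =
      (LINT s|lpos. indicat_real {t<..} s *\<^sub>R ((s - t) powr (\<sigma> - 1) *\<^sub>R cut f s))"
    by (rule set_integral_lebesgue_lpos) (use t in \<open>auto intro!: AE_lposI\<close>)
  then have "t powr \<eta> *\<^sub>R weyl_integral \<sigma> f t =
      (t powr \<eta> / Gamma \<sigma>) *\<^sub>R (LINT s|lpos. indicat_real {t<..} s *\<^sub>R ((s - t) powr (\<sigma> - 1) *\<^sub>R cut f s))"
    by (simp add: weyl_integral_def divide_inverse)
  also have "\<dots> = (LINT s|lpos. ?k s *\<^sub>R cut f s)"
    by (subst integral_scaleR_right [symmetric]) simp
  also have "\<dots> = (LINT s|lpos. (ek \<eta> \<sigma> (s / t) / t) *\<^sub>R (s powr (\<eta> + \<sigma>) *\<^sub>R cut f s))"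
  proof (rule integral_lpos_cong)
    fix s :: real assume s: "0 < s"
    show "?k s *\<^sub>R cut f s = (ek \<eta> \<sigma> (s / t) / t) *\<^sub>R (s powr (\<eta> + \<sigma>) *\<^sub>R cut f s)"
    proof (cases "t < s")
      case True
      have "s / t - 1 = (s - t) / t" using t by (simp add: field_simps)
      moreover have "((s - t) / t) powr (\<sigma> - 1) * (s / t) powr (- \<sigma> - \<eta>) / t * s powr (\<eta> + \<sigma>) =
          t powr \<eta> * (s - t) powr (\<sigma> - 1)"
        using True s t by (simp add: powr_divide powr_diff powr_minus powr_add field_simps)
      ultimately have "ek \<eta> \<sigma> (s / t) / t * s powr (\<eta> + \<sigma>) = ?k s"
        using True t by (simp add: ek_def field_simps)
      then show ?thesis by (simp only: scaleR_scaleR)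
    next
      case False
      then show ?thesis using t by (simp add: ek_def)
    qed
  qed auto
  also have "\<dots> = dil (ek \<eta> \<sigma>) (\<lambda>x. x powr (\<eta> + \<sigma>) *\<^sub>R cut f x) t"
    by (rule dil_rescale(1) [symmetric]) (use t in auto)
  finally show ?thesis .
qed

section \<open>Membership in L^p and linearity\<close>

lemma Lp_of_decay:
  assumes [measurable]: "f \<in> borel_measurable borel" and p: "1 \<le> p"
    and decay: "\<And>x. 0 < x \<Longrightarrow> norm (f x) \<le> C / (1 + x)\<^sup>2" "0 \<le> C"
  shows "f \<in> Lp p"
proof -
  \<comment> \<open>As 1/(1+x)^2 \<le> 1, its p-th power is at most itself. The exponents 1 - 1 and
    1 + 1 bring the bound into the shape of the integral for B(1, 1).\<close>
  have "Ip p f \<le> (\<integral>\<^sup>+x. ennreal (C powr p) * ennreal (x powr (1 - 1) / (1 + x) powr (1 + 1)) \<partial>lpos)"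
    unfolding Ip_def
  proof (rule nn_integral_mono_AE, rule AE_lposI)
    fix x :: real assume x: "0 < x"
    have "norm (f x) powr p \<le> (C / (1 + x)\<^sup>2) powr p"
      using decay(1)[OF x] p by (intro powr_mono2) auto
    also have "\<dots> = C powr p * ((1 / (1 + x)\<^sup>2) powr p)"
      using decay(2) x by (simp add: powr_divide)
    also have "\<dots> \<le> C powr p * ((1 / (1 + x)\<^sup>2) powr 1)"
    proof -
      have "1 \<le> (1 + x)\<^sup>2" using x by (intro one_le_power) simp
      then show ?thesis using x p by (intro mult_left_mono powr_mono') auto
    qed
    also have "(1 / (1 + x)\<^sup>2) powr 1 = x powr (1 - 1) / (1 + x) powr (1 + 1)"
      using x by simp
    finally show "ennreal (norm (f x) powr p) \<le> ennreal (C powr p) * ennreal (x powr (1 - 1) / (1 + x) powr (1 + 1))"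
      by (subst ennreal_mult' [symmetric]) (auto intro!: ennreal_leI)
  qed
  also have "\<dots> = ennreal (C powr p) * ennreal (Beta 1 1)"
    by (subst nn_integral_cmult) (simp_all only: nn_integral_Beta_prime zero_less_one, simp_all)
  also have "\<dots> < \<infinity>" by (simp add: ennreal_mult_less_top)
  finally show ?thesis by (simp add: Lp_def)
qed

lemma differentiable_on_transform:
  assumes "f differentiable_on S" "\<And>x. x \<in> S \<Longrightarrow> f x = g x"
  shows "g differentiable_on S"
  unfolding differentiable_on_def
proof
  fix x assume x: "x \<in> S"
  then have "f differentiable (at x within S)" using assms(1) by (simp add: differentiable_on_def)
  then show "g differentiable (at x within S)"
    by (rule differentiable_transform_within[OF _ zero_less_one x]) (rule assms(2))
qed

lemma schwartz_pos_add_cmult: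
  assumes \<phi>: "\<phi> \<in> schwartz_pos" and \<psi>: "\<psi> \<in> schwartz_pos"
  shows "(\<lambda>x. \<phi> x + c * \<psi> x) \<in> schwartz_pos"
proof -
  let ?f = "\<lambda>x. \<phi> x + c * \<psi> x"
  let ?g = "\<lambda>n x. (deriv_pos ^^ n) \<phi> x + c * (deriv_pos ^^ n) \<psi> x"
  have eq: "(deriv_pos ^^ n) ?f t = ?g n t" if "0 \<le> t" for n t
    using that
  proof (induction n arbitrary: t)
    case (Suc n)
    have "(deriv_pos ^^ Suc n) ?f t = deriv_pos (?g n) t"
      unfolding funpow.simps o_apply by (rule deriv_pos_cong) (use Suc in auto)
    also have "\<dots> = ?g (Suc n) t"
    proof (rule deriv_pos_eq[OF Suc.prems])
      show "(?g n has_vector_derivative ?g (Suc n) t) (at t within {0..})"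
        by (intro has_vector_derivative_add has_vector_derivative_mult_right
            schwartz_pos_has_derivative \<phi> \<psi> Suc.prems)
    qed
    finally show ?case .
  qed simp
  show ?thesis
    unfolding schwartz_pos_def mem_Collect_eq
  proof (intro allI conjI)
    fix n k
    have "?g n differentiable_on {0..}"
      by (intro differentiable_on_add differentiable_on_mult differentiable_on_const schwartz_posD(1) \<phi> \<psi>)
    then show "(deriv_pos ^^ n) ?f differentiable_on {0..}"
      by (rule differentiable_on_transform) (simp only: eq atLeast_iff)
    obtain A where A: "\<And>t. 0 \<le> t \<Longrightarrow> norm (t ^ k *\<^sub>R (deriv_pos ^^ n) \<phi> t) \<le> A"
      using schwartz_posD(2)[OF \<phi>, of k n] unfolding bounded_iff by auto
    obtain B where B: "\<And>t. 0 \<le> t \<Longrightarrow> norm (t ^ k *\<^sub>R (deriv_pos ^^ n) \<psi> t) \<le> B"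
      using schwartz_posD(2)[OF \<psi>, of k n] unfolding bounded_iff by auto
    have "norm (t ^ k *\<^sub>R (deriv_pos ^^ n) ?f t) \<le> A + norm c * B" if t: "0 \<le> t" for t
    proof -
      have "t ^ k *\<^sub>R (deriv_pos ^^ n) ?f t = t ^ k *\<^sub>R (deriv_pos ^^ n) \<phi> t + c * (t ^ k *\<^sub>R (deriv_pos ^^ n) \<psi> t)"
        by (simp add: eq[OF t] scaleR_add_right)
      also have "norm \<dots> \<le> A + norm c * B"
      proof (intro norm_triangle_le add_mono A[OF t])
        show "norm (c * (t ^ k *\<^sub>R (deriv_pos ^^ n) \<psi> t)) \<le> norm c * B"
          unfolding norm_mult using B[OF t] by (intro mult_left_mono) auto
      qed
      finally show ?thesis .
    qed
    then show "bounded ((\<lambda>t. t ^ k *\<^sub>R (deriv_pos ^^ n) ?f t) ` {0..})"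
      unfolding bounded_iff by auto
  qed
qed

lemma Ip_add:
  assumes [measurable]: "f \<in> borel_measurable borel" "g \<in> borel_measurable borel" and p: "0 \<le> p"
  shows "Ip p (\<lambda>x. f x + g x) \<le> ennreal (2 powr p) * (Ip p f + Ip p g)"
proof -
  have "Ip p (\<lambda>x. f x + g x) \<le> (\<integral>\<^sup>+x. ennreal (2 powr p) * (ennreal (norm (f x) powr p) + ennreal (norm (g x) powr p)) \<partial>lpos)"
    unfolding Ip_def
  proof (rule nn_integral_mono)
    fix x
    have "norm (f x + g x) \<le> 2 * max (norm (f x)) (norm (g x))"
      by (rule norm_triangle_le) simp
    then have "norm (f x + g x) powr p \<le> (2 * max (norm (f x)) (norm (g x))) powr p"
      using p by (intro powr_mono2) auto
    also have "\<dots> = 2 powr p * max (norm (f x)) (norm (g x)) powr p"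
      by (simp add: powr_mult)
    also have "\<dots> \<le> 2 powr p * (norm (f x) powr p + norm (g x) powr p)"
      by (intro mult_left_mono) (auto simp: max_def)
    finally show "ennreal (norm (f x + g x) powr p) \<le>
        ennreal (2 powr p) * (ennreal (norm (f x) powr p) + ennreal (norm (g x) powr p))"
      by (simp add: ennreal_mult' [symmetric] ennreal_plus [symmetric] ennreal_leI del: ennreal_plus)
  qed
  also have "\<dots> = ennreal (2 powr p) * (Ip p f + Ip p g)"
    by (simp add: nn_integral_cmult nn_integral_add Ip_def)
  finally show ?thesis .
qed

lemma Ip_cmult:
  assumes [measurable]: "f \<in> borel_measurable borel"
  shows "Ip p (\<lambda>x. c * f x) = ennreal (norm c powr p) * Ip p f"
  unfolding Ip_def by (subst nn_integral_cmult [symmetric])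
    (auto simp: norm_mult powr_mult ennreal_mult' [symmetric])

lemma Lp_add_cmult:
  assumes "f \<in> Lp p" "g \<in> Lp p" "0 \<le> p"
  shows "(\<lambda>x. f x + c * g x) \<in> Lp p"
proof -
  note [measurable] = LpD(1)[OF assms(1)] LpD(1)[OF assms(2)]
  have "Ip p (\<lambda>x. f x + c * g x) \<le> ennreal (2 powr p) * (Ip p f + ennreal (norm c powr p) * Ip p g)"
    using Ip_add[of f "\<lambda>x. c * g x" p] assms by (simp add: Ip_cmult)
  also have "\<dots> < \<infinity>"
    using LpD(2)[OF assms(1)] LpD(2)[OF assms(2)] by (simp add: ennreal_mult_less_top)
  finally show ?thesis by (simp add: Lp_def)
qed

lemma Lp_diff: "f \<in> Lp p \<Longrightarrow> g \<in> Lp p \<Longrightarrow> 0 \<le> p \<Longrightarrow> (\<lambda>x. f x - g x) \<in> Lp p"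
  using Lp_add_cmult[of f p g "-1"] by simp

lemma dil_add_cmult:
  assumes "kern p k" "f \<in> Lp p" "g \<in> Lp p" "1 \<le> p"
  shows "AE t in lpos. dil k (\<lambda>x. f x + c * g x) t = dil k f t + c * dil k g t"
  using dil_AE_integrable[OF assms(1,2,4)] dil_AE_integrable[OF assms(1,3,4)]
proof eventually_elim
  case (elim t)
  have "integrable lpos (\<lambda>u. c * (k u *\<^sub>R g (t * u)))"
    using elim by (intro integrable_mult_right)
  then have "(LINT u|lpos. k u *\<^sub>R f (t * u) + c * (k u *\<^sub>R g (t * u))) = dil k f t + c * dil k g t"
    using elim unfolding dil_def
    by (subst Bochner_Integration.integral_add) (simp_all only: integral_mult_right_zero)
  then show ?case by (simp add: dil_def scaleR_add_right)
qed

section \<open>Taylor's formula at infinity\<close>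

lemma weyl_integral_one_deriv:
  assumes \<phi>: "\<phi> \<in> schwartz_pos" and t: "0 < t"
  shows "weyl_integral 1 (deriv_pos \<phi>) t = - \<phi> t"
proof -
  note [measurable] = schwartz_pos_cut_measurable[OF \<phi>, of 1, simplified]
  let ?f = "deriv_pos \<phi>"
  obtain C where C: "0 \<le> C" "\<And>x. 0 \<le> x \<Longrightarrow> norm (?f x) \<le> C / (1 + x) ^ 2"
    using schwartz_pos_decay[OF \<phi>, of 1 2] by auto
  obtain C0 where C0: "0 \<le> C0" "\<And>x. 0 \<le> x \<Longrightarrow> norm (\<phi> x) \<le> C0 / (1 + x)"
    using schwartz_pos_decay[OF \<phi>, of 0 1] by auto
  have "integrable lpos (\<lambda>u. u powr (1 - 1) *\<^sub>R cut ?f (0 + u))"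
    by (rule weyl_kernel_integrable[of _ _ 2 _ C]) (use C in auto)
  also have "?this \<longleftrightarrow> integrable lpos (cut ?f)"
    by (rule integrable_cong_AE) (simp, simp, rule AE_lposI, simp)
  finally have "integrable lpos (\<lambda>s. indicat_real {t<..} s *\<^sub>R cut ?f s)"
    by (intro integrable_mult_indicator) auto
  then have "integrable lborel (\<lambda>s. indicat_real {0<..} s *\<^sub>R (indicat_real {t<..} s *\<^sub>R cut ?f s))"
    by (subst (asm) integrable_lpos) auto
  also have "(\<lambda>s. indicat_real {0<..} s *\<^sub>R (indicat_real {t<..} s *\<^sub>R cut ?f s)) = (\<lambda>s. indicat_real {t<..} s *\<^sub>R ?f s)"
    using t by (auto simp: indicator_def)
  finally have int: "set_integrable lborel {t<..} ?f"
    by (simp add: set_integrable_def)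
  \<comment> \<open>The fundamental theorem of calculus on (t, \<infinity>); the decay of \<phi>
    removes the boundary term at infinity.\<close>
  have "(LBINT x=ereal t..\<infinity>. ?f x) = 0 - \<phi> t"
  proof (rule interval_integral_FTC_integrable)
    fix x assume "ereal t < ereal x" "ereal x < \<infinity>"
    then have x: "x \<in> interior {0..}" "0 \<le> x" using t by auto
    show "(\<phi> has_vector_derivative ?f x) (at x)"
      using schwartz_pos_has_derivative[OF \<phi> x(2), of 0] by (simp add: at_within_interior[OF x(1)])
    show "isCont ?f x"
      using schwartz_pos_continuous[OF \<phi>, of 1] x by (simp add: continuous_on_interior)
  next
    have "(\<phi> \<longlongrightarrow> \<phi> t) (at t within {0..})"
      using schwartz_pos_continuous[OF \<phi>, of 0] t by (simp add: continuous_on)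
    then have "(\<phi> \<longlongrightarrow> \<phi> t) (at_right t)"
      by (rule tendsto_within_subset) (use t in auto)
    then show "((\<phi> \<circ> real_of_ereal) \<longlongrightarrow> \<phi> t) (at_right (ereal t))"
      by (simp only: ereal_tendsto_simps)
    have "(\<phi> \<longlongrightarrow> 0) at_top"
    proof (rule Lim_null_comparison)
      show "\<forall>\<^sub>F x in at_top. norm (\<phi> x) \<le> C0 / (1 + x)"
        using eventually_ge_at_top[of 0] by eventually_elim (rule C0)
      show "((\<lambda>x. C0 / (1 + x)) \<longlongrightarrow> 0) at_top"
        by (intro tendsto_divide_0[OF tendsto_const] filterlim_at_top_imp_at_infinity
            filterlim_tendsto_add_at_top[OF tendsto_const] filterlim_ident)
    qed
    then show "((\<phi> \<circ> real_of_ereal) \<longlongrightarrow> 0) (at_left \<infinity>)"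
      by (simp only: ereal_tendsto_simps)
  qed (use int in auto)
  then have I: "(LBINT s:{t<..}. ?f s) = - \<phi> t"
    by (simp add: interval_integral_to_infinity_eq)
  have "(LINT s:{t<..}|lebesgue. (s - t) powr (1 - 1) *\<^sub>R ?f s) = (LINT s|lpos. indicat_real {t<..} s *\<^sub>R cut ?f s)"
    by (rule set_integral_lebesgue_lpos) (use t in \<open>auto intro!: AE_lposI\<close>)
  also have "\<dots> = (LINT s|lborel. indicat_real {0<..} s *\<^sub>R (indicat_real {t<..} s *\<^sub>R cut ?f s))"
    by (rule integral_lpos) simp
  also have "\<dots> = (LBINT s:{t<..}. ?f s)"
    unfolding set_lebesgue_integral_def
    using t by (intro Bochner_Integration.integral_cong) (auto simp: indicator_def)
  finally show ?thesis unfolding weyl_integral_def I by simp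
qed

text \<open>The scale-invariant n-th derivative. The factor x^n keeps it in the dilation calculus,
  and the sign absorbs the minus of integrating from infinity, so that an order-one Erdelyi-Kober
  operator lowers n by one without a constant.\<close>

definition tay :: "nat \<Rightarrow> (real \<Rightarrow> complex) \<Rightarrow> real \<Rightarrow> complex" where
  "tay n \<phi> x = (-1) ^ n * (x powr real n *\<^sub>R cut ((deriv_pos ^^ n) \<phi>) x)"

lemma tay_measurable: "\<phi> \<in> schwartz_pos \<Longrightarrow> tay n \<phi> \<in> borel_measurable borel"
  unfolding tay_def[abs_def] using schwartz_pos_cut_measurable[of \<phi> n] by measurable

lemma tay_Lp:
  assumes \<phi>: "\<phi> \<in> schwartz_pos" and "1 \<le> p"
  shows "tay n \<phi> \<in> Lp p"
proof -
  obtain C where C: "0 \<le> C" "\<And>x. 0 \<le> x \<Longrightarrow> norm ((deriv_pos ^^ n) \<phi> x) \<le> C / (1 + x) ^ (n + 2)"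
    using schwartz_pos_decay[OF \<phi>, of n "n + 2"] by blast
  show ?thesis
  proof (rule Lp_of_decay[OF tay_measurable[OF \<phi>] \<open>1 \<le> p\<close> _ C(1)])
    fix x :: real assume x: "0 < x"
    have "norm (tay n \<phi> x) = x ^ n * norm ((deriv_pos ^^ n) \<phi> x)"
      using x by (simp add: tay_def norm_mult norm_power powr_realpow)
    also have "\<dots> \<le> (1 + x) ^ n * (C / (1 + x) ^ (n + 2))"
      using x C by (intro mult_mono power_mono) auto
    also have "\<dots> = C / (1 + x)\<^sup>2"
      using x by (simp add: power_add power2_eq_square)
    finally show "norm (tay n \<phi> x) \<le> C / (1 + x)\<^sup>2" .
  qed
qed

lemma tay_Suc:
  assumes \<phi>: "\<phi> \<in> schwartz_pos" and t: "0 < t"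
  shows "dil (ek (real n) 1) (tay (Suc n) \<phi>) t = tay n \<phi> t"
proof -
  let ?\<psi> = "(deriv_pos ^^ n) \<phi>"
  have "dil (ek (real n) 1) (tay (Suc n) \<phi>) t =
      (-1) ^ Suc n * dil (ek (real n) 1) (\<lambda>x. x powr (real n + 1) *\<^sub>R cut (deriv_pos ?\<psi>) x) t"
  proof -
    have "tay (Suc n) \<phi> = (\<lambda>x. (-1) ^ Suc n * (x powr (real n + 1) *\<^sub>R cut (deriv_pos ?\<psi>) x))"
      by (simp add: tay_def fun_eq_iff add.commute)
    then show ?thesis by (simp only: dil_cmult)
  qed
  also have "dil (ek (real n) 1) (\<lambda>x. x powr (real n + 1) *\<^sub>R cut (deriv_pos ?\<psi>) x) t =
      t powr real n *\<^sub>R weyl_integral 1 (deriv_pos ?\<psi>) t"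
    by (rule weyl_integral_eq_ek [symmetric])
      (use t schwartz_pos_cut_measurable[OF \<phi>, of "Suc n"] in auto)
  also have "weyl_integral 1 (deriv_pos ?\<psi>) t = - ?\<psi> t"
    by (rule weyl_integral_one_deriv[OF schwartz_pos_deriv[OF \<phi>] t])
  finally have "dil (ek (real n) 1) (tay (Suc n) \<phi>) t = (-1) ^ n * (t powr real n *\<^sub>R ?\<psi> t)"
    by simp
  also have "\<dots> = tay n \<phi> t" using t by (simp add: tay_def)
  finally show ?thesis .
qed

text \<open>Taylor's formula with the remainder at infinity.\<close>

lemma ek_tay:
  assumes \<phi>: "\<phi> \<in> schwartz_pos"
  shows "AE t in lpos. dil (ek 0 (real (Suc n))) (tay (Suc n) \<phi>) t = \<phi> t"
proof (induction n)
  case 0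
  show ?case
  proof (rule AE_lposI)
    fix t :: real assume "0 < t"
    then have "dil (ek 0 1) (tay (Suc 0) \<phi>) t = tay 0 \<phi> t" using tay_Suc[OF \<phi>, of t 0] by simp
    also have "\<dots> = \<phi> t" using \<open>0 < t\<close> by (simp add: tay_def)
    finally show "dil (ek 0 (real (Suc 0))) (tay (Suc 0) \<phi>) t = \<phi> t" by simp
  qed
next
  case (Suc n)
  have "AE t in lpos. dil (ek 0 (real (Suc n))) (dil (ek (0 + real (Suc n)) 1) (tay (Suc (Suc n)) \<phi>)) t =
      dil (ek 0 (real (Suc n) + 1)) (tay (Suc (Suc n)) \<phi>) t"
    by (rule ek_compose[where p = 1]) (use tay_Lp[OF \<phi>, of 1] in auto)
  then show ?case using Suc AE_lpos_pos
  proof eventually_elim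
    case (elim t)
    have [measurable]: "tay m \<phi> \<in> borel_measurable borel" for m by (rule tay_measurable[OF \<phi>])
    have "dil (ek 0 (real (Suc n))) (dil (ek (0 + real (Suc n)) 1) (tay (Suc (Suc n)) \<phi>)) t =
        dil (ek 0 (real (Suc n))) (tay (Suc n) \<phi>) t"
      by (rule dil_cong_AE) (use elim tay_Suc[OF \<phi>, of _ "Suc n"] in \<open>auto intro!: AE_lposI\<close>)
    moreover have "real (Suc n) + 1 = real (Suc (Suc n))" by simp
    ultimately show ?case using elim by simp
  qed
qed

section \<open>The inverse of the fractional derivative\<close>

lemma kern_cmult:
  assumes "kern p k" "0 \<le> c"
  shows "kern p (\<lambda>u. c * k u)"
proof -
  note [measurable] = kernD(1)[OF assms(1)]
  have "(\<integral>\<^sup>+u. ennreal (c * k u * u powr (-1/p)) \<partial>lpos) = ennreal c * (\<integral>\<^sup>+u. ennreal (k u * u powr (-1/p)) \<partial>lpos)"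
    using assms(2) by (subst nn_integral_cmult [symmetric]) (auto simp: ennreal_mult' [symmetric] mult_ac)
  then show ?thesis
    using assms by (auto simp: kern_def ennreal_mult_less_top)
qed

text \<open>For \<alpha> > 0 and u > 1 this is \<alpha> (u-1)^(\<alpha>-1) u^(-\<alpha>), the kernel
  of the classical inverse of \<open>D_plus \<alpha>\<close>.\<close>

definition jk :: "real \<Rightarrow> real \<Rightarrow> real" where
  "jk \<alpha> u = Gamma (\<alpha> + 1) * ek 0 \<alpha> u"

lemma jk_measurable [measurable]: "jk \<alpha> \<in> borel_measurable borel"
  unfolding jk_def[abs_def] by measurable

lemma dil_jk: "dil (jk \<alpha>) f t = Gamma (\<alpha> + 1) *\<^sub>R dil (ek 0 \<alpha>) f t"
  unfolding jk_def[abs_def] by (rule dil_kernel_cmult)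

lemma kern_jk: "0 < \<alpha> \<Longrightarrow> 1 \<le> p \<Longrightarrow> kern p (jk \<alpha>)"
  unfolding jk_def[abs_def] by (intro kern_cmult kern_ek) (auto intro!: Gamma_real_pos less_imp_le)

lemma jk_injective:
  assumes "0 < \<alpha>" "1 \<le> p" "f \<in> Lp p" "g \<in> Lp p" "AE t in lpos. dil (jk \<alpha>) f t = dil (jk \<alpha>) g t"
  shows "AE t in lpos. f t = g t"
proof -
  have G: "0 < Gamma (\<alpha> + 1)" using assms(1) by (intro Gamma_real_pos) simp
  have k: "kern p (ek 0 \<alpha>)" by (rule kern_ek) (use assms in auto)
  have d: "(\<lambda>x. f x + (-1) * g x) \<in> Lp p"
    by (rule Lp_add_cmult) (use assms in auto)
  have "AE t in lpos. dil (ek 0 \<alpha>) (\<lambda>x. f x + (-1) * g x) t = 0"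
    using dil_add_cmult[OF k assms(3,4,2), of "-1"] assms(5)
    by eventually_elim (use G in \<open>simp add: dil_jk\<close>)
  from ek_injective[OF assms(1,2) d this] show ?thesis
    by eventually_elim simp
qed

text \<open>With n = \<alpha> + \<sigma>, the derivatives pass under the Weyl integral, and
  \<open>D_plus \<alpha> \<phi>\<close> becomes
  \<open>dil (ek \<alpha> \<sigma>) (tay n \<phi>)\<close> divided by \<Gamma>(\<alpha>+1). Applying
  \<open>jk \<alpha>\<close> completes the order to n by the semigroup law, and
  \<open>ek_tay\<close> returns \<phi>.\<close>

lemma D_plus_schwartz:
  assumes \<phi>: "\<phi> \<in> schwartz_pos" and \<alpha>: "0 < \<alpha>" and p: "1 \<le> p"
  obtains h where "h \<in> Lp p" "\<And>t. 0 < t \<Longrightarrow> D_plus \<alpha> \<phi> t = h t" "AE t in lpos. dil (jk \<alpha>) h t = \<phi> t"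
proof -
  define n where "n = nat \<lfloor>\<alpha>\<rfloor> + 1"
  define \<sigma> where "\<sigma> = real n - \<alpha>"
  have \<sigma>: "0 < \<sigma>" "\<alpha> + \<sigma> = real n" unfolding \<sigma>_def n_def using \<alpha> by linarith+
  have G: "0 < Gamma (\<alpha> + 1)" using \<alpha> by (intro Gamma_real_pos) simp
  have pos: "0 < 0 + 1 / p" "0 < \<alpha> + 1 / p" using p \<alpha> by (auto intro!: add_pos_pos)
  let ?e = "dil (ek \<alpha> \<sigma>) (tay n \<phi>)"
  define h where "h t = of_real (1 / Gamma (\<alpha> + 1)) * ?e t" for t
  have e: "?e \<in> Lp p" by (rule dil_Lp[OF kern_ek tay_Lp]) (use \<sigma> pos p \<phi> in auto)
  note [measurable] = LpD(1)[OF e]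
  have h: "h \<in> Lp p"
    unfolding Lp_def h_def[abs_def] using LpD(2)[OF e]
    by (simp only: mem_Collect_eq Ip_cmult[OF LpD(1)[OF e]]) (simp add: ennreal_mult_less_top)
  have D: "D_plus \<alpha> \<phi> t = h t" if t: "0 < t" for t
  proof -
    have "weyl_deriv \<alpha> \<phi> t = (-1) ^ n * (deriv_pos ^^ n) (weyl_integral \<sigma> \<phi>) t"
      using \<alpha> by (simp add: weyl_deriv_def Let_def n_def \<sigma>_def)
    also have "(deriv_pos ^^ n) (weyl_integral \<sigma> \<phi>) t = weyl_integral \<sigma> ((deriv_pos ^^ n) \<phi>) t"
      by (rule deriv_pos_weyl_integral) (use \<phi> \<sigma> t in auto)
    finally have "t powr \<alpha> *\<^sub>R weyl_deriv \<alpha> \<phi> t = (-1) ^ n * (t powr \<alpha> *\<^sub>R weyl_integral \<sigma> ((deriv_pos ^^ n) \<phi>) t)"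
      by simp
    also have "t powr \<alpha> *\<^sub>R weyl_integral \<sigma> ((deriv_pos ^^ n) \<phi>) t =
        dil (ek \<alpha> \<sigma>) (\<lambda>x. x powr (\<alpha> + \<sigma>) *\<^sub>R cut ((deriv_pos ^^ n) \<phi>) x) t"
      by (rule weyl_integral_eq_ek) (use \<sigma> t schwartz_pos_cut_measurable[OF \<phi>] in auto)
    also have "(-1) ^ n * \<dots> = ?e t"
      unfolding \<sigma>(2) by (subst dil_cmult [symmetric]) (simp add: tay_def[abs_def])
    finally show ?thesis
      by (simp add: D_plus_def h_def scaleR_conv_of_real divide_inverse)
  qed
  have "AE t in lpos. dil (ek 0 \<alpha>) (dil (ek (0 + \<alpha>) \<sigma>) (tay n \<phi>)) t = dil (ek 0 (\<alpha> + \<sigma>)) (tay n \<phi>) t"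
    by (rule ek_compose) (use \<alpha> \<sigma> pos p tay_Lp[OF \<phi> p] in auto)
  moreover have "AE t in lpos. dil (ek 0 (real n)) (tay n \<phi>) t = \<phi> t"
    using ek_tay[OF \<phi>, of "nat \<lfloor>\<alpha>\<rfloor>"] by (simp add: n_def)
  ultimately have "AE t in lpos. dil (jk \<alpha>) h t = \<phi> t"
    unfolding \<sigma>(2)
  proof eventually_elim
    case (elim t)
    have "dil (jk \<alpha>) h t = of_real (Gamma (\<alpha> + 1)) * (of_real (1 / Gamma (\<alpha> + 1)) * dil (ek 0 \<alpha>) ?e t)"
      unfolding dil_jk h_def[abs_def] dil_cmult scaleR_conv_of_real by (rule refl mult.left_commute)
    then show ?case using elim G by simp
  qed
  with that h D show ?thesis by blast
qed

text \<open>Linearity is read off from the inverse: both sides have the same image under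
  \<open>dil (jk \<alpha>)\<close>, which is linear and injective. The exponent 1 is an arbitrary
  choice, as no exponent occurs in the claim.\<close>

lemma D_plus_add_cmult:
  assumes \<phi>: "\<phi> \<in> schwartz_pos" and \<psi>: "\<psi> \<in> schwartz_pos" and \<alpha>: "0 < \<alpha>"
  shows "AE t in lpos. D_plus \<alpha> (\<lambda>x. \<phi> x + c * \<psi> x) t = D_plus \<alpha> \<phi> t + c * D_plus \<alpha> \<psi> t"
proof -
  obtain f where f: "f \<in> Lp 1" "\<And>t. 0 < t \<Longrightarrow> D_plus \<alpha> \<phi> t = f t" "AE t in lpos. dil (jk \<alpha>) f t = \<phi> t"
    using D_plus_schwartz[OF \<phi> \<alpha>, of 1] by auto
  obtain g where g: "g \<in> Lp 1" "\<And>t. 0 < t \<Longrightarrow> D_plus \<alpha> \<psi> t = g t" "AE t in lpos. dil (jk \<alpha>) g t = \<psi> t"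
    using D_plus_schwartz[OF \<psi> \<alpha>, of 1] by auto
  obtain h where h: "h \<in> Lp 1" "\<And>t. 0 < t \<Longrightarrow> D_plus \<alpha> (\<lambda>x. \<phi> x + c * \<psi> x) t = h t"
    "AE t in lpos. dil (jk \<alpha>) h t = \<phi> t + c * \<psi> t"
    using D_plus_schwartz[OF schwartz_pos_add_cmult[OF \<phi> \<psi>] \<alpha>, of 1 c] by auto
  have fg: "(\<lambda>x. f x + c * g x) \<in> Lp 1" by (rule Lp_add_cmult) (use f g in auto)
  have "AE t in lpos. dil (jk \<alpha>) h t = dil (jk \<alpha>) (\<lambda>x. f x + c * g x) t"
    using dil_add_cmult[OF kern_jk[OF \<alpha> order_refl] f(1) g(1) order_refl, of c] f(3) g(3) h(3)
    by eventually_elim simp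
  then have "AE t in lpos. h t = f t + c * g t"
    by (rule jk_injective[OF \<alpha> _ h(1) fg, rotated]) simp
  then show ?thesis using AE_lpos_pos by eventually_elim (simp add: f g h)
qed

lemma T_norm_eq_D_plus:
  assumes "0 \<le> \<alpha>" "0 < p"
  shows "T_norm \<alpha> p f = Lp_norm p (D_plus \<alpha> f)"
proof -
  have G: "0 < Gamma (\<alpha> + 1)" using assms(1) by (intro Gamma_real_pos) simp
  have "norm (D_plus \<alpha> f t) powr p = (1 / Gamma (\<alpha> + 1)) powr p * (norm (weyl_deriv \<alpha> f t) powr p * t powr (\<alpha> * p))" for t
    using G by (simp add: D_plus_def powr_mult powr_divide powr_powr)
  then have "Lp_norm p (D_plus \<alpha> f) = ((1 / Gamma (\<alpha> + 1)) powr p *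
      (LINT t|lebesgue_on {0<..}. norm (weyl_deriv \<alpha> f t) powr p * t powr (\<alpha> * p))) powr (1 / p)"
    by (simp add: Lp_norm_def)
  also have "\<dots> = T_norm \<alpha> p f"
    unfolding T_norm_def using G assms
    by (subst powr_mult) (auto simp: powr_powr)
  finally show ?thesis ..
qed

section \<open>Exponentials\<close>

lemma exp_has_vector_derivative:
  "((\<lambda>t. complex_of_real ((- \<kappa>) ^ n * exp (- \<kappa> * t))) has_vector_derivative
     of_real ((- \<kappa>) ^ Suc n * exp (- \<kappa> * t))) (at t within S)"
proof -
  have "((\<lambda>t. (- \<kappa>) ^ n * exp (- \<kappa> * t)) has_vector_derivative ((- \<kappa>) ^ Suc n * exp (- \<kappa> * t))) (at t within S)"
    unfolding has_real_derivative_iff_has_vector_derivative[symmetric]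
    by (auto intro!: derivative_eq_intros)
  then show ?thesis
    by (rule bounded_linear.has_vector_derivative[OF bounded_linear_of_real])
qed

lemma exp_has_deriv_pos:
  assumes "0 \<le> t"
  shows "(deriv_pos ^^ n) (\<lambda>t. of_real (exp (- \<kappa> * t))) t = of_real ((- \<kappa>) ^ n * exp (- \<kappa> * t))"
  using assms
proof (induction n arbitrary: t)
  case (Suc n)
  have "(deriv_pos ^^ Suc n) (\<lambda>t. of_real (exp (- \<kappa> * t))) t =
      deriv_pos (\<lambda>t. of_real ((- \<kappa>) ^ n * exp (- \<kappa> * t))) t"
    unfolding funpow.simps o_apply by (rule deriv_pos_cong) (use Suc in auto)
  also have "\<dots> = of_real ((- \<kappa>) ^ Suc n * exp (- \<kappa> * t))"
    by (rule deriv_pos_eq[OF Suc.prems exp_has_vector_derivative])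
  finally show ?case .
qed simp

lemma power_exp_decay_bounded:
  fixes \<kappa> :: real
  assumes "0 < \<kappa>"
  obtains B where "\<And>t. 0 \<le> t \<Longrightarrow> t ^ k * exp (- \<kappa> * t) \<le> B"
proof (cases "k = 0")
  case True
  have "t ^ k * exp (- \<kappa> * t) \<le> 1" if "0 \<le> t" for t
    using that assms True mult_nonneg_nonneg[of \<kappa> t] by simp
  then show ?thesis by (rule that)
next
  case False
  \<comment> \<open>The constant is y \<le> e^y at y = \<kappa> t / k, raised to the power
    k.\<close>
  have "t ^ k * exp (- \<kappa> * t) \<le> (real k / \<kappa>) ^ k" if "0 \<le> t" for t
  proof -
    have "\<kappa> * t / real k \<le> exp (\<kappa> * t / real k)"
      using exp_ge_add_one_self[of "\<kappa> * t / real k"] by linarith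
    then have "(\<kappa> * t / real k) ^ k \<le> exp (\<kappa> * t / real k) ^ k"
      using assms that by (intro power_mono) auto
    also have "\<dots> = exp (\<kappa> * t)" using False by (simp flip: exp_of_nat_mult)
    finally have "(real k / \<kappa>) ^ k * (\<kappa> * t / real k) ^ k \<le> (real k / \<kappa>) ^ k * exp (\<kappa> * t)"
      using assms by (intro mult_left_mono) auto
    also have "(real k / \<kappa>) ^ k * (\<kappa> * t / real k) ^ k = t ^ k"
      using assms False by (simp flip: power_mult_distrib)
    finally show ?thesis by (simp add: exp_minus divide_simps)
  qed
  then show ?thesis by (rule that)
qed

lemma exp_schwartz:
  assumes "0 < \<kappa>"
  shows "(\<lambda>t. of_real (exp (- \<kappa> * t))) \<in> schwartz_pos"
  unfolding schwartz_pos_def mem_Collect_eq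
proof (intro allI conjI)
  fix n k
  let ?D = "(deriv_pos ^^ n) (\<lambda>t. of_real (exp (- \<kappa> * t)))"
  have "(\<lambda>t. complex_of_real ((- \<kappa>) ^ n * exp (- \<kappa> * t))) differentiable_on {0..}"
    unfolding differentiable_on_def by (blast intro: differentiableI_vector exp_has_vector_derivative)
  then show "?D differentiable_on {0..}"
    by (rule differentiable_on_transform) (simp only: exp_has_deriv_pos atLeast_iff)
  obtain B where B: "\<And>t. 0 \<le> t \<Longrightarrow> t ^ k * exp (- \<kappa> * t) \<le> B"
    using power_exp_decay_bounded[OF assms] by blast
  have "norm (t ^ k *\<^sub>R ?D t) \<le> \<kappa> ^ n * B" if t: "0 \<le> t" for t
  proof -
    have "norm (t ^ k *\<^sub>R ?D t) = \<kappa> ^ n * (t ^ k * exp (- \<kappa> * t))"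
      unfolding exp_has_deriv_pos[OF t] norm_scaleR norm_of_real
      using t assms by (simp add: abs_mult power_abs)
    also have "\<dots> \<le> \<kappa> ^ n * B" using B[OF t] assms by (intro mult_left_mono) auto
    finally show ?thesis .
  qed
  then show "bounded ((\<lambda>t. t ^ k *\<^sub>R ?D t) ` {0..})"
    unfolding bounded_iff by auto
qed

lemma integral_lpos_Gamma:
  assumes "0 < \<sigma>" "0 < \<kappa>"
  shows "(LINT u|lpos. u powr (\<sigma> - 1) *\<^sub>R complex_of_real (exp (- \<kappa> * u))) = of_real (Gamma \<sigma> / \<kappa> powr \<sigma>)"
proof -
  have "(\<integral>\<^sup>+x. ennreal (x powr (\<sigma> - 1) * exp (- x)) \<partial>lpos) = ennreal (Gamma \<sigma>)"
    unfolding Gamma_conv_nn_integral_real[OF assms(1)]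
    by (subst nn_integral_lpos, simp, rule nn_integral_cong)
      (auto simp: indicator_def exp_minus divide_inverse)
  then have G: "(LINT x|lpos. x powr (\<sigma> - 1) * exp (- x)) = Gamma \<sigma>"
    using Gamma_real_pos[OF assms(1)] by (subst integral_eq_nn_integral) auto
  have "(LINT u|lpos. u powr (\<sigma> - 1) * exp (- \<kappa> * u)) =
      (LINT u|lpos. \<kappa> powr (1 - \<sigma>) *\<^sub>R ((\<kappa> * u) powr (\<sigma> - 1) * exp (- (\<kappa> * u))))"
  proof (rule integral_lpos_cong)
    fix u :: real assume "0 < u"
    have "\<kappa> powr (1 - \<sigma>) * \<kappa> powr (\<sigma> - 1) = 1" using assms by (simp flip: powr_add)
    then show "u powr (\<sigma> - 1) * exp (- \<kappa> * u) = \<kappa> powr (1 - \<sigma>) *\<^sub>R ((\<kappa> * u) powr (\<sigma> - 1) * exp (- (\<kappa> * u)))"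
      using assms \<open>0 < u\<close> by (simp add: powr_mult)
  qed auto
  also have "\<dots> = \<kappa> powr (1 - \<sigma>) *\<^sub>R (Gamma \<sigma> /\<^sub>R \<kappa>)"
    by (subst integral_scaleR_right, subst integral_lpos_scale[where g = "\<lambda>x. x powr (\<sigma> - 1) * exp (- x)"])
      (use assms G in auto)
  also have "\<dots> = Gamma \<sigma> / \<kappa> powr \<sigma>"
    using assms by (simp add: powr_diff field_simps)
  finally have "(LINT u|lpos. u powr (\<sigma> - 1) * exp (- \<kappa> * u)) = Gamma \<sigma> / \<kappa> powr \<sigma>" .
  then have "(LINT u|lpos. complex_of_real (u powr (\<sigma> - 1) * exp (- \<kappa> * u))) = of_real (Gamma \<sigma> / \<kappa> powr \<sigma>)"
    by (simp only: integral_complex_of_real)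
  then show ?thesis by (simp add: scaleR_conv_of_real)
qed

text \<open>Exponentials are eigenfunctions of the Weyl derivative with eigenvalue
  \<kappa>^\<alpha>: the n derivatives contribute \<kappa>^n and the Weyl integral of order \<sigma>
  = n - \<alpha> contributes \<kappa>^(-\<sigma>).\<close>

lemma D_plus_exp:
  assumes \<alpha>: "0 < \<alpha>" and \<kappa>: "0 < \<kappa>" and t: "0 < t"
  shows "D_plus \<alpha> (\<lambda>t. of_real (exp (- \<kappa> * t))) t =
    of_real (\<kappa> powr \<alpha> / Gamma (\<alpha> + 1)) * of_real (t powr \<alpha> * exp (- \<kappa> * t))"
proof -
  define n where "n = nat \<lfloor>\<alpha>\<rfloor> + 1"
  define \<sigma> where "\<sigma> = real n - \<alpha>"
  have \<sigma>: "0 < \<sigma>" unfolding \<sigma>_def n_def using \<alpha> by linarith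
  have G: "0 < Gamma \<sigma>" using \<sigma> by (rule Gamma_real_pos)
  let ?e = "\<lambda>t. complex_of_real (exp (- \<kappa> * t))"
  have S: "?e \<in> schwartz_pos" by (rule exp_schwartz[OF \<kappa>])
  have "weyl_deriv \<alpha> ?e t = (-1) ^ n * (deriv_pos ^^ n) (weyl_integral \<sigma> ?e) t"
    using \<alpha> by (simp add: weyl_deriv_def Let_def n_def \<sigma>_def)
  also have "(deriv_pos ^^ n) (weyl_integral \<sigma> ?e) t = weyl_integral \<sigma> ((deriv_pos ^^ n) ?e) t"
    by (rule deriv_pos_weyl_integral) (use S \<sigma> t in auto)
  also have "\<dots> = (LINT u|lpos. u powr (\<sigma> - 1) *\<^sub>R cut ((deriv_pos ^^ n) ?e) (t + u)) /\<^sub>R Gamma \<sigma>"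
    by (rule weyl_integral_eq) (use schwartz_pos_cut_measurable[OF S] t in auto)
  also have "(LINT u|lpos. u powr (\<sigma> - 1) *\<^sub>R cut ((deriv_pos ^^ n) ?e) (t + u)) =
      (LINT u|lpos. of_real ((- \<kappa>) ^ n * exp (- \<kappa> * t)) * (u powr (\<sigma> - 1) *\<^sub>R complex_of_real (exp (- \<kappa> * u))))"
  proof (rule integral_lpos_cong)
    fix u :: real assume u: "0 < u"
    have "cut ((deriv_pos ^^ n) ?e) (t + u) = of_real ((- \<kappa>) ^ n * exp (- \<kappa> * (t + u)))"
      using u t by (simp only: cut_eq exp_has_deriv_pos add_nonneg_nonneg less_imp_le)
    also have "exp (- \<kappa> * (t + u)) = exp (- \<kappa> * t) * exp (- \<kappa> * u)"
      by (simp add: algebra_simps flip: exp_add)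
    finally show "u powr (\<sigma> - 1) *\<^sub>R cut ((deriv_pos ^^ n) ?e) (t + u) =
        of_real ((- \<kappa>) ^ n * exp (- \<kappa> * t)) * (u powr (\<sigma> - 1) *\<^sub>R complex_of_real (exp (- \<kappa> * u)))"
      by (simp add: scaleR_conv_of_real mult_ac)
  qed (use schwartz_pos_cut_measurable[OF S, of n] in measurable)
  also have "\<dots> = of_real ((- \<kappa>) ^ n * exp (- \<kappa> * t)) * of_real (Gamma \<sigma> / \<kappa> powr \<sigma>)"
    unfolding integral_lpos_Gamma[OF \<sigma> \<kappa>, symmetric] by (rule integral_mult_right_zero)
  finally have "weyl_deriv \<alpha> ?e t = of_real ((-1) ^ n * ((- \<kappa>) ^ n * exp (- \<kappa> * t) * (Gamma \<sigma> / \<kappa> powr \<sigma>) / Gamma \<sigma>))"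
    by (simp add: scaleR_conv_of_real divide_inverse)
  also have "(-1) ^ n * ((- \<kappa>) ^ n * exp (- \<kappa> * t) * (Gamma \<sigma> / \<kappa> powr \<sigma>) / Gamma \<sigma>) =
      ((-1) ^ n * (- \<kappa>) ^ n / \<kappa> powr \<sigma>) * exp (- \<kappa> * t)"
    using G by simp
  also have "(-1) ^ n * (- \<kappa>) ^ n = \<kappa> powr real n"
    using \<kappa> by (simp add: powr_realpow flip: power_mult_distrib)
  also have "\<kappa> powr real n / \<kappa> powr \<sigma> = \<kappa> powr \<alpha>"
    by (simp add: \<sigma>_def flip: powr_diff)
  finally show ?thesis by (simp add: D_plus_def scaleR_conv_of_real)
qed

lemma D_plus_exp_sum:
  fixes a :: "nat \<Rightarrow> complex"
  assumes \<alpha>: "0 < \<alpha>"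
  shows "\<exists>\<phi>\<in>schwartz_pos. AE t in lpos. D_plus \<alpha> \<phi> t =
    of_real (t powr \<alpha> * exp (- t)) * (\<Sum>k<d. a k * of_real (exp (- t)) ^ k)"
proof (induction d)
  case 0
  \<comment> \<open>The zero function is written as a difference of exponentials, so that its
    derivative follows from linearity.\<close>
  let ?e = "\<lambda>t. complex_of_real (exp (- 1 * t))"
  have e: "?e \<in> schwartz_pos" by (rule exp_schwartz) simp
  show ?case
  proof (rule bexI)
    show "(\<lambda>t. ?e t + (-1) * ?e t) \<in> schwartz_pos" by (intro schwartz_pos_add_cmult e)
    show "AE t in lpos. D_plus \<alpha> (\<lambda>t. ?e t + (-1) * ?e t) t =
        of_real (t powr \<alpha> * exp (- t)) * (\<Sum>k<0. a k * of_real (exp (- t)) ^ k)"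
      using D_plus_add_cmult[OF e e \<alpha>, of "-1"] by eventually_elim simp
  qed
next
  case (Suc d)
  then obtain \<phi> where \<phi>: "\<phi> \<in> schwartz_pos" "AE t in lpos. D_plus \<alpha> \<phi> t =
    of_real (t powr \<alpha> * exp (- t)) * (\<Sum>k<d. a k * of_real (exp (- t)) ^ k)" by blast
  \<comment> \<open>The rate is d + 1 because one factor e^(-t) belongs to the weight and d of them
    form the monomial. The coefficient \<open>?c\<close> below divides out the eigenvalue and the
    normalisation of \<open>D_plus\<close>.\<close>
  define \<kappa> where "\<kappa> = real d + 1"
  have \<kappa>: "0 < \<kappa>" by (simp add: \<kappa>_def)
  have G: "0 < Gamma (\<alpha> + 1)" using \<alpha> by (intro Gamma_real_pos) simp
  let ?e = "\<lambda>t. complex_of_real (exp (- \<kappa> * t))"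
  let ?c = "of_real (Gamma (\<alpha> + 1) / \<kappa> powr \<alpha>) * a d"
  have e: "?e \<in> schwartz_pos" by (rule exp_schwartz[OF \<kappa>])
  show ?case
  proof (rule bexI)
    show "(\<lambda>t. \<phi> t + ?c * ?e t) \<in> schwartz_pos" by (intro schwartz_pos_add_cmult e \<phi>)
    show "AE t in lpos. D_plus \<alpha> (\<lambda>t. \<phi> t + ?c * ?e t) t =
        of_real (t powr \<alpha> * exp (- t)) * (\<Sum>k<Suc d. a k * of_real (exp (- t)) ^ k)"
      using D_plus_add_cmult[OF \<phi>(1) e \<alpha>, of ?c] \<phi>(2) AE_lpos_pos
    proof eventually_elim
      case (elim t)
      have "exp (- \<kappa> * t) = exp (- t) * exp (- t) ^ d"
        by (simp add: \<kappa>_def algebra_simps flip: exp_of_nat_mult exp_add)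
      moreover have "Gamma (\<alpha> + 1) / \<kappa> powr \<alpha> * (\<kappa> powr \<alpha> / Gamma (\<alpha> + 1)) = 1"
        using G \<kappa> by simp
      then have "?c * (of_real (\<kappa> powr \<alpha> / Gamma (\<alpha> + 1)) * z) = a d * z" for z
        by (metis (no_types, lifting) mult.assoc mult.commute mult_1 of_real_1 of_real_mult)
      then have "?c * D_plus \<alpha> ?e t = a d * of_real (t powr \<alpha> * exp (- \<kappa> * t))"
        using elim by (simp only: D_plus_exp[OF \<alpha> \<kappa>])
      ultimately have "?c * D_plus \<alpha> ?e t = of_real (t powr \<alpha> * exp (- t)) * (a d * of_real (exp (- t)) ^ d)"
        by (simp add: mult_ac)
      then show ?case using elim by (simp only: sum.lessThan_Suc ring_distribs)
    qed
  qed
qed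

section \<open>Completeness and density\<close>

lemma Ip_tendsto_zero:
  assumes [measurable]: "\<And>n. f n \<in> borel_measurable borel" "g \<in> borel_measurable borel" "w \<in> borel_measurable borel"
    and lim: "AE t in lpos. (\<lambda>n. f n t) \<longlonglongrightarrow> g t"
    and dom: "\<And>n. AE t in lpos. norm (f n t - g t) \<le> w t"
    and w: "(\<integral>\<^sup>+t. ennreal (w t powr p) \<partial>lpos) < \<infinity>" and p: "1 \<le> p"
  shows "(\<lambda>n. Ip p (\<lambda>t. f n t - g t)) \<longlonglongrightarrow> 0"
proof -
  have "(\<lambda>n. (\<integral>\<^sup>+t. ennreal (norm (f n t - g t) powr p) \<partial>lpos)) \<longlonglongrightarrow> (\<integral>\<^sup>+t. 0 \<partial>lpos)"
  proof (rule nn_integral_dominated_convergence[where w = "\<lambda>t. ennreal (w t powr p)"])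
    show "AE t in lpos. ennreal (norm (f n t - g t) powr p) \<le> ennreal (w t powr p)" for n
      using dom[of n] by eventually_elim (use p in \<open>auto intro!: ennreal_leI powr_mono2\<close>)
    show "AE t in lpos. (\<lambda>n. ennreal (norm (f n t - g t) powr p)) \<longlonglongrightarrow> 0"
      using lim
    proof eventually_elim
      case (elim t)
      then have "(\<lambda>n. norm (f n t - g t)) \<longlonglongrightarrow> 0"
        by (intro tendsto_norm_zero) (simp add: LIM_zero_iff)
      then have "(\<lambda>n. norm (f n t - g t) powr p) \<longlonglongrightarrow> 0 powr p"
        by (rule tendsto_powr2) (use p in auto)
      then have "(\<lambda>n. ennreal (norm (f n t - g t) powr p)) \<longlonglongrightarrow> ennreal 0"
        using p by (intro tendsto_ennrealI) simp
      then show ?case by simp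
    qed
  qed (use w in auto)
  then show ?thesis by (simp add: Ip_def)
qed

lemma Ip_diff_triangle:
  assumes [measurable]: "f \<in> borel_measurable borel" "g \<in> borel_measurable borel" "h \<in> borel_measurable borel"
    and p: "0 \<le> p"
  shows "Ip p (\<lambda>x. f x - h x) \<le> ennreal (2 powr p) * (Ip p (\<lambda>x. f x - g x) + Ip p (\<lambda>x. g x - h x))"
  using Ip_add[of "\<lambda>x. f x - g x" "\<lambda>x. g x - h x" p] p by simp

lemma Ip_minus_commute: "Ip p (\<lambda>x. f x - g x) = Ip p (\<lambda>x. g x - f x)"
  by (simp add: Ip_def norm_minus_commute)

lemma Lp_if_close:
  assumes [measurable]: "f \<in> borel_measurable borel" and g: "g \<in> Lp p" and p: "0 \<le> p"
    and "Ip p (\<lambda>x. f x - g x) < \<infinity>"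
  shows "f \<in> Lp p"
proof -
  note [measurable] = LpD(1)[OF g]
  have "Ip p f \<le> ennreal (2 powr p) * (Ip p (\<lambda>x. f x - g x) + Ip p g)"
    using Ip_add[of "\<lambda>x. f x - g x" g p] p by simp
  also have "\<dots> < \<infinity>" using assms(4) LpD(2)[OF g] by (simp add: ennreal_mult_less_top)
  finally show ?thesis by (simp add: Lp_def)
qed

text \<open>
  Riesz-Fischer: along a subsequence with \<open>\<parallel>d\<^sub>k\<parallel>\<^sub>p \<le> 4\<^bsup>-k\<^esup>\<close> the integral of \<open>\<Sum>\<^sub>k (2\<^sup>k \<bar>d\<^sub>k\<bar>)\<^sup>p\<close> is
  finite, so \<open>\<bar>d\<^sub>k\<bar> = O(2\<^bsup>-k\<^esup>)\<close> almost everywhere and the subsequence converges there.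
\<close>

lemma Lp_complete:
  assumes h: "\<And>n. h n \<in> Lp p" and p: "1 \<le> p"
    and Cauchy: "\<And>e::real. 0 < e \<Longrightarrow> \<exists>N. \<forall>m\<ge>N. \<forall>n\<ge>N. Ip p (\<lambda>t. h m t - h n t) < ennreal e"
  obtains g where "g \<in> Lp p" "(\<lambda>n. Ip p (\<lambda>t. h n t - g t)) \<longlonglongrightarrow> 0"
proof -
  note [measurable] = LpD(1)[OF h]
  have "\<forall>k. \<exists>N. \<forall>m\<ge>N. \<forall>n\<ge>N. Ip p (\<lambda>t. h m t - h n t) < ennreal (((1/4) ^ k) powr p)"
    using Cauchy by simp
  then obtain N where N: "\<And>k m n. N k \<le> m \<Longrightarrow> N k \<le> n \<Longrightarrow> Ip p (\<lambda>t. h m t - h n t) < ennreal (((1/4) ^ k) powr p)"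
    by metis
  \<comment> \<open>The sum puts r j beyond N k for all k \<le> j; the summand k makes r k at least
    k, so the indices tend to infinity.\<close>
  define r where "r k = k + (\<Sum>i\<le>k. N i)" for k
  have rN: "N k \<le> r j" if "k \<le> j" for k j
  proof -
    have "N k \<le> (\<Sum>i\<le>j. N i)" using that by (intro member_le_sum) auto
    then show ?thesis by (simp add: r_def)
  qed
  define d where "d k t = h (r (Suc k)) t - h (r k) t" for k t
  have [measurable]: "d k \<in> borel_measurable borel" for k unfolding d_def by measurable
  have "(\<integral>\<^sup>+t. (\<Sum>k. ennreal ((2 ^ k) powr p * norm (d k t) powr p)) \<partial>lpos) =
      (\<Sum>k. ennreal ((2 ^ k) powr p) * Ip p (d k))"
    by (subst nn_integral_suminf) (auto simp: ennreal_mult' nn_integral_cmult Ip_def)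
  also have "\<dots> \<le> (\<Sum>k. ennreal ((1 / 2 powr p) ^ k))"
  proof (rule suminf_le)
    fix k
    have "ennreal ((2 ^ k) powr p) * Ip p (d k) \<le> ennreal ((2 ^ k) powr p) * ennreal (((1/4) ^ k) powr p)"
      unfolding d_def by (intro mult_left_mono less_imp_le[OF N] rN) auto
    also have "\<dots> = ennreal ((2 ^ k * (1/4) ^ k) powr p)"
      by (simp add: ennreal_mult' [symmetric] powr_mult)
    also have "(2 ^ k * (1/4) ^ k) powr p = (1 / 2 powr p) ^ k"
    proof -
      have "(2::real) ^ k * (1/4) ^ k = (1/2) ^ k" by (simp flip: power_mult_distrib)
      also have "\<dots> powr p = ((1/2) powr p) ^ k"
        by (simp add: powr_powr mult.commute flip: powr_realpow)
      finally show ?thesis by (simp add: powr_divide)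
    qed
    finally show "ennreal ((2 ^ k) powr p) * Ip p (d k) \<le> ennreal ((1 / 2 powr p) ^ k)" .
  qed auto
  also have "\<dots> < \<infinity>"
  proof -
    have "1 < 2 powr p" using p by simp
    then have "summable (\<lambda>k. (1 / 2 powr p) ^ k)" by (intro summable_geometric) auto
    then show ?thesis by (subst suminf_ennreal2) auto
  qed
  finally have "AE t in lpos. (\<Sum>k. ennreal ((2 ^ k) powr p * norm (d k t) powr p)) \<noteq> \<infinity>"
    by (intro nn_integral_PInf_AE) auto
  then have conv: "AE t in lpos. convergent (\<lambda>k. h (r k) t)"
  proof eventually_elim
    case (elim t)
    define M where "M = enn2real (\<Sum>k. ennreal ((2 ^ k) powr p * norm (d k t) powr p))"
    have M: "(\<Sum>k. ennreal ((2 ^ k) powr p * norm (d k t) powr p)) = ennreal M" "0 \<le> M"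
      unfolding M_def using elim by (simp_all add: less_top)
    have "norm (d k t) \<le> M powr (1/p) * (1/2) ^ k" for k
    proof -
      have "ennreal ((2 ^ k) powr p * norm (d k t) powr p) \<le> ennreal M"
      proof -
        have "a k \<le> suminf a" for a :: "nat \<Rightarrow> ennreal"
          using sum_le_suminf[of a "{k}"] by simp
        then show ?thesis unfolding M(1)[symmetric] .
      qed
      then have "(2 ^ k * norm (d k t)) powr p \<le> M" using M(2) by (simp add: powr_mult)
      then have "((2 ^ k * norm (d k t)) powr p) powr (1/p) \<le> M powr (1/p)"
        using p by (intro powr_mono2) auto
      then have "2 ^ k * norm (d k t) \<le> M powr (1/p)" using p by (simp add: powr_powr)
      then show ?thesis by (simp add: field_simps power_divide)
    qed
    moreover have "summable (\<lambda>k. M powr (1/p) * (1/2::real) ^ k)"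
      by (intro summable_mult summable_geometric) simp
    ultimately have "summable (\<lambda>k. d k t)"
      by (blast intro: summable_comparison_test')
    then have "convergent (\<lambda>n. \<Sum>k<n. d k t)" by (simp add: summable_iff_convergent)
    moreover have "(\<Sum>k<n. d k t) = h (r n) t - h (r 0) t" for n
      unfolding d_def by (rule sum_lessThan_telescope)
    ultimately have "convergent (\<lambda>n. (h (r n) t - h (r 0) t) + h (r 0) t)"
      by (intro convergent_add convergent_const) simp
    then show ?case by simp
  qed
  define g where "g t = lim (\<lambda>k. h (r k) t)" for t
  have [measurable]: "g \<in> borel_measurable borel" unfolding g_def by measurable
  have lim: "AE t in lpos. (\<lambda>k. h (r k) t) \<longlonglongrightarrow> g t"
    using conv unfolding g_def by eventually_elim (simp add: convergent_LIMSEQ_iff)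
  \<comment> \<open>Passing to the limit along the subsequence in the Cauchy estimate, with n fixed,
    gives convergence of the whole sequence in L^p.\<close>
  have Fatou: "Ip p (\<lambda>t. h n t - g t) \<le> ennreal e"
    if "\<And>m. M \<le> m \<Longrightarrow> Ip p (\<lambda>t. h m t - h n t) < ennreal e" for n M e
  proof -
    have "Ip p (\<lambda>t. h n t - g t) = (\<integral>\<^sup>+t. liminf (\<lambda>k. ennreal (norm (h n t - h (r k) t) powr p)) \<partial>lpos)"
      unfolding Ip_def
    proof (rule nn_integral_cong_AE)
      show "AE t in lpos. ennreal (norm (h n t - g t) powr p) = liminf (\<lambda>k. ennreal (norm (h n t - h (r k) t) powr p))"
        using lim
      proof eventually_elim
        case (elim t)
        have "(\<lambda>k. ennreal (norm (h n t - h (r k) t) powr p)) \<longlonglongrightarrow> ennreal (norm (h n t - g t) powr p)"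
          using p by (intro tendsto_ennrealI tendsto_powr2 tendsto_norm tendsto_diff tendsto_const elim) auto
        then show ?case by (intro lim_imp_Liminf [symmetric]) auto
      qed
    qed
    also have "\<dots> \<le> liminf (\<lambda>k. Ip p (\<lambda>t. h n t - h (r k) t))"
      unfolding Ip_def by (rule nn_integral_liminf) measurable
    also have "\<dots> \<le> ennreal e"
    proof (rule Liminf_le)
      show "\<forall>\<^sub>F k in sequentially. Ip p (\<lambda>t. h n t - h (r k) t) \<le> ennreal e"
        using eventually_ge_at_top[of M]
      proof eventually_elim
        case (elim k)
        then have "M \<le> r k" by (simp add: r_def)
        then show ?case using that[of "r k"] Ip_minus_commute[of p "h n" "h (r k)"] by simp
      qed
    qed simp
    finally show ?thesis .
  qed
  have tendsto: "(\<lambda>n. Ip p (\<lambda>t. h n t - g t)) \<longlonglongrightarrow> 0"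
  proof (rule tendsto_zero_ennreal)
    fix e :: real assume e: "0 < e"
    then obtain M where M: "\<And>m n. M \<le> m \<Longrightarrow> M \<le> n \<Longrightarrow> Ip p (\<lambda>t. h m t - h n t) < ennreal (e / 2)"
      using Cauchy[of "e / 2"] by auto
    show "\<forall>\<^sub>F n in sequentially. Ip p (\<lambda>t. h n t - g t) < ennreal e"
      using eventually_ge_at_top[of M]
    proof eventually_elim
      case (elim n)
      have "Ip p (\<lambda>t. h n t - g t) \<le> ennreal (e / 2)" by (rule Fatou) (rule M[OF _ elim])
      also have "\<dots> < ennreal e" using e by (simp add: ennreal_lessI)
      finally show ?case .
    qed
  qed
  then have "\<forall>\<^sub>F n in sequentially. Ip p (\<lambda>t. h n t - g t) < 1"
    by (rule order_tendstoD) simp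
  then obtain n where "Ip p (\<lambda>t. h n t - g t) < 1" by (auto simp: eventually_sequentially)
  then have "g \<in> Lp p"
    using p by (intro Lp_if_close[OF _ h[of n]])
      (auto simp: Ip_minus_commute[of p g] intro: less_trans ennreal_one_less_top)
  with tendsto that show ?thesis by blast
qed

section \<open>Density of the fractional derivatives of Schwartz functions\<close>

definition D_plus_approximable :: "real \<Rightarrow> real \<Rightarrow> (real \<Rightarrow> complex) \<Rightarrow> bool" where
  "D_plus_approximable \<alpha> p f \<longleftrightarrow> (\<forall>e>0::real. \<exists>\<phi>\<in>schwartz_pos. \<exists>g\<in>Lp p. (AE t in lpos. D_plus \<alpha> \<phi> t = g t) \<and>
     Ip p (\<lambda>t. g t - f t) < ennreal e)"

lemma D_plus_approximable_limit:
  assumes f: "\<And>n. D_plus_approximable \<alpha> p (f n)" and [measurable]: "\<And>n. f n \<in> borel_measurable borel" "g \<in> borel_measurable borel"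
    and lim: "(\<lambda>n. Ip p (\<lambda>t. f n t - g t)) \<longlonglongrightarrow> 0" and p: "0 \<le> p"
  shows "D_plus_approximable \<alpha> p g"
  unfolding D_plus_approximable_def
proof (intro allI impI)
  fix e :: real assume e: "0 < e"
  \<comment> \<open>The triangle inequality for \<open>Ip\<close> costs 2^p, and there are two
    terms.\<close>
  define e' where "e' = e / 2 powr p / 2"
  have e': "0 < e'" using e by (simp add: e'_def)
  have "\<forall>\<^sub>F n in sequentially. Ip p (\<lambda>t. f n t - g t) < ennreal e'"
    by (rule order_tendstoD[OF lim]) (use e' in simp)
  then obtain n where n: "Ip p (\<lambda>t. f n t - g t) < ennreal e'" by (auto simp: eventually_sequentially)
  obtain \<phi> h where \<phi>: "\<phi> \<in> schwartz_pos" "h \<in> Lp p" "AE t in lpos. D_plus \<alpha> \<phi> t = h t"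
    "Ip p (\<lambda>t. h t - f n t) < ennreal e'"
    using f[of n] e' unfolding D_plus_approximable_def by blast
  note [measurable] = LpD(1)[OF \<phi>(2)]
  have "Ip p (\<lambda>t. h t - g t) \<le> ennreal (2 powr p) * (Ip p (\<lambda>t. h t - f n t) + Ip p (\<lambda>t. f n t - g t))"
    by (rule Ip_diff_triangle) (use p in auto)
  also have "\<dots> < ennreal (2 powr p) * (ennreal e' + ennreal e')"
    by (intro ennreal_mult_strict_left_mono add_strict_mono \<phi> n) auto
  also have "\<dots> = ennreal e"
    using e' by (simp add: ennreal_plus[symmetric] ennreal_mult' [symmetric] e'_def del: ennreal_plus)
  finally show "\<exists>\<phi>\<in>schwartz_pos. \<exists>h\<in>Lp p. (AE t in lpos. D_plus \<alpha> \<phi> t = h t) \<and> Ip p (\<lambda>t. h t - g t) < ennreal e"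
    using \<phi> by blast
qed

lemma complex_Weierstrass:
  fixes q :: "real \<Rightarrow> complex"
  assumes "continuous_on {0..1} q" "0 < \<delta>"
  obtains a :: "nat \<Rightarrow> complex" and d where "\<And>x. x \<in> {0..1} \<Longrightarrow> norm (q x - (\<Sum>k<d. a k * of_real x ^ k)) < \<delta>"
proof -
  obtain g where g: "polynomial_function g" "\<And>x. x \<in> {0..1} \<Longrightarrow> norm (q x - g x) < \<delta>"
    using Stone_Weierstrass_polynomial_function[OF compact_Icc assms] by blast
  have "real_polynomial_function (Re \<circ> g)" "real_polynomial_function (Im \<circ> g)"
    using g(1) bounded_linear_Re bounded_linear_Im unfolding polynomial_function_def by auto
  then obtain a n b m where ab: "Re \<circ> g = (\<lambda>x. \<Sum>i\<le>n. a i * x ^ i)" "Im \<circ> g = (\<lambda>x. \<Sum>i\<le>m. b i * x ^ i)"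
    unfolding real_polynomial_function_iff_sum by blast
  \<comment> \<open>Any d above both degrees serves; missing coefficients are filled with
    zeros.\<close>
  define d where "d = Suc (n + m)"
  define c where "c k = Complex (if k \<le> n then a k else 0) (if k \<le> m then b k else 0)" for k
  have "(\<Sum>k<d. c k * of_real x ^ k) = g x" for x
  proof (rule complex_eqI)
    have "Re (\<Sum>k<d. c k * of_real x ^ k) = (\<Sum>k<d. if k \<le> n then a k * x ^ k else 0)"
      unfolding Re_sum by (intro sum.cong) (auto simp: c_def simp flip: of_real_power)
    also have "\<dots> = (\<Sum>k\<in>{..n}. a k * x ^ k)"
      by (subst sum.inter_filter[symmetric]) (auto simp: d_def intro!: sum.cong)
    finally show "Re (\<Sum>k<d. c k * of_real x ^ k) = Re (g x)" using fun_cong[OF ab(1), of x] by simp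
    have "Im (\<Sum>k<d. c k * of_real x ^ k) = (\<Sum>k<d. if k \<le> m then b k * x ^ k else 0)"
      unfolding Im_sum by (intro sum.cong) (auto simp: c_def simp flip: of_real_power)
    also have "\<dots> = (\<Sum>k\<in>{..m}. b k * x ^ k)"
      by (subst sum.inter_filter[symmetric]) (auto simp: d_def intro!: sum.cong)
    finally show "Im (\<Sum>k<d. c k * of_real x ^ k) = Im (g x)" using fun_cong[OF ab(2), of x] by simp
  qed
  then show ?thesis using that[of c d] g(2) by simp
qed

lemma powr_exp_Lp:
  assumes "0 < \<alpha>" "1 \<le> p"
  shows "(\<lambda>t. of_real (t powr \<alpha> * exp (- t))) \<in> Lp p"
proof -
  define k where "k = nat \<lceil>\<alpha>\<rceil>"
  have k: "\<alpha> \<le> real k" unfolding k_def by linarith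
  obtain B where B: "\<And>t. 0 \<le> t \<Longrightarrow> t ^ (k + 2) * exp (- 1 * t) \<le> (B :: real)"
    by (rule power_exp_decay_bounded[OF zero_less_one, of "k + 2"]) (rule that)
  have decay: "t powr \<alpha> * exp (- t) \<le> B * exp 1 / (1 + t)\<^sup>2" if t: "0 < t" for t
  proof -
    have "t powr \<alpha> \<le> (1 + t) powr \<alpha>" using t assms by (intro powr_mono2) auto
    also have "\<dots> \<le> (1 + t) powr real k" using t k by (intro powr_mono) auto
    also have "\<dots> = (1 + t) ^ k" using t by (simp add: powr_realpow)
    finally have "t powr \<alpha> * exp (- t) * (1 + t)\<^sup>2 \<le> (1 + t) ^ k * exp (- t) * (1 + t)\<^sup>2"
      by (intro mult_right_mono) auto
    \<comment> \<open>One factor e compensates for writing e^(-t) in terms of e^(-(1+t)), after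
      which B applies at the point 1 + t.\<close>
    also have "\<dots> = ((1 + t) ^ (k + 2) * exp (- 1 * (1 + t))) * exp 1"
    proof -
      have "exp (- t) = exp (- 1 * (1 + t)) * exp 1" by (simp flip: exp_add)
      then have "(1 + t) ^ k * exp (- t) * (1 + t)\<^sup>2 =
          (1 + t) ^ k * (exp (- 1 * (1 + t)) * exp 1) * (1 + t)\<^sup>2" by (rule arg_cong)
      then show ?thesis by (simp only: power_add mult_ac)
    qed
    also have "\<dots> \<le> B * exp 1" using t by (intro mult_right_mono B) auto
    finally show ?thesis using t by (simp add: field_simps)
  qed
  have "0 \<le> B" using B[of 0] by simp
  moreover have "norm (complex_of_real (t powr \<alpha> * exp (- t))) \<le> B * exp 1 / (1 + t)\<^sup>2" if "0 < t" for t
    unfolding norm_of_real using decay[OF that] by simp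
  ultimately show ?thesis
    by (intro Lp_of_decay[where C = "B * exp 1"]) (use assms in simp_all)
qed

text \<open>
  In the variable \<open>x = e\<^bsup>-t\<^esup>\<close> the functions \<open>D_plus \<alpha> \<phi>\<close>, \<open>\<phi>\<close> a combination of exponentials
  \<open>e\<^bsup>-kt\<^esup>\<close>, are the polynomials in \<open>x\<close> times the weight \<open>t\<^sup>\<alpha> e\<^bsup>-t\<^esup>\<close>, so that Weierstrass' theorem applies.
\<close>

lemma D_plus_approximable_continuous:
  assumes \<alpha>: "0 < \<alpha>" and p: "1 \<le> p" and ab: "0 < a" "a < b"
    and h: "continuous_on UNIV h" "\<And>t. t \<notin> {a<..<b} \<Longrightarrow> h t = 0"
  shows "D_plus_approximable \<alpha> p h"
  unfolding D_plus_approximable_def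
proof (intro allI impI)
  fix e :: real assume e: "0 < e"
  let ?w = "\<lambda>t. t powr \<alpha> * exp (- t)"
  define W where "W = enn2real (Ip p (\<lambda>t. of_real (?w t)))"
  have W: "Ip p (\<lambda>t. of_real (?w t)) = ennreal W" "0 \<le> W"
    using LpD(2)[OF powr_exp_Lp[OF \<alpha> p]] by (simp_all add: W_def less_top)
  \<comment> \<open>A uniform error \<delta> in x costs at most \<delta>^p W in \<open>Ip\<close>.
    Dividing by W + 1 makes this strictly less than e and covers W = 0.\<close>
  define \<delta> where "\<delta> = (e / (W + 1)) powr (1 / p)"
  have \<delta>: "0 < \<delta>" using e W by (simp add: \<delta>_def)
  have "\<delta> powr p * W = e / (W + 1) * W" using e W p by (simp add: \<delta>_def powr_powr)
  also have "\<dots> < e" using e W by (simp add: field_simps)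
  finally have \<delta>W: "\<delta> powr p * W < e" .
  \<comment> \<open>The quotient of h by the weight, in the variable x = e^(-t). As h is supported
    between a > 0 and b, the weight stays away from 0 there, and q extends continuously by
    0.\<close>
  define q where "q x = (if exp (- b) < x \<and> x < exp (- a) then h (- ln x) / of_real (?w (- ln x)) else 0)" for x
  have "continuous_on ({exp (- b)..exp (- a)} \<union> ({..exp (- b)} \<union> {exp (- a)..})) q"
    unfolding q_def
  proof (rule continuous_on_cases)
    have pos: "0 < x" "- ln x > 0" if "x \<in> {exp (- b)..exp (- a)}" for x
    proof -
      show x: "0 < x" using that less_le_trans[OF exp_gt_zero] by auto
      have "ln x \<le> ln (exp (- a))" using that x by (subst ln_le_cancel_iff) auto
      then show "- ln x > 0" using ab by simp
    qed
    have l: "continuous_on {exp (- b)..exp (- a)} (\<lambda>x. - ln x)"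
      using pos by (intro continuous_intros) force
    have nz: "\<forall>x\<in>{exp (- b)..exp (- a)}. - ln x \<noteq> 0" "\<forall>x\<in>{exp (- b)..exp (- a)}. x \<noteq> 0"
      using pos by fastforce+
    then have "\<forall>x\<in>{exp (- b)..exp (- a)}. complex_of_real (?w (- ln x)) \<noteq> 0"
      by simp
    then show "continuous_on {exp (- b)..exp (- a)} (\<lambda>x. h (- ln x) / of_real (?w (- ln x)))"
    proof (intro continuous_intros l nz)
      show "continuous_on {exp (- b)..exp (- a)} (\<lambda>x. h (- ln x))"
        using continuous_on_compose[OF l continuous_on_subset[OF h(1)]] by (simp add: o_def)
    qed
  next
    show "\<forall>x. x \<in> {exp (- b)..exp (- a)} \<and> \<not> (exp (- b) < x \<and> x < exp (- a)) \<or>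
         x \<in> {..exp (- b)} \<union> {exp (- a)..} \<and> exp (- b) < x \<and> x < exp (- a) \<longrightarrow>
         h (- ln x) / of_real (?w (- ln x)) = 0"
    proof (intro allI impI)
      fix x
      assume "x \<in> {exp (- b)..exp (- a)} \<and> \<not> (exp (- b) < x \<and> x < exp (- a)) \<or>
         x \<in> {..exp (- b)} \<union> {exp (- a)..} \<and> exp (- b) < x \<and> x < exp (- a)"
      then have "x = exp (- b) \<or> x = exp (- a)" by auto
      then have "h (- ln x) = 0" by (auto intro!: h(2))
      then show "h (- ln x) / of_real (?w (- ln x)) = 0" by simp
    qed
  qed auto
  moreover have "{exp (- b)..exp (- a)} \<union> ({..exp (- b)} \<union> {exp (- a)..}) = UNIV" by auto
  ultimately have "continuous_on {0..1} q"
    by (metis continuous_on_subset subset_UNIV)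
  then obtain c :: "nat \<Rightarrow> complex" and d where
    c: "\<And>x. x \<in> {0..1} \<Longrightarrow> norm (q x - (\<Sum>k<d. c k * of_real x ^ k)) < \<delta>"
    using complex_Weierstrass[OF _ \<delta>] by blast
  let ?P = "\<lambda>x. \<Sum>k<d. c k * of_real x ^ k"
  define g where "g t = of_real (?w t) * ?P (exp (- t))" for t
  obtain \<phi> where \<phi>: "\<phi> \<in> schwartz_pos" "AE t in lpos. D_plus \<alpha> \<phi> t = g t"
    using D_plus_exp_sum[OF \<alpha>, of c d] unfolding g_def by blast
  have [measurable]: "h \<in> borel_measurable borel" by (rule borel_measurable_continuous_onI[OF h(1)])
  have [measurable]: "g \<in> borel_measurable borel" unfolding g_def by measurable
  have hw: "h t = of_real (?w t) * q (exp (- t))" if "0 < t" for t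
    using that h(2)[of t] by (auto simp: q_def)
  have "Ip p (\<lambda>t. g t - h t) \<le> Ip p (\<lambda>t. of_real \<delta> * of_real (?w t))"
    unfolding Ip_def
  proof (rule nn_integral_mono_AE, rule AE_lposI)
    fix t :: real assume t: "0 < t"
    have "norm (g t - h t) = ?w t * norm (q (exp (- t)) - ?P (exp (- t)))"
      unfolding hw[OF t] g_def
      by (subst right_diff_distrib [symmetric]) (simp add: norm_mult norm_minus_commute)
    also have "\<dots> \<le> ?w t * \<delta>"
      using t by (intro mult_left_mono less_imp_le[OF c]) auto
    finally have "norm (g t - h t) \<le> norm (of_real \<delta> * complex_of_real (?w t))"
      using \<delta> by (simp add: norm_mult mult_ac)
    then show "ennreal (norm (g t - h t) powr p) \<le> ennreal (norm (of_real \<delta> * complex_of_real (?w t)) powr p)"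
      using p by (intro ennreal_leI powr_mono2) auto
  qed
  also have "\<dots> = ennreal (\<delta> powr p * W)"
    using \<delta> W by (subst Ip_cmult) (auto simp: ennreal_mult)
  also have "\<dots> < ennreal e" using \<delta>W e by (intro ennreal_lessI)
  finally have close: "Ip p (\<lambda>t. g t - h t) < ennreal e" .
  \<comment> \<open>The membership of g in L^p is inherited from the Borel version given by
    \<open>D_plus_schwartz\<close>, as both agree with \<open>D_plus \<alpha> \<phi>\<close> almost
    everywhere.\<close>
  obtain g' where g': "g' \<in> Lp p" "\<And>t. 0 < t \<Longrightarrow> D_plus \<alpha> \<phi> t = g' t"
    using D_plus_schwartz[OF \<phi>(1) \<alpha> p] by blast
  have "AE t in lpos. g t = g' t"
    using \<phi>(2) AE_lpos_pos by eventually_elim (simp add: g'(2))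
  then have "Ip p g = Ip p g'" by (rule Ip_cong_AE)
  then have "g \<in> Lp p" using g'(1) by (simp add: Lp_def)
  with \<phi> close show "\<exists>\<phi>\<in>schwartz_pos. \<exists>g\<in>Lp p. (AE t in lpos. D_plus \<alpha> \<phi> t = g t) \<and> Ip p (\<lambda>t. g t - h t) < ennreal e"
    by blast
qed

text \<open>A measurable function is an almost everywhere limit of continuous ones. These are cut
  off and truncated continuously, so that the continuous case applies to each and a multiple of the
  indicator of a bounded set dominates them.\<close>

lemma D_plus_approximable_bounded:
  assumes \<alpha>: "0 < \<alpha>" and p: "1 \<le> p" and R: "1 \<le> R"
    and [measurable]: "h \<in> borel_measurable borel"
    and supp: "\<And>t. t \<notin> {1 / R..R} \<Longrightarrow> h t = 0" and bound: "\<And>t. norm (h t) \<le> R"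
  shows "D_plus_approximable \<alpha> p h"
proof -
  have "h \<in> borel_measurable lebesgue" using measurable_completion[of h lborel borel] by simp
  then have "h measurable_on UNIV" by (rule lebesgue_measurable_imp_measurable_on) simp
  then obtain N g where N: "negligible N" and g: "\<And>n. continuous_on UNIV (g n)"
    "\<And>x. x \<notin> N \<Longrightarrow> (\<lambda>n. g n x) \<longlonglongrightarrow> h x"
    unfolding measurable_on_def by auto
  \<comment> \<open>A piecewise linear cutoff: 1 on [1/R, R], where h lives, and 0 outside (1/(2R),
    2R).\<close>
  define \<theta> where "\<theta> t = max 0 (min 1 (min (2 * R * t - 1) (2 - t / R)))" for t
  \<comment> \<open>The factor R / max R |g| is the radial truncation to norm R. It is continuous
    and leaves the limit unchanged, since |h| \<le> R.\<close>
  define f where "f n t = (\<theta> t * (R / max R (norm (g n t)))) *\<^sub>R g n t" for n t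
  have \<theta>: "0 \<le> \<theta> t" "\<theta> t \<le> 1" for t by (auto simp: \<theta>_def)
  have \<theta>0: "\<theta> t = 0" if "t \<notin> {1 / (2 * R)<..<2 * R}" for t
  proof -
    have "2 * R * t \<le> 1 \<or> 2 \<le> t / R" using that R by (auto simp: field_simps not_less)
    then show ?thesis by (auto simp: \<theta>_def)
  qed
  have \<theta>1: "\<theta> t = 1" if "t \<in> {1 / R..R}" for t
  proof -
    have "2 \<le> 2 * R * t" "t / R \<le> 1" using that R by (auto simp: field_simps)
    then show ?thesis by (simp add: \<theta>_def)
  qed
  have cont: "continuous_on UNIV (f n)" for n
    unfolding f_def \<theta>_def using R
    by (intro continuous_intros g) (auto simp: max_def)
  have [measurable]: "f n \<in> borel_measurable borel" for n
    by (rule borel_measurable_continuous_onI[OF cont])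
  have nf: "norm (f n t) \<le> R" for n t
  proof -
    have "norm (f n t) = \<theta> t * (R / max R (norm (g n t)) * norm (g n t))"
      using \<theta> R by (simp add: f_def)
    also have "\<dots> \<le> 1 * R"
      using \<theta> R by (intro mult_mono) (auto simp: field_simps max_def)
    finally show ?thesis by simp
  qed
  show ?thesis
  proof (rule D_plus_approximable_limit[where f = f])
    show "D_plus_approximable \<alpha> p (f n)" for n
    proof (rule D_plus_approximable_continuous[OF \<alpha> p _ _ cont])
      show "0 < 1 / (2 * R)" using R by simp
      show "1 / (2 * R) < 2 * R"
      proof -
        have "1 / (2 * R) < 1" using R by simp
        then show ?thesis using R by linarith
      qed
      show "f n t = 0" if "t \<notin> {1 / (2 * R)<..<2 * R}" for t
        using \<theta>0[OF that] by (simp add: f_def)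
    qed
    show "(\<lambda>n. Ip p (\<lambda>t. f n t - h t)) \<longlonglongrightarrow> 0"
    proof (rule Ip_tendsto_zero[where w = "\<lambda>t. 2 * R * indicat_real {..2 * R} t"])
      have "AE t in lebesgue. t \<notin> N"
        using N by (intro AE_not_in) (simp add: negligible_iff_null_sets)
      then have "AE t in lpos. t \<notin> N"
        unfolding AE_completion_iff AE_lpos by eventually_elim simp
      then show "AE t in lpos. (\<lambda>n. f n t) \<longlonglongrightarrow> h t"
      proof eventually_elim
        case (elim t)
        have "(\<lambda>n. f n t) \<longlonglongrightarrow> (\<theta> t * (R / max R (norm (h t)))) *\<^sub>R h t"
          unfolding f_def using R by (intro tendsto_intros g(2) elim) (auto simp: max_def)
        also have "(\<theta> t * (R / max R (norm (h t)))) *\<^sub>R h t = h t"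
          using bound[of t] supp[of t] \<theta>1[of t] R by (cases "t \<in> {1 / R..R}") (auto simp: max_def)
        finally show ?case .
      qed
      show "AE t in lpos. norm (f n t - h t) \<le> 2 * R * indicat_real {..2 * R} t" for n
      proof (rule AE_lposI)
        fix t :: real
        have "norm (f n t - h t) \<le> R + R"
          using norm_triangle_ineq4[of "f n t" "h t"] nf[of n t] bound[of t] by linarith
        moreover have "f n t = 0 \<and> h t = 0" if "2 * R < t"
          using \<theta>0[of t] supp[of t] that R by (auto simp: f_def)
        ultimately show "norm (f n t - h t) \<le> 2 * R * indicat_real {..2 * R} t"
          by (auto simp: indicator_def)
      qed
      have "(\<integral>\<^sup>+t. ennreal ((2 * R * indicat_real {..2 * R} t) powr p) \<partial>lpos) =
          (\<integral>\<^sup>+t. ennreal ((2 * R) powr p) * indicator {0<..2 * R} t \<partial>lborel)"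
        by (subst nn_integral_lpos) (auto intro!: nn_integral_cong simp: indicator_def)
      also have "\<dots> < \<infinity>" using R by (simp add: nn_integral_cmult ennreal_mult_less_top)
      finally show "(\<integral>\<^sup>+t. ennreal ((2 * R * indicat_real {..2 * R} t) powr p) \<partial>lpos) < \<infinity>" .
    qed (use p in auto)
  qed (use p in auto)
qed

text \<open>Removing large values and arguments near 0 or infinity leads to the bounded case; the
  error is dominated by |h| itself.\<close>

lemma D_plus_approximable_Lp:
  assumes \<alpha>: "0 < \<alpha>" and p: "1 \<le> p" and h: "h \<in> Lp p"
  shows "D_plus_approximable \<alpha> p h"
proof -
  note [measurable] = LpD(1)[OF h]
  define f where "f n t = (if t \<in> {1 / real (Suc n)..real (Suc n)} \<and> norm (h t) \<le> real (Suc n) then h t else 0)" for n t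
  have [measurable]: "f n \<in> borel_measurable borel" for n unfolding f_def by measurable
  show ?thesis
  proof (rule D_plus_approximable_limit[where f = f])
    show "D_plus_approximable \<alpha> p (f n)" for n
      by (rule D_plus_approximable_bounded[OF \<alpha> p, of "real (Suc n)"]) (auto simp: f_def)
    show "(\<lambda>n. Ip p (\<lambda>t. f n t - h t)) \<longlonglongrightarrow> 0"
    proof (rule Ip_tendsto_zero[where w = "\<lambda>t. norm (h t)"])
      show "AE t in lpos. (\<lambda>n. f n t) \<longlonglongrightarrow> h t"
      proof (rule AE_lposI)
        fix t :: real assume t: "0 < t"
        obtain K where K: "max (max t (1 / t)) (norm (h t)) < real K" using reals_Archimedean2 by blast
        have "\<forall>\<^sub>F n in sequentially. f n t = h t"
          using eventually_ge_at_top[of K]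
        proof eventually_elim
          case (elim n)
          then have "max (max t (1 / t)) (norm (h t)) < real (Suc n)" using K by simp
          moreover from this have "1 / real (Suc n) \<le> t" using t by (simp add: field_simps)
          ultimately show ?case by (simp add: f_def)
        qed
        then show "(\<lambda>n. f n t) \<longlonglongrightarrow> h t" by (rule tendsto_eventually)
      qed
      show "AE t in lpos. norm (f n t - h t) \<le> norm (h t)" for n
        by (rule AE_lposI) (simp add: f_def)
    qed (use LpD(2)[OF h] p in \<open>auto simp: Ip_def\<close>)
  qed (use p in auto)
qed

section \<open>The spaces and the adjoint\<close>

lemma enn2real_powr_tendsto_zero_iff:
  fixes I :: "nat \<Rightarrow> ennreal"
  assumes "\<And>n. I n < \<infinity>" and p: "0 < p"
  shows "(\<lambda>n. enn2real (I n) powr (1 / p)) \<longlonglongrightarrow> 0 \<longleftrightarrow> I \<longlonglongrightarrow> 0"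
proof
  assume "(\<lambda>n. enn2real (I n) powr (1 / p)) \<longlonglongrightarrow> 0"
  then have "(\<lambda>n. (enn2real (I n) powr (1 / p)) powr p) \<longlonglongrightarrow> 0 powr p"
    by (rule tendsto_powr2) (use p in auto)
  then have "(\<lambda>n. ennreal (enn2real (I n))) \<longlonglongrightarrow> ennreal 0"
    using p by (intro tendsto_ennrealI) (simp add: powr_powr)
  then show "I \<longlonglongrightarrow> 0" using assms by simp
next
  assume "I \<longlonglongrightarrow> 0"
  then have "(\<lambda>n. enn2real (I n)) \<longlonglongrightarrow> 0" by (intro tendsto_enn2real) simp_all
  then have "(\<lambda>n. enn2real (I n) powr (1 / p)) \<longlonglongrightarrow> 0 powr (1 / p)"
    by (intro tendsto_powr2) (use p in auto)
  then show "(\<lambda>n. enn2real (I n) powr (1 / p)) \<longlonglongrightarrow> 0" using p by simp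
qed

lemma Lp_norm_tendsto_zero_iff:
  assumes f0: "\<And>n. f0 n \<in> Lp p" and g0: "g0 \<in> Lp p" and p: "0 < p"
    and eq: "\<And>n. AE t in lpos. f n t = f0 n t" "AE t in lpos. g t = g0 t"
  shows "(\<lambda>n. Lp_norm p (\<lambda>t. f n t - g t)) \<longlonglongrightarrow> 0 \<longleftrightarrow> (\<lambda>n. Ip p (\<lambda>t. f0 n t - g0 t)) \<longlonglongrightarrow> 0"
proof -
  have d: "(\<lambda>t. f0 n t - g0 t) \<in> Lp p" for n by (rule Lp_diff) (use f0 g0 p in auto)
  have "Lp_norm p (\<lambda>t. f n t - g t) = enn2real (Ip p (\<lambda>t. f0 n t - g0 t)) powr (1 / p)" for n
    by (rule Lp_norm_eq[OF LpD(1)[OF d]]) (use eq(1)[of n] eq(2) in \<open>eventually_elim, simp\<close>)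
  then show ?thesis
    using enn2real_powr_tendsto_zero_iff[of "\<lambda>n. Ip p (\<lambda>t. f0 n t - g0 t)" p] LpD(2)[OF d] p by simp
qed

lemma T_norm_diff:
  assumes \<alpha>: "0 < \<alpha>" and p: "1 \<le> p" and \<phi>: "\<phi> \<in> schwartz_pos" and \<psi>: "\<psi> \<in> schwartz_pos"
    and H: "H \<in> Lp p" "AE t in lpos. D_plus \<alpha> \<phi> t = H t" and K: "K \<in> Lp p" "AE t in lpos. D_plus \<alpha> \<psi> t = K t"
  shows "T_norm \<alpha> p (\<lambda>t. \<phi> t - \<psi> t) = enn2real (Ip p (\<lambda>t. H t - K t)) powr (1 / p)"
proof -
  have d: "(\<lambda>t. H t - K t) \<in> Lp p" by (rule Lp_diff) (use H K p in auto)
  have "AE t in lpos. D_plus \<alpha> (\<lambda>t. \<phi> t - \<psi> t) t = H t - K t"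
    using D_plus_add_cmult[OF \<phi> \<psi> \<alpha>, of "-1"] H(2) K(2) by eventually_elim simp
  then show ?thesis
    using T_norm_eq_D_plus[of \<alpha> p] Lp_norm_eq[OF LpD(1)[OF d]] \<alpha> p by simp
qed

lemma dil_tendsto:
  assumes k: "kern p k" and p: "1 \<le> p" and H: "\<And>n. H n \<in> Lp p" and h: "h \<in> Lp p"
    and lim: "(\<lambda>n. Ip p (\<lambda>t. H n t - h t)) \<longlonglongrightarrow> 0"
  shows "(\<lambda>n. Ip p (\<lambda>t. dil k (H n) t - dil k h t)) \<longlonglongrightarrow> 0"
proof -
  note [measurable] = LpD(1)[OF H] LpD(1)[OF h]
  obtain C where C: "\<And>f. f \<in> borel_measurable borel \<Longrightarrow> Ip p (dil k f) \<le> ennreal C * Ip p f"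
    using dil_bounded[OF k p] by blast
  have le: "Ip p (\<lambda>t. dil k (H n) t - dil k h t) \<le> ennreal C * Ip p (\<lambda>t. H n t - h t)" for n
  proof -
    have "AE t in lpos. dil k (H n) t - dil k h t = dil k (\<lambda>t. H n t - h t) t"
      using dil_add_cmult[OF k H[of n] h p, of "-1"] by eventually_elim simp
    then have "Ip p (\<lambda>t. dil k (H n) t - dil k h t) = Ip p (dil k (\<lambda>t. H n t - h t))"
      by (rule Ip_cong_AE)
    also have "\<dots> \<le> ennreal C * Ip p (\<lambda>t. H n t - h t)" by (rule C) measurable
    finally show ?thesis .
  qed
  have "(\<lambda>n. ennreal C * Ip p (\<lambda>t. H n t - h t)) \<longlonglongrightarrow> ennreal C * 0"
    by (rule ennreal_tendsto_cmult[OF _ lim]) simp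
  then have lim0: "(\<lambda>n. ennreal C * Ip p (\<lambda>t. H n t - h t)) \<longlonglongrightarrow> 0" by simp
  show ?thesis
    by (rule tendsto_sandwich[OF _ _ tendsto_const lim0])
      (simp, intro always_eventually allI le)
qed

lemma Ip_eq_zero_imp:
  assumes [measurable]: "f \<in> borel_measurable borel" and "Ip p f = 0"
  shows "AE t in lpos. f t = 0"
proof -
  have "AE t in lpos. ennreal (norm (f t) powr p) = 0"
    using assms(2) unfolding Ip_def by (subst (asm) nn_integral_0_iff_AE) auto
  then show ?thesis by eventually_elim simp
qed

lemma Lp_limit_unique:
  assumes F: "\<And>n. F n \<in> borel_measurable borel" and [measurable]: "f \<in> borel_measurable borel" "g \<in> borel_measurable borel"
    and lim: "(\<lambda>n. Ip p (\<lambda>t. F n t - f t)) \<longlonglongrightarrow> 0" "(\<lambda>n. Ip p (\<lambda>t. F n t - g t)) \<longlonglongrightarrow> 0" and p: "0 \<le> p"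
  shows "AE t in lpos. f t = g t"
proof -
  note [measurable] = F
  have "(\<lambda>n. ennreal (2 powr p) * (Ip p (\<lambda>t. F n t - f t) + Ip p (\<lambda>t. F n t - g t))) \<longlonglongrightarrow> ennreal (2 powr p) * (0 + 0)"
    by (intro ennreal_tendsto_cmult tendsto_add lim) simp
  moreover have "Ip p (\<lambda>t. f t - g t) \<le> ennreal (2 powr p) * (Ip p (\<lambda>t. F n t - f t) + Ip p (\<lambda>t. F n t - g t))" for n
    using Ip_diff_triangle[of f "F n" g p] p by (simp add: Ip_minus_commute[of p f])
  ultimately have "Ip p (\<lambda>t. f t - g t) \<le> ennreal (2 powr p) * (0 + 0)"
    by (intro LIMSEQ_le_const) auto
  then have "Ip p (\<lambda>t. f t - g t) = 0" by simp
  then have "AE t in lpos. f t - g t = 0" by (intro Ip_eq_zero_imp) auto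
  then show ?thesis by eventually_elim simp
qed

section \<open>Identification of the spaces with L^p\<close>

lemma D_plus_schwartz_AE:
  assumes "\<phi> \<in> schwartz_pos" "0 < \<alpha>" "1 \<le> p"
  shows "\<exists>H\<in>Lp p. (AE t in lpos. D_plus \<alpha> \<phi> t = H t) \<and> (AE t in lpos. \<phi> t = dil (jk \<alpha>) H t)"
proof -
  obtain H where H: "H \<in> Lp p" "\<And>t. 0 < t \<Longrightarrow> D_plus \<alpha> \<phi> t = H t" "AE t in lpos. dil (jk \<alpha>) H t = \<phi> t"
    using D_plus_schwartz[OF assms] by blast
  have "AE t in lpos. D_plus \<alpha> \<phi> t = H t" by (rule AE_lposI) (rule H(2))
  moreover have "AE t in lpos. \<phi> t = dil (jk \<alpha>) H t" using H(3) by eventually_elim simp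
  ultimately show ?thesis using H(1) by blast
qed

text \<open>If the fractional derivatives of \<phi> n tend to h, then \<phi> n, their image under
  the bounded operator \<open>dil (jk \<alpha>)\<close>, tends to the image of h. It also tends to
  f, and limits in L^p are unique. The result holds for any representing sequence.\<close>

lemma represents_limit:
  assumes \<alpha>: "0 < \<alpha>" and p: "1 \<le> p" and f: "f \<in> Lp_pos p" and r: "represents \<alpha> p \<phi> f"
    and h: "h \<in> Lp p" and h': "AE t in lpos. h' t = h t"
    and lim: "(\<lambda>n. Lp_norm p (\<lambda>t. D_plus \<alpha> (\<phi> n) t - h' t)) \<longlonglongrightarrow> 0"
  shows "AE t in lpos. f t = dil (jk \<alpha>) h t"
proof -
  obtain f0 where f0: "f0 \<in> Lp p" "AE t in lpos. f t = f0 t" using Lp_pos_obtain_borel[OF f] .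
  have \<phi>: "\<phi> n \<in> schwartz_pos" for n using r by (simp add: represents_def)
  have "\<exists>H\<in>Lp p. (AE t in lpos. D_plus \<alpha> (\<phi> n) t = H t) \<and> (AE t in lpos. \<phi> n t = dil (jk \<alpha>) H t)" for n
    by (rule D_plus_schwartz_AE[OF \<phi> \<alpha> p])
  then obtain H where H: "\<And>n. H n \<in> Lp p" "\<And>n. AE t in lpos. D_plus \<alpha> (\<phi> n) t = H n t"
    "\<And>n. AE t in lpos. \<phi> n t = dil (jk \<alpha>) (H n) t" by metis
  note k = kern_jk[OF \<alpha> p]
  have JH: "dil (jk \<alpha>) (H n) \<in> Lp p" "dil (jk \<alpha>) h \<in> Lp p" for n
    using dil_Lp[OF k _ p] H h by auto
  have "(\<lambda>n. Ip p (\<lambda>t. H n t - h t)) \<longlonglongrightarrow> 0"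
    using lim Lp_norm_tendsto_zero_iff[of H p h, OF H(1) h _ H(2) h'] p by simp
  then have "(\<lambda>n. Ip p (\<lambda>t. dil (jk \<alpha>) (H n) t - dil (jk \<alpha>) h t)) \<longlonglongrightarrow> 0"
    by (rule dil_tendsto[OF k p H(1) h])
  moreover have "(\<lambda>n. Lp_norm p (\<lambda>t. \<phi> n t - f t)) \<longlonglongrightarrow> 0"
    using r by (simp add: represents_def)
  then have "(\<lambda>n. Ip p (\<lambda>t. dil (jk \<alpha>) (H n) t - f0 t)) \<longlonglongrightarrow> 0"
    using Lp_norm_tendsto_zero_iff[of "\<lambda>n. dil (jk \<alpha>) (H n)" p f0, OF JH(1) f0(1) _ H(3) f0(2)] p by simp
  ultimately have "AE t in lpos. dil (jk \<alpha>) h t = f0 t"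
    using p by (intro Lp_limit_unique[where F = "\<lambda>n. dil (jk \<alpha>) (H n)"] LpD(1)[OF JH(1)] LpD(1)[OF JH(2)] LpD(1)[OF f0(1)]) auto
  with f0(2) show ?thesis by eventually_elim simp
qed

text \<open>The order 0 is set apart because its kernel would be a point mass at u = 1; with it as
  the identity, both cases of the spaces are treated at once.\<close>

definition Jop :: "real \<Rightarrow> (real \<Rightarrow> complex) \<Rightarrow> real \<Rightarrow> complex" where
  "Jop \<alpha> h = (if \<alpha> = 0 then h else dil (jk \<alpha>) h)"

lemma Jop_Lp: "0 \<le> \<alpha> \<Longrightarrow> 1 \<le> p \<Longrightarrow> h \<in> Lp p \<Longrightarrow> Jop \<alpha> h \<in> Lp p"
  by (auto simp: Jop_def intro!: dil_Lp kern_jk)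

text \<open>\<open>T_norm\<close> is the L^p norm of the fractional derivative, so along a
  representing sequence these derivatives are Cauchy. Their limit shows that the choice in
  \<open>D_ext\<close> has a witness.\<close>

lemma T_space_D_ext:
  assumes \<alpha>: "0 \<le> \<alpha>" and p: "1 \<le> p" and f: "f \<in> T_space \<alpha> p"
  obtains h where "h \<in> Lp p" "AE t in lpos. D_ext \<alpha> p f t = h t" "AE t in lpos. f t = Jop \<alpha> h t"
proof (cases "\<alpha> = 0")
  case True
  then have "f \<in> Lp_pos p" using f by (simp add: T_space_def)
  then obtain h where "h \<in> Lp p" "AE t in lpos. f t = h t" by (rule Lp_pos_obtain_borel)
  with True that show ?thesis by (simp add: D_ext_def Jop_def)
next
  case False
  then have \<alpha>: "0 < \<alpha>" using assms by simp
  have fL: "f \<in> Lp_pos p" and "\<exists>\<phi>. represents \<alpha> p \<phi> f" using f False by (auto simp: T_space_def)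
  then obtain \<phi> where r: "represents \<alpha> p \<phi> f" by blast
  have \<phi>: "\<phi> n \<in> schwartz_pos" for n using r by (simp add: represents_def)
  have "\<exists>H\<in>Lp p. (AE t in lpos. D_plus \<alpha> (\<phi> n) t = H t)" for n
    using D_plus_schwartz_AE[OF \<phi> \<alpha> p] by blast
  then obtain H where H: "\<And>n. H n \<in> Lp p" "\<And>n. AE t in lpos. D_plus \<alpha> (\<phi> n) t = H n t" by metis
  obtain h where h: "h \<in> Lp p" "(\<lambda>n. Ip p (\<lambda>t. H n t - h t)) \<longlonglongrightarrow> 0"
  proof (rule Lp_complete[OF H(1) p])
    fix e :: real assume e: "0 < e"
    then have "0 < e powr (1 / p)" by simp
    then obtain N where N: "\<And>m n. N \<le> m \<Longrightarrow> N \<le> n \<Longrightarrow> T_norm \<alpha> p (\<lambda>t. \<phi> m t - \<phi> n t) < e powr (1 / p)"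
      using r unfolding represents_def by meson
    have "Ip p (\<lambda>t. H m t - H n t) < ennreal e" if "N \<le> m" "N \<le> n" for m n
    proof -
      let ?I = "Ip p (\<lambda>t. H m t - H n t)"
      have fin: "?I < \<infinity>" using LpD(2)[OF Lp_diff[OF H(1) H(1)]] p by simp
      have "enn2real ?I powr (1 / p) < e powr (1 / p)"
        using N[OF that] T_norm_diff[OF \<alpha> p \<phi> \<phi> H(1) H(2) H(1) H(2)] by simp
      then have "enn2real ?I < e"
      proof (rule contrapos_pp)
        assume "\<not> enn2real ?I < e"
        then have "e powr (1 / p) \<le> enn2real ?I powr (1 / p)"
          using e p by (intro powr_mono2) auto
        then show "\<not> enn2real ?I powr (1 / p) < e powr (1 / p)" by simp
      qed
      then have "ennreal (enn2real ?I) < ennreal e" using e by (intro ennreal_lessI) auto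
      then show ?thesis using fin by simp
    qed
    then show "\<exists>N. \<forall>m\<ge>N. \<forall>n\<ge>N. Ip p (\<lambda>t. H m t - H n t) < ennreal e" by blast
  qed
  let ?P = "\<lambda>h. h \<in> Lp_pos p \<and> (\<exists>\<phi>. represents \<alpha> p \<phi> f \<and> (\<lambda>n. Lp_norm p (\<lambda>t. D_plus \<alpha> (\<phi> n) t - h t)) \<longlonglongrightarrow> 0)"
  have "?P h"
  proof
    show "h \<in> Lp_pos p" using Lp_pos_iff[of h h] h LpD by auto
    have "(\<lambda>n. Lp_norm p (\<lambda>t. D_plus \<alpha> (\<phi> n) t - h t)) \<longlonglongrightarrow> 0"
      using h Lp_norm_tendsto_zero_iff[of H p h, OF H(1) h(1) _ H(2)] p by simp
    with r show "\<exists>\<phi>. represents \<alpha> p \<phi> f \<and> (\<lambda>n. Lp_norm p (\<lambda>t. D_plus \<alpha> (\<phi> n) t - h t)) \<longlonglongrightarrow> 0" by blast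
  qed
  \<comment> \<open>The chosen function may belong to another representing sequence than the one at
    hand; \<open>represents_limit\<close> applies to either.\<close>
  then have "?P (SOME h. ?P h)" by (rule someI[of ?P])
  then have D: "?P (D_ext \<alpha> p f)" using False by (simp add: D_ext_def)
  then obtain h1 where h1: "h1 \<in> Lp p" "AE t in lpos. D_ext \<alpha> p f t = h1 t"
    using Lp_pos_obtain_borel by blast
  have "AE t in lpos. f t = dil (jk \<alpha>) h1 t"
    using D represents_limit[OF \<alpha> p fL _ h1] by blast
  with h1 False that show ?thesis by (simp add: Jop_def)
qed

text \<open>Converse of \<open>T_space_D_ext\<close>: by density h is a limit of fractional
  derivatives of Schwartz functions, and these Schwartz functions represent the image of h.
  Injectivity of \<open>Jop \<alpha>\<close> then forces \<open>D_ext\<close> to return h.\<close>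

lemma T_space_Jop:
  assumes \<alpha>: "0 \<le> \<alpha>" and p: "1 \<le> p" and h: "h \<in> Lp p" and f: "AE t in lpos. f t = Jop \<alpha> h t"
  shows "f \<in> T_space \<alpha> p" and "AE t in lpos. D_ext \<alpha> p f t = h t"
proof -
  have J: "Jop \<alpha> h \<in> Lp p" by (rule Jop_Lp[OF \<alpha> p h])
  have fL: "f \<in> Lp_pos p" using Lp_pos_iff[OF LpD(1)[OF J] f] J by simp
  show fT: "f \<in> T_space \<alpha> p"
  proof (cases "\<alpha> = 0")
    case False
    then have \<alpha>: "0 < \<alpha>" using assms by simp
    note k = kern_jk[OF \<alpha> p]
    have "\<exists>\<phi>\<in>schwartz_pos. \<exists>g\<in>Lp p. (AE t in lpos. D_plus \<alpha> \<phi> t = g t) \<and>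
        Ip p (\<lambda>t. g t - h t) < ennreal (1 / real (Suc n))" for n
      using D_plus_approximable_Lp[OF \<alpha> p h] by (simp add: D_plus_approximable_def)
    then obtain \<phi> g where \<phi>: "\<And>n. \<phi> n \<in> schwartz_pos" and g: "\<And>n. g n \<in> Lp p"
      and Dg: "\<And>n. AE t in lpos. D_plus \<alpha> (\<phi> n) t = g n t"
      and close: "\<And>n. Ip p (\<lambda>t. g n t - h t) < ennreal (1 / real (Suc n))"
      by metis
    note [measurable] = LpD(1)[OF g] LpD(1)[OF h]
    have "(\<lambda>n. ennreal (1 / real (Suc n))) \<longlonglongrightarrow> ennreal 0"
      by (intro tendsto_ennrealI LIMSEQ_Suc[OF lim_1_over_n])
    then have lim0: "(\<lambda>n. ennreal (1 / real (Suc n))) \<longlonglongrightarrow> 0" by (simp only: ennreal_0)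
    have lim: "(\<lambda>n. Ip p (\<lambda>t. g n t - h t)) \<longlonglongrightarrow> 0"
      by (rule tendsto_sandwich[OF _ _ tendsto_const lim0])
        (simp, intro always_eventually allI less_imp_le close)
    have J\<phi>: "AE t in lpos. \<phi> n t = dil (jk \<alpha>) (g n) t" for n
    proof -
      obtain H where H: "H \<in> Lp p" "\<And>t. 0 < t \<Longrightarrow> D_plus \<alpha> (\<phi> n) t = H t" "AE t in lpos. dil (jk \<alpha>) H t = \<phi> n t"
        using D_plus_schwartz[OF \<phi> \<alpha> p] by blast
      note [measurable] = LpD(1)[OF H(1)]
      have "AE t in lpos. H t = g n t"
        using Dg[of n] AE_lpos_pos by eventually_elim (simp add: H(2))
      then have eqJ: "dil (jk \<alpha>) H t = dil (jk \<alpha>) (g n) t" if "0 < t" for t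
        using that by (intro dil_cong_AE) auto
      show ?thesis using H(3) AE_lpos_pos by eventually_elim (simp add: eqJ)
    qed
    have "represents \<alpha> p \<phi> f"
      unfolding represents_def
    proof (intro conjI allI impI \<phi>)
      have "(\<lambda>n. Ip p (\<lambda>t. dil (jk \<alpha>) (g n) t - dil (jk \<alpha>) h t)) \<longlonglongrightarrow> 0"
        by (rule dil_tendsto[OF k p g h lim])
      then show "(\<lambda>n. Lp_norm p (\<lambda>t. \<phi> n t - f t)) \<longlonglongrightarrow> 0"
        using Lp_norm_tendsto_zero_iff[of "\<lambda>n. dil (jk \<alpha>) (g n)" p "dil (jk \<alpha>) h" \<phi> f] f J\<phi> p g h False
          dil_Lp[OF k _ p] by (simp add: Jop_def)
    next
      fix e :: real assume e: "0 < e"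
      \<comment> \<open>Chosen so that 2^p times 2 e' is (e/2)^p; its p-th root e/2 leaves room for
        the strict inequality.\<close>
      define e' where "e' = (e / 2) powr p / 2 powr p / 2"
      have e': "0 < e'" using e by (simp add: e'_def)
      have "\<forall>\<^sub>F n in sequentially. Ip p (\<lambda>t. g n t - h t) < ennreal e'"
        by (rule order_tendstoD[OF lim]) (use e' in simp)
      then obtain N where N: "\<And>n. N \<le> n \<Longrightarrow> Ip p (\<lambda>t. g n t - h t) < ennreal e'"
        by (auto simp: eventually_sequentially)
      have "T_norm \<alpha> p (\<lambda>t. \<phi> m t - \<phi> n t) < e" if "N \<le> m" "N \<le> n" for m n
      proof -
        have "Ip p (\<lambda>t. g m t - g n t) \<le> ennreal (2 powr p) * (Ip p (\<lambda>t. g m t - h t) + Ip p (\<lambda>t. h t - g n t))"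
          by (rule Ip_diff_triangle) (use p in auto)
        also have "\<dots> \<le> ennreal (2 powr p) * (ennreal e' + ennreal e')"
          unfolding Ip_minus_commute[of p h]
          by (intro mult_left_mono add_mono less_imp_le[OF N] that) auto
        also have "\<dots> = ennreal ((e / 2) powr p)"
          using e' by (simp add: ennreal_plus[symmetric] ennreal_mult' [symmetric] e'_def del: ennreal_plus)
        finally have "enn2real (Ip p (\<lambda>t. g m t - g n t)) \<le> (e / 2) powr p"
          using enn2real_mono[of _ "ennreal ((e / 2) powr p)"] by simp
        then have "enn2real (Ip p (\<lambda>t. g m t - g n t)) powr (1 / p) \<le> ((e / 2) powr p) powr (1 / p)"
          using p by (intro powr_mono2) auto
        also have "\<dots> < e" using e p by (simp add: powr_powr)
        finally show ?thesis
          using T_norm_diff[OF \<alpha> p \<phi> \<phi> g Dg g Dg] by simp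
      qed
      then show "\<exists>N. \<forall>m\<ge>N. \<forall>n\<ge>N. T_norm \<alpha> p (\<lambda>t. \<phi> m t - \<phi> n t) < e" by blast
    qed
    with fL False show ?thesis by (auto simp: T_space_def)
  qed (use fL in \<open>simp add: T_space_def\<close>)
  obtain h1 where h1: "h1 \<in> Lp p" "AE t in lpos. D_ext \<alpha> p f t = h1 t" "AE t in lpos. f t = Jop \<alpha> h1 t"
    using T_space_D_ext[OF \<alpha> p fT] .
  have eq: "AE t in lpos. Jop \<alpha> h1 t = Jop \<alpha> h t" using f h1(3) by eventually_elim simp
  have "AE t in lpos. h1 t = h t"
  proof (cases "\<alpha> = 0")
    case False
    then show ?thesis
      using jk_injective[of \<alpha> p h1 h] eq \<alpha> p h h1 by (simp add: Jop_def)
  qed (use eq in \<open>simp add: Jop_def\<close>)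
  then show "AE t in lpos. D_ext \<alpha> p f t = h t" using h1(2) by eventually_elim simp
qed

lemma T_space_subset_Lp_pos: "T_space \<alpha> p \<subseteq> Lp_pos p"
  by (auto simp: T_space_def)

text \<open>In the coordinate h of f the Stieltjes operator acts by the same kernel as on L^p,
  because it commutes with the dilation operator \<open>Jop \<alpha>\<close>.\<close>

lemma stieltjes_Jop:
  assumes \<alpha>: "0 \<le> \<alpha>" and p: "1 \<le> p" and b: "0 < b - 1 / p" "b - 1 / p < m"
    and h: "h \<in> Lp p" and f: "AE t in lpos. f t = Jop \<alpha> h t"
  shows "AE t in lpos. stieltjes b m f t = Jop \<alpha> (dil (sk b m) h) t"
proof -
  note k = kern_sk[OF b]
  have J: "Jop \<alpha> h \<in> Lp p" by (rule Jop_Lp[OF \<alpha> p h])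
  have "AE t in lpos. stieltjes b m f t = dil (sk b m) (Jop \<alpha> h) t"
    by (rule AE_lposI) (rule stieltjes_eq_dil[OF LpD(1)[OF J] f])
  moreover have "AE t in lpos. dil (sk b m) (Jop \<alpha> h) t = Jop \<alpha> (dil (sk b m) h) t"
    using dil_commute[OF k kern_jk h p, of \<alpha>] \<alpha> p by (auto simp: Jop_def)
  ultimately show ?thesis by eventually_elim simp
qed

lemma Jop_cong_AE:
  assumes "g \<in> borel_measurable borel" "h \<in> borel_measurable borel" "AE t in lpos. g t = h t"
  shows "AE t in lpos. Jop \<alpha> g t = Jop \<alpha> h t"
  using assms dil_cong_AE[OF jk_measurable assms] by (auto simp: Jop_def intro!: AE_lposI)

section \<open>The adjoint of a Stieltjes operator\<close>

lemma T_pairing_eq: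
  assumes u: "u0 \<in> Lp p" "AE t in lpos. D_ext \<alpha> p u t = u0 t"
    and g: "g0 \<in> Lp q" "AE t in lpos. D_ext \<alpha> q g t = g0 t"
  shows "T_pairing \<alpha> p q u g = (LINT t|lpos. u0 t * g0 t)"
  unfolding T_pairing_def
proof (rule integral_lebesgue_on_pos)
  note [measurable] = LpD(1)[OF u(1)] LpD(1)[OF g(1)]
  show "(\<lambda>t. u0 t * g0 t) \<in> borel_measurable borel" by measurable
  show "AE t in lpos. D_ext \<alpha> p u t * D_ext \<alpha> q g t = u0 t * g0 t"
    using u(2) g(2) by eventually_elim simp
qed

text \<open>In the coordinates of \<open>D_ext\<close> the pairing is the plain integral of a
  product, so the transposed Stieltjes operator meets the condition behind \<open>SOME\<close>. Any
  other function meeting it has a coordinate that differs from this one by something annihilating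
  all of L^q, hence agrees with it almost everywhere.\<close>

lemma T_adjoint_stieltjes:
  assumes \<alpha>: "0 \<le> \<alpha>" and p: "1 < p" and pq: "1 / p + 1 / q = 1"
    and \<gamma>: "0 < \<gamma> - 1 / q" "\<gamma> - 1 / q < \<nu>" and f: "f \<in> T_space \<alpha> p"
  shows "AE t in lpos. T_adjoint \<alpha> p q (stieltjes \<gamma> \<nu>) f t = stieltjes (\<nu> - \<gamma> + 1) \<nu> f t"
proof -
  have "1 / q = 1 - 1 / p" "0 < 1 / p" "1 / p < 1" using p pq by auto
  then have "0 < 1 / q" "1 / q < 1" by linarith+
  then have q: "1 \<le> q" by (simp add: divide_less_eq)
  have p1: "1 \<le> p" using p by simp
  \<comment> \<open>By 1/p + 1/q = 1 the middle quantity equals \<nu> - (\<gamma> - 1/q), the mirror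
    image of the assumed one in (0, \<nu>).\<close>
  have \<gamma>': "0 < (\<nu> - \<gamma> + 1) - 1 / p" "(\<nu> - \<gamma> + 1) - 1 / p < \<nu>" using \<gamma> pq by linarith+
  let ?k = "sk \<gamma> \<nu>" and ?k' = "sk (\<nu> - \<gamma> + 1) \<nu>"
  note k = kern_sk[OF \<gamma>] and k' = kern_sk[OF \<gamma>']
  have kk': "?k v = ?k' (1 / v) / v" if "0 < v" for v
  proof -
    have "1 + 1 / v = (1 + v) / v" using that by (simp add: field_simps)
    then show ?thesis
      using that by (simp add: sk_def powr_divide powr_diff powr_add field_simps)
  qed
  obtain h where h: "h \<in> Lp p" "AE t in lpos. D_ext \<alpha> p f t = h t" "AE t in lpos. f t = Jop \<alpha> h t"
    using T_space_D_ext[OF \<alpha> p1 f] .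
  have k'h: "dil ?k' h \<in> Lp p" by (rule dil_Lp[OF k' h(1) p1])
  have kl: "dil ?k l \<in> Lp q" if "l \<in> Lp q" for l by (rule dil_Lp[OF k that q])
  have adj: "(LINT t|lpos. dil ?k' h t * l t) = (LINT t|lpos. h t * dil ?k l t)" if "l \<in> Lp q" for l
    by (rule dil_transpose[OF k' k h(1) that p pq kk'])
  have SJ: "AE t in lpos. stieltjes (\<nu> - \<gamma> + 1) \<nu> f t = Jop \<alpha> (dil ?k' h) t"
    by (rule stieltjes_Jop[OF \<alpha> p1 \<gamma>' h(1,3)])
  note Sf = T_space_Jop[OF \<alpha> p1 k'h SJ]
  have pair: "T_pairing \<alpha> p q f (stieltjes \<gamma> \<nu> g) = (LINT t|lpos. h t * dil ?k l t)"
    if l: "l \<in> Lp q" and g: "AE t in lpos. g t = Jop \<alpha> l t" for g l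
    by (rule T_pairing_eq[OF h(1,2) kl[OF l] T_space_Jop(2)[OF \<alpha> q kl[OF l] stieltjes_Jop[OF \<alpha> q \<gamma> l g]]])
  define P where "P u \<longleftrightarrow> u \<in> T_space \<alpha> p \<and>
    (\<forall>g\<in>T_space \<alpha> q. T_pairing \<alpha> p q u g = T_pairing \<alpha> p q f (stieltjes \<gamma> \<nu> g))" for u
  have "P (stieltjes (\<nu> - \<gamma> + 1) \<nu> f)"
    unfolding P_def
  proof (intro conjI ballI Sf(1))
    fix g assume "g \<in> T_space \<alpha> q"
    then obtain l where l: "l \<in> Lp q" "AE t in lpos. D_ext \<alpha> q g t = l t" "AE t in lpos. g t = Jop \<alpha> l t"
      using T_space_D_ext[OF \<alpha> q] by blast
    show "T_pairing \<alpha> p q (stieltjes (\<nu> - \<gamma> + 1) \<nu> f) g = T_pairing \<alpha> p q f (stieltjes \<gamma> \<nu> g)"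
      unfolding T_pairing_eq[OF k'h Sf(2) l(1,2)] pair[OF l(1,3)] by (rule adj[OF l(1)])
  qed
  then have "P (SOME u. P u)" by (rule someI[of P])
  then have PT: "P (T_adjoint \<alpha> p q (stieltjes \<gamma> \<nu>) f)" (is "P ?u")
    by (simp add: T_adjoint_def P_def)
  then have "?u \<in> T_space \<alpha> p" by (simp add: P_def)
  then obtain w where w: "w \<in> Lp p" "AE t in lpos. D_ext \<alpha> p ?u t = w t" "AE t in lpos. ?u t = Jop \<alpha> w t"
    using T_space_D_ext[OF \<alpha> p1] by blast
  have d: "(\<lambda>t. w t - dil ?k' h t) \<in> Lp p" by (rule Lp_diff[OF w(1) k'h]) (use p in simp)
  \<comment> \<open>Every l in L^q is the coordinate of an element, namely
    \<open>Jop \<alpha> l\<close>, so the defining property of the adjoint can be tested against all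
    of L^q.\<close>
  have "AE t in lpos. w t - dil ?k' h t = 0"
  proof (rule Lp_eq_zero_if_annihilates[OF d p pq])
    fix l assume l: "l \<in> Lp q"
    have J: "AE t in lpos. Jop \<alpha> l t = Jop \<alpha> l t" by simp
    note Jl = T_space_Jop[OF \<alpha> q l J]
    have "(LINT t|lpos. w t * l t) = T_pairing \<alpha> p q ?u (Jop \<alpha> l)"
      by (rule T_pairing_eq[OF w(1,2) l Jl(2), symmetric])
    also have "\<dots> = T_pairing \<alpha> p q f (stieltjes \<gamma> \<nu> (Jop \<alpha> l))"
      using PT Jl(1) by (simp add: P_def)
    also have "\<dots> = (LINT t|lpos. dil ?k' h t * l t)"
      unfolding pair[OF l J] by (rule adj[OF l, symmetric])
    finally have "(LINT t|lpos. w t * l t) - (LINT t|lpos. dil ?k' h t * l t) = 0" by simp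
    then show "(LINT t|lpos. (w t - dil ?k' h t) * l t) = 0"
      using Lp_mult_integrable[OF w(1) l p pq] Lp_mult_integrable[OF k'h l p pq]
      by (simp add: left_diff_distrib)
  qed
  then have "AE t in lpos. w t = dil ?k' h t" by eventually_elim simp
  then have "AE t in lpos. Jop \<alpha> w t = Jop \<alpha> (dil ?k' h) t"
    by (rule Jop_cong_AE[OF LpD(1)[OF w(1)] LpD(1)[OF k'h]])
  with w(3) SJ show ?thesis by eventually_elim simp
qed

theorem theorem10:
  fixes \<alpha> p \<beta> \<mu> :: real
  assumes "0 \<le> \<alpha>" and "1 \<le> p" and "0 < \<beta> - 1 / p" and "\<beta> - 1 / p < \<mu>"
  shows
    "(\<forall>\<gamma> \<nu>. 0 < \<gamma> - 1 / p \<and> \<gamma> - 1 / p < \<nu> \<longrightarrow>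
       (\<forall>f \<in> T_space \<alpha> p. AE t in lebesgue_on {0<..}.
          let k1 = (\<lambda>s. (s powr (\<beta> - 1) / t powr \<beta> *
                     hyp2F1 \<mu> (\<beta> + \<nu> - \<gamma>) (\<mu> + \<nu>) (1 - s / t)) *\<^sub>R f s);
              k2 = (\<lambda>s. (t powr (\<mu> - \<beta>) / s powr (\<mu> - \<beta> + 1) *
                     hyp2F1 \<mu> (\<gamma> + \<mu> - \<beta>) (\<mu> + \<nu>) (1 - t / s)) *\<^sub>R f s)
          in set_integrable lebesgue {0<..<t} k1 \<and> set_integrable lebesgue {t<..} k2 \<and>
             stieltjes \<beta> \<mu> (stieltjes \<gamma> \<nu> f) t /\<^sub>R Beta (\<beta> + \<nu> - \<gamma>) (\<gamma> + \<mu> - \<beta>) =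
             (LINT s:{0<..<t}|lebesgue. k1 s) + (LINT s:{t<..}|lebesgue. k2 s))) \<and>
     (\<forall>q \<gamma> \<nu>. 1 < p \<and> 1 / p + 1 / q = 1 \<and> 0 < \<gamma> - 1 / q \<and> \<gamma> - 1 / q < \<nu> \<longrightarrow>
       (\<forall>f \<in> T_space \<alpha> p. AE t in lebesgue_on {0<..}.
          let k1 = (\<lambda>s. (s powr (\<beta> - 1) / t powr \<beta> *
                     hyp2F1 \<mu> (\<beta> + \<gamma> - 1) (\<mu> + \<nu>) (1 - s / t)) *\<^sub>R f s);
              k2 = (\<lambda>s. (t powr (\<mu> - \<beta>) / s powr (\<mu> - \<beta> + 1) *
                     hyp2F1 \<mu> (\<nu> - \<gamma> + \<mu> - \<beta> + 1) (\<mu> + \<nu>) (1 - t / s)) *\<^sub>R f s)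
          in set_integrable lebesgue {0<..<t} k1 \<and> set_integrable lebesgue {t<..} k2 \<and>
             stieltjes \<beta> \<mu> (T_adjoint \<alpha> p q (stieltjes \<gamma> \<nu>) f) t
               /\<^sub>R Beta (\<beta> + \<gamma> - 1) (\<nu> - \<gamma> + \<mu> - \<beta> + 1) =
             (LINT s:{0<..<t}|lebesgue. k1 s) + (LINT s:{t<..}|lebesgue. k2 s)))"
proof (intro conjI allI impI ballI, goal_cases)
  case (1 \<gamma> \<nu> f)
  then show ?case
    by (intro stieltjes_compose[OF assms(2-4)]) (use T_space_subset_Lp_pos in auto)
next
  case (2 q \<gamma> \<nu> f)
  have "0 < (\<nu> - \<gamma> + 1) - 1 / p" "(\<nu> - \<gamma> + 1) - 1 / p < \<nu>" using 2(1) by linarith+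
  moreover have "f \<in> Lp_pos p" using 2(2) T_space_subset_Lp_pos by blast
  moreover have "AE t in lpos. T_adjoint \<alpha> p q (stieltjes \<gamma> \<nu>) f t = stieltjes (\<nu> - \<gamma> + 1) \<nu> f t"
    using 2 assms(1) by (intro T_adjoint_stieltjes) auto
  \<comment> \<open>The parameter \<nu> - \<gamma> + 1 of the transposed operator, put in place of
    \<gamma> in the first formula, produces the parameters of the second.\<close>
  moreover have "\<beta> + \<nu> - (\<nu> - \<gamma> + 1) = \<beta> + \<gamma> - 1" "(\<nu> - \<gamma> + 1) + \<mu> - \<beta> = \<nu> - \<gamma> + \<mu> - \<beta> + 1"
    by simp_all
  ultimately show ?case
    using stieltjes_compose[OF assms(2-4), of "\<nu> - \<gamma> + 1" \<nu> f "T_adjoint \<alpha> p q (stieltjes \<gamma> \<nu>) f"]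
    by (simp only:)
qed

end
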